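(* For any positive integer $k$ and any even positive integer $t$, $$\sum_{\lambda\in\mathcal{SC}}q^{|\lambda|}x^{|\mathcal{H}_t(\lambda)|}b^{\mathrm{BG}(\lambda)}\prod_{h\in\mathcal{H}_t(\lambda)}\frac{1}{h}\sum_{h\in\mathcal{H}_t(\lambda)}h^{2k}$$ $$=t^{2k+1}\left(q^{2t};q^{2t}\right)_{\infty}^{t/2}\left(-bq;q^4\right)_{\infty}\left(-q^3/b;q^4\right)_{\infty}\exp \left(\frac{x^2q^{2t}}{2t}\right)\sum_{i=0}^k T(k+1,i+1)\,C(i)\left(\frac{x^2q^{2t}}{t^2}\right)^{i+1}.$$
   Context: A partition is a finite nonincreasing sequence $\lambda=(\lambda_1,\dots,\lambda_\ell)$ of positive integers (the empty partition is allowed), and $|\lambda|$ is the sum of its parts. A partition is identified with its Ferrers diagram, the set of boxes $(i,j)$ (row $i$, column $j$) with $1\le j\le\lambda_i$. The conjugate $\lambda'$ is given by $\lambda'_j=\#\{i:\lambda_i\ge j\}$; $\mathcal{SC}$ is the set of self-conjugate partitions ($\lambda=\lambda'$). The hook-length of a box $(i,j)$ is $\lambda_i-j+\lambda'_j-i+1$; $\mathcal{H}_t(\lambda)$ is the multiset of hook-lengths of $\lambda$ divisible by $t$ (cardinality, products and sums are taken with multiplicity; empty products are $1$, empty sums are $0$). The BG-rank is $\mathrm{BG}(\lambda)=\sum_{(i,j)\in\lambda}(-1)^{i+j}$. Also $(a;q)_\infty=\prod_{j\ge0}(1-aq^j)$. For $i\ge0$, $C(i):=\frac{1}{2(i+1)^2}\binom{2i}{i}\binom{2i+2}{i+1}$.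 The central factorial numbers $T(k,i)$ are defined by $T(k,0)=T(0,i)=0$, $T(1,1)=1$, and $T(k,i)=i^2T(k-1,i)+T(k-1,i-1)$ for $k,i\ge1$, $(k,i)\neq(1,1)$. The identity is one of formal power series in $q$ whose coefficients are polynomials in $x,b,b^{-1}$. *)

theory Defs
  imports
    "HOL-Analysis.Analysis"
    "HOL-Computational_Algebra.Formal_Power_Series"
    "HOL-Computational_Algebra.Polynomial"
    "HOL-Library.Multiset"
    "HOL-Library.Poly_Mapping"
begin

definition is_partition :: "nat list \<Rightarrow> bool" where
  "is_partition p \<longleftrightarrow> sorted_wrt (\<ge>) p \<and> 0 \<notin> set p"

(* Rows, columns and parts are numbered from 1; parts beyond the length are 0. *)
definition part :: "nat list \<Rightarrow> nat \<Rightarrow> nat" where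
  "part p i = (if 1 \<le> i \<and> i \<le> length p then p ! (i - 1) else 0)"

definition col_length :: "nat list \<Rightarrow> nat \<Rightarrow> nat" where
  "col_length p j = card {i \<in> {1..length p}. part p i \<ge> j}"

(* The positive column lengths are exactly those in columns 1, ..., part p 1. *)
definition conjugate :: "nat list \<Rightarrow> nat list" where
  "conjugate p = map (col_length p) [1..<Suc (part p 1)]"

definition self_conjugate :: "nat list set" where
  "self_conjugate = {p. is_partition p \<and> conjugate p = p}"

definition diagram :: "nat list \<Rightarrow> (nat \<times> nat) set" where
  "diagram p = (SIGMA i:{1..length p}. {1..part p i})"

(* No subtraction truncates when (i, j) is a box of the diagram of a partition. *)
definition hook_length :: "nat list \<Rightarrow> nat \<times> nat \<Rightarrow> nat" where
  "hook_length p = (\<lambda>(i, j). (part p i - j) + (col_length p j - i) + 1)"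

definition hooks_div :: "nat \<Rightarrow> nat list \<Rightarrow> nat multiset" where
  "hooks_div t p =
     {#h \<in># image_mset (hook_length p) (mset_set (diagram p)). t dvd h#}"

definition BG_rank :: "nat list \<Rightarrow> int" where
  "BG_rank p = (\<Sum>(i, j)\<in>diagram p. (-1) ^ (i + j))"

definition C_coeff :: "nat \<Rightarrow> rat" where
  "C_coeff i = 1 / (2 * of_nat (i + 1) ^ 2)
     * of_nat ((2 * i) choose i) * of_nat ((2 * i + 2) choose (i + 1))"

fun central_factorial :: "nat \<Rightarrow> nat \<Rightarrow> nat" where
  "central_factorial k 0 = 0"
| "central_factorial 0 (Suc i) = 0"
| "central_factorial (Suc k) (Suc i) =
     (if k = 0 \<and> i = 0 then 1
      else (Suc i)^2 * central_factorial k (Suc i) + central_factorial k i)"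

(* The ring of polynomials in x, b, 1/b over the rationals: finitely supported maps
   from integer exponents of b to rational polynomials in x, under convolution. *)
type_synonym laurent = "int \<Rightarrow>\<^sub>0 rat poly"

definition scalar :: "rat \<Rightarrow> laurent" where
  "scalar r = Poly_Mapping.single 0 [:r:]"

definition x_var :: laurent where
  "x_var = Poly_Mapping.single 0 [:0, 1:]"

(* the monomial b^n, where n may be negative *)
definition b_pow :: "int \<Rightarrow> laurent" where
  "b_pow n = Poly_Mapping.single n 1"

(* (a; z)_\<infinity>, with convergence in the library's metric (that is, coefficientwise
   stabilisation) on formal power series. *)
definition qpoch_inf :: "laurent fps \<Rightarrow> laurent fps \<Rightarrow> laurent fps" where
  "qpoch_inf a z = prodinf (\<lambda>j. 1 - a * z ^ j)"

lemma qpoch_has_prod: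
  assumes "fps_nth a 0 = 0" "fps_nth z 0 = 0"
  shows "(\<lambda>j. 1 - a * z ^ j) has_prod qpoch_inf a z"
proof -
  let ?f = "\<lambda>j. 1 - a * z ^ j"
  have z: "fps_nth (z ^ j) i = 0" if "i < j" for i j
    using startsby_zero_power_prefix[OF assms(2)] that by auto
  have az: "fps_nth (a * z ^ j) i = 0" if "i < j" for i j
    using that by (auto simp: fps_mult_nth z intro!: sum.neutral)
  have step: "fps_nth (\<Prod>j\<le>m. ?f j) n = fps_nth (\<Prod>j\<le>n. ?f j) n" if "n \<le> m" for n m
    using that
  proof (induction m rule: dec_induct)
    case (step m)
    have "fps_nth ((\<Prod>j\<le>m. ?f j) * (a * z ^ Suc m)) n = 0"
    proof (subst fps_mult_nth, intro sum.neutral ballI)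
      fix i assume "i \<in> {0..n}"
      have "n - i < Suc m" using step(1) by simp
      then show "fps_nth (\<Prod>j\<le>m. ?f j) i * fps_nth (a * z ^ Suc m) (n - i) = 0"
        using az[of "n - i" "Suc m"] by (simp del: power_Suc)
    qed
    moreover have "(\<Prod>j\<le>Suc m. ?f j) =
        (\<Prod>j\<le>m. ?f j) - (\<Prod>j\<le>m. ?f j) * (a * z ^ Suc m)"
      by (simp only: prod.atMost_Suc right_diff_distrib mult_1_right)
    ultimately show ?case using step.IH by (simp only: fps_sub_nth diff_zero)
  qed simp
  let ?P = "Abs_fps (\<lambda>n. fps_nth (\<Prod>j\<le>n. ?f j) n)"
  have lim: "(\<lambda>m. \<Prod>j\<le>m. ?f j) \<longlonglongrightarrow> ?P"
  proof (rule tendsto_fpsI)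
    fix n
    show "eventually (\<lambda>m. fps_nth (\<Prod>j\<le>m. ?f j) n = fps_nth ?P n) sequentially"
      unfolding fps_nth_Abs_fps by (rule eventually_sequentiallyI[of n]) (rule step)
  qed
  have "fps_nth ?P 0 = 1" using assms by simp
  then have "?P \<noteq> 0" by (intro notI) simp
  with lim have "raw_has_prod ?f 0 ?P" unfolding raw_has_prod_def add_0_right by (rule conjI)
  then have *: "?f has_prod ?P" unfolding has_prod_def by (rule disjI1)
  show ?thesis
    unfolding qpoch_inf_def by (rule subst[where P = "\<lambda>s. ?f has_prod s", OF has_prod_unique[OF *] *])
qed

(* fps_exp is only available over a field, so the exponential series is composed with
   f directly; this is exp f whenever f has constant term 0. *)
definition exp_fps :: "laurent fps \<Rightarrow> laurent fps" where
  "exp_fps f = fps_compose (Abs_fps (\<lambda>n. scalar (1 / fact n))) f"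

end

theory Submission
  imports Defs "HOL-Computational_Algebra.Polynomial_FPS"
begin

text \<open>
  A partition \<open>p\<close> is encoded by its Maya diagram, the set of all integers \<open>p\<^sub>i - i\<close>. Boxes become pairs
  of an element \<open>s\<close> and a smaller non-element \<open>g\<close>, with hook length \<open>s - g\<close>, so the hooks
  divisible by \<open>t\<close> are the pairs inside one residue class modulo \<open>t\<close>. For even \<open>t\<close> a
  self-conjugate diagram amounts to \<open>t / 2\<close> arbitrary diagrams, that is, to \<open>t / 2\<close> charges
  and \<open>t / 2\<close> partitions; size and BG-rank are additive, and the BG-rank depends only on the charges.
  Hence the left-hand side is a series in the charges times a power of the sum over partitions. Giving all
  partitions weight 1 and comparing with Euler's products determines the series in the charges.

  What remains are the sums over partitions of \<open>n\<close> of the squared inverse hook products, with and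
  without the factor \<open>\<Sum>h ^ (2 * k)\<close>. Adding a box of content \<open>x\<close> changes \<open>\<Sum>h ^ (2 * k)\<close> by a polynomial in \<open>x\<close> and
  the power sums of the corner contents, and averaging over Plancherel growth lowers degrees by 2; so the
  Plancherel average is a polynomial in \<open>n\<close> of degree at most \<open>k + 1\<close>. In the basis
  \<open>\<Prod>i\<le>r. (h ^ 2 - i ^ 2)\<close> this polynomial is known from its zeros \<open>0, \<dots>, r\<close> and its value at \<open>r + 1\<close>.
\<close>

section \<open>Maya diagrams and their hooks\<close>

text \<open>The reflection \<open>z \<mapsto> - 1 - z\<close> swaps beads and gaps of a
  self-conjugate diagram and exchanges the residue classes \<open>r\<close> and
  \<open>t - 1 - r\<close>. For even \<open>t\<close> no class is fixed, so every hook divisible by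
  \<open>t\<close> is counted in two mirror classes. The inverse hook product therefore becomes a
  square, and this is what makes Plancherel measure appear on each of the \<open>t / 2\<close> free
  partitions. The same doubling is the source of \<open>x^2\<close>, of \<open>q^(2t)\<close> and of
  a factor 2 which, together with the \<open>t / 2\<close> classes that may carry the power sum,
  raises \<open>t^(2k)\<close> to \<open>t^(2k+1)\<close>. The series in the charges can be read off
  from a single weight because charges and partitions vary independently: it is the same factor for
  every weight. The degree bound rests on increments: an added box changes a hook power sum by a
  polynomial in corner data, and it is the average of this change that is placed in the filtered
  algebra; summation over \<open>n\<close> then costs one degree. The numbers \<open>T(k, i)\<close>
  are the change of basis from \<open>h^(2k)\<close> to the products of \<open>h^2 - i^2\<close>,
  and \<open>C(r)\<close> is the contribution of the hook shapes of size
  \<open>r + 1\<close>.\<close>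

definition maya :: "int set \<Rightarrow> bool" where
  "maya S \<longleftrightarrow> finite (S \<inter> {0..}) \<and> finite ({..<0} - S)"

text \<open>The sum of \<open>f\<close> over the elements of \<open>S\<close>, renormalised so that it vanishes on the diagram
  \<open>{..<0}\<close> of the empty partition. For \<open>f = 1\<close> and \<open>f = id\<close> it is the charge and the
  energy; a diagram of charge 0 encodes a partition, of size equal to the energy.\<close>

definition msum :: "(int \<Rightarrow> int) \<Rightarrow> int set \<Rightarrow> int" where
  "msum f S = (\<Sum>s\<in>S \<inter> {0..}. f s) - (\<Sum>s\<in>{..<0} - S. f s)"

abbreviation charge :: "int set \<Rightarrow> int" where
  "charge \<equiv> msum (\<lambda>_. 1)"

abbreviation energy :: "int set \<Rightarrow> int" where
  "energy \<equiv> msum (\<lambda>s. s)"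

text \<open>A box of content \<open>x\<close> is added by moving a bead from position \<open>x - 1\<close> to \<open>x\<close>, so
  \<open>addable\<close> and \<open>removable\<close> list the contents of the outer and inner corners.\<close>

definition addable :: "int set \<Rightarrow> int set" where
  "addable S = {x. x - 1 \<in> S \<and> x \<notin> S}"

definition removable :: "int set \<Rightarrow> int set" where
  "removable S = {y. y \<in> S \<and> y - 1 \<notin> S}"

definition add_box :: "int \<Rightarrow> int set \<Rightarrow> int set" where
  "add_box x S = insert x (S - {x - 1})"

definition del_box :: "int \<Rightarrow> int set \<Rightarrow> int set" where
  "del_box y S = insert (y - 1) (S - {y})"

definition hook_pairs :: "int set \<Rightarrow> (int \<times> int) set" where
  "hook_pairs S = {(s, g). s \<in> S \<and> g \<notin> S \<and> g < s}"

lemma maya_insert [simp]: "maya (insert s S) \<longleftrightarrow> maya S"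
proof -
  have "{..<0} - S \<subseteq> insert s ({..<0} - insert s S)" by auto
  then have "finite ({..<0} - insert s S) \<longleftrightarrow> finite ({..<0} - S)"
    by (meson Diff_mono finite.insertI finite_subset order_refl subset_insertI)
  then show ?thesis by (auto simp: maya_def Int_insert_left)
qed

lemma maya_remove [simp]: "maya (S - {s}) \<longleftrightarrow> maya S"
  by (cases "s \<in> S") (metis insert_Diff maya_insert, simp)

lemma maya_add_box [simp]: "maya (add_box x S) \<longleftrightarrow> maya S"
  by (simp add: add_box_def)

lemma maya_del_box [simp]: "maya (del_box x S) \<longleftrightarrow> maya S"
  by (simp add: del_box_def)

lemma maya_lessThan [simp]: "maya {..<c}"
proof -
  have "{..<c} \<inter> {0..} \<subseteq> {0..c}" "{..<0} - {..<c} \<subseteq> {c..0}" by auto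
  then show ?thesis
    unfolding maya_def by (meson finite_atLeastAtMost_int finite_subset)
qed

lemma maya_bounds:
  assumes "maya S"
  obtains n where "n \<ge> 0" "\<And>z. z \<notin> S \<Longrightarrow> -n < z" "\<And>z. z \<in> S \<Longrightarrow> z < n"
proof -
  define F where "F = (S \<inter> {0..}) \<union> ({..<0} - S)"
  have F: "finite F" using assms by (simp add: F_def maya_def)
  define n where "n = 1 + (\<Sum>z\<in>F. \<bar>z\<bar>)"
  have le: "\<bar>z\<bar> < n" if "z \<in> F" for z
    using member_le_sum[of z F abs] that F by (simp add: n_def)
  have n: "n \<ge> 1" by (simp add: n_def sum_nonneg)
  show ?thesis
  proof (rule that[of n])
    show "-n < z" if "z \<notin> S" for z using le[of z] that n by (cases "z < 0") (auto simp: F_def)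
    show "z < n" if "z \<in> S" for z using le[of z] that n by (cases "z < 0") (auto simp: F_def)
  qed (use n in simp)
qed

lemma finite_hook_pairs [simp]:
  assumes "maya S" shows "finite (hook_pairs S)"
proof -
  obtain n where n: "\<And>z. z \<notin> S \<Longrightarrow> -n < z" "\<And>z. z \<in> S \<Longrightarrow> z < n"
    using maya_bounds[OF assms] by metis
  have "hook_pairs S \<subseteq> {-n..n} \<times> {-n..n}"
    using n by (fastforce simp: hook_pairs_def)
  then show ?thesis by (rule finite_subset) auto
qed

lemma finite_addable [simp]:
  assumes "maya S" shows "finite (addable S)"
proof -
  obtain n where n: "\<And>z. z \<notin> S \<Longrightarrow> -n < z" "\<And>z. z \<in> S \<Longrightarrow> z < n"
    using maya_bounds[OF assms] by metis
  have "addable S \<subseteq> {-n..n}" using n by (fastforce simp: addable_def)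
  then show ?thesis by (rule finite_subset) auto
qed

lemma finite_removable [simp]:
  assumes "maya S" shows "finite (removable S)"
proof -
  obtain n where n: "\<And>z. z \<notin> S \<Longrightarrow> -n < z" "\<And>z. z \<in> S \<Longrightarrow> z < n"
    using maya_bounds[OF assms] by metis
  have "removable S \<subseteq> {-n..n+1}" using n by (fastforce simp: removable_def)
  then show ?thesis by (rule finite_subset) auto
qed

lemma msum_insert:
  assumes "maya S" "s \<notin> S" shows "msum f (insert s S) = msum f S + f s"
proof (cases "s \<ge> 0")
  case True
  have "insert s S \<inter> {0..} = insert s (S \<inter> {0..})" "{..<0} - insert s S = {..<0} - S"
    using True by auto
  then show ?thesis using assms by (simp add: msum_def maya_def)
next
  case False
  define D where "D = {..<0} - insert s S"
  have "insert s S \<inter> {0..} = S \<inter> {0..}" "{..<0} - S = insert s D" "s \<notin> D"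
    using False assms by (auto simp: D_def)
  moreover have "finite D"
    using assms(1) maya_insert[of s S] unfolding maya_def D_def by blast
  ultimately show ?thesis by (simp add: msum_def flip: D_def)
qed

lemma msum_remove:
  assumes "maya S" "s \<in> S" shows "msum f (S - {s}) = msum f S - f s"
proof -
  have "msum f (insert s (S - {s})) = msum f (S - {s}) + f s"
    using assms by (intro msum_insert) auto
  then show ?thesis using assms(2) by (simp only: insert_Diff)
qed

lemma msum_add_box:
  assumes "maya S" "x \<in> addable S" shows "msum f (add_box x S) = msum f S + f x - f (x - 1)"
proof -
  have x: "x - 1 \<in> S" "x \<notin> S - {x - 1}" using assms(2) by (auto simp: addable_def)
  have "maya (S - {x - 1})" using assms(1) by (simp only: maya_remove)
  from msum_insert[OF this x(2)] msum_remove[OF assms(1) x(1)]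
  show ?thesis unfolding add_box_def by (metis add_diff_eq diff_add_eq)
qed

lemma msum_del_box:
  assumes "maya S" "x \<in> removable S" shows "msum f (del_box x S) = msum f S - f x + f (x - 1)"
proof -
  have x: "x \<in> S" "x - 1 \<notin> S - {x}" using assms(2) by (auto simp: removable_def)
  have "maya (S - {x})" using assms(1) by (simp only: maya_remove)
  from msum_insert[OF this x(2)] msum_remove[OF assms(1) x(1)]
  show ?thesis unfolding del_box_def by metis
qed

lemma msum_add: "msum (\<lambda>z. f z + g z) S = msum f S + msum g S"
  by (simp add: msum_def sum.distrib)

lemma msum_cmult: "msum (\<lambda>z. c * f z) S = c * msum f S"
  by (simp add: msum_def sum_distrib_left right_diff_distrib)

lemma msum_const: "msum (\<lambda>z. c) S = c * charge S"
  using msum_cmult[of c "\<lambda>_. 1"] by simp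

lemma msum_lessThan_0 [simp]: "msum f {..<0} = 0"
proof -
  have "{..<0} \<inter> {0::int..} = {}" by auto
  then show ?thesis by (simp add: msum_def)
qed

lemma msum_lessThan_Suc: "msum f {..<c + 1} = msum f {..<c} + f c"
proof -
  have "{..<c + 1} = insert c {..<c}" by auto
  then show ?thesis by (simp add: msum_insert)
qed

lemma charge_lessThan [simp]: "charge {..<c} = c"
proof (induction c rule: int_induct[where k = 0])
  case (step1 i) then show ?case by (simp only: msum_lessThan_Suc)
next
  case (step2 i) then show ?case using msum_lessThan_Suc[of "\<lambda>_. 1" "i - 1"] by simp
qed simp

lemma energy_nonneg: "energy S \<ge> 0"
proof -
  have "(\<Sum>s\<in>S \<inter> {0..}. s) \<ge> 0" "(\<Sum>s\<in>{..<0} - S. s) \<le> 0"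
    by (auto intro!: sum_nonneg sum_nonpos)
  then show ?thesis by (simp add: msum_def)
qed

lemma add_box_del_box: "y \<in> removable S \<Longrightarrow> add_box y (del_box y S) = S"
  by (auto simp: add_box_def del_box_def removable_def)

lemma del_box_add_box: "x \<in> addable S \<Longrightarrow> del_box x (add_box x S) = S"
  by (auto simp: add_box_def del_box_def addable_def)

lemma addable_del_box: "y \<in> removable S \<Longrightarrow> y \<in> addable (del_box y S)"
  by (auto simp: addable_def del_box_def removable_def)

lemma removable_add_box: "y \<in> addable S \<Longrightarrow> y \<in> removable (add_box y S)"
  by (auto simp: addable_def add_box_def removable_def)

text \<open>Every bead then has a bead directly below it, so the set is a ray, and the charge is the
  end of that ray.\<close>

lemma maya_no_removable:
  assumes "maya S" "removable S = {}" shows "S = {..<charge S}"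
proof -
  obtain n where n: "n \<ge> 0" "\<And>z. z \<notin> S \<Longrightarrow> -n < z" "\<And>z. z \<in> S \<Longrightarrow> z < n"
    using maya_bounds[OF assms(1)] by metis
  have down: "z - 1 \<in> S" if "z \<in> S" for z using assms(2) that by (auto simp: removable_def)
  have down': "z - int k \<in> S" if "z \<in> S" for z k
    using that
  proof (induction k)
    case (Suc k)
    then show ?case using down[of "z - int k"] by (simp add: algebra_simps)
  qed simp
  have down'': "w \<in> S" if "z \<in> S" "w \<le> z" for z w
    using down'[of z "nat (z - w)"] that by simp
  define m where "m = Max (S \<inter> {-n..n})"
  have ne: "S \<inter> {-n..n} \<noteq> {}" 
  proof -
    have "-n \<in> S \<inter> {-n..n}" using n(1) n(2)[of "-n"] by force
    then show ?thesis by blast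
  qed
  have m: "m \<in> S" "\<And>z. z \<in> S \<Longrightarrow> -n \<le> z \<Longrightarrow> z \<le> n \<Longrightarrow> z \<le> m"
    using Max_in[OF _ ne] Max_ge[of "S \<inter> {-n..n}"] unfolding m_def by auto
  have "z \<le> m" if "z \<in> S" for z
  proof (cases "z < -n")
    case True
    moreover have "m \<ge> -n" using Max_in[OF _ ne] unfolding m_def by auto
    ultimately show ?thesis by simp
  next
    case False
    then show ?thesis using m(2)[of z] n(3)[of z] that by simp
  qed
  then have "S = {..<m + 1}" using down''[OF m(1)] by force
  then show ?thesis by (metis charge_lessThan)
qed

text \<open>Induction on the energy: deleting a removable box lowers it by 1, it is never negative,
  and the diagrams with nothing to delete are the rays.\<close>

lemma maya_induct [consumes 1, case_names lessThan add]:
  assumes "maya S"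
    and base: "\<And>c. P {..<c}"
    and step: "\<And>S x. maya S \<Longrightarrow> P S \<Longrightarrow> x \<in> addable S \<Longrightarrow> P (add_box x S)"
  shows "P S"
  using assms(1)
proof (induction "nat (energy S)" arbitrary: S rule: less_induct)
  case less
  show ?case
  proof (cases "removable S = {}")
    case True
    then show ?thesis using maya_no_removable[OF less.prems] base by metis
  next
    case False
    then obtain y where y: "y \<in> removable S" by auto
    have "energy (del_box y S) = energy S - 1"
      using msum_del_box[OF less.prems y] by simp
    then have "P (del_box y S)"
      using energy_nonneg[of "del_box y S"] less.prems by (intro less.hyps) auto
    then show ?thesis
      using step[of "del_box y S" y] less.prems y by (simp add: addable_del_box add_box_del_box)
  qed
qed

lemma maya0_induct [consumes 2, case_names empty add]:
  assumes "maya S" "charge S = 0"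
    and base: "P {..<0}"
    and step: "\<And>S x. maya S \<Longrightarrow> charge S = 0 \<Longrightarrow> P S \<Longrightarrow> x \<in> addable S \<Longrightarrow> P (add_box x S)"
  shows "P S"
proof -
  have "charge S = 0 \<longrightarrow> P S"
    using assms(1)
  proof (induction rule: maya_induct)
    case (add S x)
    then show ?case using step by (simp add: msum_add_box)
  qed (use base in simp)
  then show ?thesis using assms(2) by simp
qed

section \<open>Change of the hooks under adding a box, for sums and products alike\<close>

lemma finite_beads_above:
  assumes "maya S" shows "finite {s\<in>S. s > x}"
proof -
  obtain n where "\<And>z. z \<in> S \<Longrightarrow> z < n" using maya_bounds[OF assms] by metis
  then have "{s\<in>S. s > x} \<subseteq> {x..n}" by fastforce
  then show ?thesis by (rule finite_subset) auto
qed

lemma finite_gaps_below: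
  assumes "maya S" shows "finite {g. g \<notin> S \<and> g < x}"
proof -
  obtain n where "\<And>z. z \<notin> S \<Longrightarrow> -n < z" using maya_bounds[OF assms] by metis
  then have "{g. g \<notin> S \<and> g < x} \<subseteq> {-n..x}" by fastforce
  then show ?thesis by (rule finite_subset) auto
qed

lemma image_add_one: "(\<lambda>s. s + 1) ` A = {s :: int. s - 1 \<in> A}"
  using image_iff by fastforce

context comm_monoid_set
begin

text \<open>Only the pairs with bead \<open>x - 1\<close> or gap \<open>x\<close> are affected;
  \<open>K\<close> collects the others. A commutative monoid has no quotients, so the common part is
  named explicitly.\<close>

lemma hook_pairs_add_box:
  assumes "maya S" "x \<in> addable S"
  shows "\<exists>K. F h (hook_pairs S) = K \<^bold>* F (\<lambda>s. h (s, x)) {s\<in>S. s > x} \<^bold>* F (\<lambda>g. h (x - 1, g)) {g. g \<notin> S \<and> g < x - 1}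
     \<and> F h (hook_pairs (add_box x S)) = K \<^bold>* F (\<lambda>s. h (s, x - 1)) {s\<in>S. s > x} \<^bold>* F (\<lambda>g. h (x, g)) {g. g \<notin> S \<and> g < x - 1} \<^bold>* h (x, x - 1)"
proof -
  define R where "R = {s\<in>S. s > x}"
  define L where "L = {g. g \<notin> S \<and> g < x - 1}"
  define K where "K = {(s, g). s \<in> S \<and> g \<notin> S \<and> g < s \<and> s \<noteq> x - 1 \<and> g \<noteq> x}"
  have x: "x - 1 \<in> S" "x \<notin> S" using assms by (auto simp: addable_def)
  have 1: "hook_pairs S = (K \<union> (\<lambda>s. (s, x)) ` R) \<union> (\<lambda>g. (x - 1, g)) ` L"
    using x unfolding hook_pairs_def K_def R_def L_def by (auto simp: image_iff)
  have 2: "hook_pairs (add_box x S) = ((K \<union> (\<lambda>s. (s, x - 1)) ` R) \<union> (\<lambda>g. (x, g)) ` L) \<union> {(x, x - 1)}"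
    using x unfolding hook_pairs_def K_def R_def L_def add_box_def by (auto simp: image_iff)
  have "finite (hook_pairs S)" using assms by simp
  then have fin: "finite K" "finite ((\<lambda>s. (s, x)) ` R)" "finite ((\<lambda>g. (x - 1, g)) ` L)" unfolding 1 by auto
  then have fin': "finite R" "finite L" by (auto dest!: finite_imageD simp: inj_on_def)
  have inj: "inj_on (\<lambda>s. (s, c)) A" "inj_on (\<lambda>g. (c, g)) A" for c :: int and A :: "int set"
    by (auto simp: inj_on_def)
  have "F h (hook_pairs S) = F h K \<^bold>* F (\<lambda>s. h (s, x)) R \<^bold>* F (\<lambda>g. h (x - 1, g)) L"
    unfolding 1 using fin fin' x
    by (subst union_disjoint; (force simp: K_def R_def L_def)?)+ (simp add: reindex inj o_def)
  moreover have "F h (hook_pairs (add_box x S)) = F h K \<^bold>* F (\<lambda>s. h (s, x - 1)) R \<^bold>* F (\<lambda>g. h (x, g)) L \<^bold>* h (x, x - 1)"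
    unfolding 2 using fin fin' x
    by (subst union_disjoint; (force simp: K_def R_def L_def)?)+ (simp add: reindex inj o_def)
  ultimately show ?thesis unfolding R_def L_def by blast
qed

lemma shifted_image:
  fixes \<phi> :: "int \<Rightarrow> 'a"
  shows "F (\<lambda>s. \<phi> (s + 1)) A = F \<phi> {s. s - 1 \<in> A}"
  unfolding image_add_one[symmetric] by (subst reindex) (auto simp: inj_on_def o_def)

lemma finite_shifted: "finite A \<Longrightarrow> finite {s :: int. s - 1 \<in> A}"
  unfolding image_add_one[symmetric] by (rule finite_imageI)

text \<open>The beads above \<open>x\<close>, moved up by one, differ from the unmoved beads only at
  corners: a position gained is addable, a position lost is removable or equal to
  \<open>x + 1\<close>. The last case occurs if \<open>x\<close> is a bead, because \<open>x\<close>
  itself is not moved.\<close>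

lemma telescope_right:
  fixes \<phi> :: "int \<Rightarrow> 'a"
  assumes "maya S"
  shows "F (\<lambda>s. \<phi> (s + 1)) {s\<in>S. s > x} \<^bold>* F \<phi> {y\<in>removable S. y > x} \<^bold>* (if x \<in> S then \<phi> (x + 1) else \<^bold>1)
       = F \<phi> {s\<in>S. s > x} \<^bold>* F \<phi> {y\<in>addable S. y > x}"
proof -
  let ?T = "{s. s - 1 \<in> {s\<in>S. s > x}}" and ?E = "if x \<in> S then {x + 1} else {}"
  have fin: "finite {s\<in>S. s > x}" "finite ?T"
    using finite_beads_above[OF assms] finite_shifted[OF finite_beads_above[OF assms]] by blast+
  have un: "(?T \<union> {y\<in>removable S. y > x}) \<union> ?E = {s\<in>S. s > x} \<union> {y\<in>addable S. y > x}" (is "?A = ?B")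
  proof (rule set_eqI)
    fix z show "z \<in> ?A \<longleftrightarrow> z \<in> ?B"
      by (cases "z = x + 1") (auto simp: addable_def removable_def)
  qed
  have "F (\<lambda>s. \<phi> (s + 1)) {s\<in>S. s > x} = F \<phi> ?T" by (rule shifted_image)
  moreover have "(if x \<in> S then \<phi> (x + 1) else \<^bold>1) = F \<phi> ?E" by simp
  moreover have "F \<phi> ?T \<^bold>* F \<phi> {y\<in>removable S. y > x} = F \<phi> (?T \<union> {y\<in>removable S. y > x})"
    by (rule union_disjoint[symmetric], use fin assms in simp, use assms in simp, force simp: removable_def)
  moreover have "F \<phi> (?T \<union> {y\<in>removable S. y > x}) \<^bold>* F \<phi> ?E = F \<phi> ?A"
    by (rule union_disjoint[symmetric], use fin assms in simp, simp, auto simp: removable_def)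
  moreover have "F \<phi> ?B = F \<phi> {s\<in>S. s > x} \<^bold>* F \<phi> {y\<in>addable S. y > x}"
    by (rule union_disjoint, use fin assms in simp, use assms in simp, force simp: addable_def)
  ultimately show ?thesis by (simp only: un)
qed

text \<open>The same comparison for gaps, where addable and removable corners exchange roles; a gap
  at \<open>x - 1\<close> is the boundary case.\<close>

lemma telescope_left:
  fixes \<phi> :: "int \<Rightarrow> 'a"
  assumes "maya S"
  shows "F (\<lambda>g. \<phi> (g + 1)) {g. g \<notin> S \<and> g < x - 1} \<^bold>* F \<phi> {y\<in>addable S. y < x}
       = F \<phi> {g. g \<notin> S \<and> g < x - 1} \<^bold>* F \<phi> {y\<in>removable S. y < x} \<^bold>* (if x - 1 \<in> S then \<^bold>1 else \<phi> (x - 1))"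
proof -
  let ?L = "{g. g \<notin> S \<and> g < x - 1}" and ?E = "if x - 1 \<in> S then {} else {x - 1}"
  have fin: "finite ?L" "finite {s. s - 1 \<in> ?L}"
    using finite_gaps_below[OF assms] finite_shifted[OF finite_gaps_below[OF assms]] by blast+
  have un: "{s. s - 1 \<in> ?L} \<union> {y\<in>addable S. y < x} = (?L \<union> {y\<in>removable S. y < x}) \<union> ?E" (is "?A = ?B")
  proof (rule set_eqI)
    fix z show "z \<in> ?A \<longleftrightarrow> z \<in> ?B"
      by (cases "z = x - 1") (auto simp: addable_def removable_def)
  qed
  have "F (\<lambda>g. \<phi> (g + 1)) ?L = F \<phi> {s. s - 1 \<in> ?L}" by (rule shifted_image)
  moreover have "F \<phi> {s. s - 1 \<in> ?L} \<^bold>* F \<phi> {y\<in>addable S. y < x} = F \<phi> ?A"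
    by (rule union_disjoint[symmetric], use fin assms in simp, use assms in simp, force simp: addable_def)
  moreover have "F \<phi> ?L \<^bold>* F \<phi> {y\<in>removable S. y < x} = F \<phi> (?L \<union> {y\<in>removable S. y < x})"
    by (rule union_disjoint[symmetric], use fin assms in simp, use assms in simp, force simp: removable_def)
  moreover have "F \<phi> (?L \<union> {y\<in>removable S. y < x}) \<^bold>* F \<phi> ?E = F \<phi> ?B"
    by (rule union_disjoint[symmetric], use fin assms in simp, simp, auto simp: removable_def)
  moreover have "(if x - 1 \<in> S then \<^bold>1 else \<phi> (x - 1)) = F \<phi> ?E" by simp
  ultimately show ?thesis by (simp only: un)
qed

lemma split_at:
  fixes \<phi> :: "int \<Rightarrow> 'a"
  assumes "finite A"
  shows "F \<phi> (A - {x}) = F \<phi> {y\<in>A. y > x} \<^bold>* F \<phi> {y\<in>A. y < x}"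
proof -
  have "A - {x} = {y\<in>A. y > x} \<union> {y\<in>A. y < x}" by auto
  then show ?thesis using assms by (simp add: union_disjoint disjoint_iff)
qed

text \<open>In the row and the column of the new box every hook grows by one, so after telescoping
  only the distances from \<open>x\<close> to the corners survive; \<open>\<phi> 1\<close> belongs
  to the new box. Terms stand on both sides because a monoid admits no subtraction.\<close>

lemma hooks_add_box:
  fixes \<phi> :: "int \<Rightarrow> 'a"
  assumes "maya S" "x \<in> addable S"
  shows "F (\<lambda>(s, g). \<phi> (s - g)) (hook_pairs (add_box x S)) \<^bold>* F (\<lambda>y. \<phi> \<bar>x - y\<bar>) (removable S)
       = F (\<lambda>(s, g). \<phi> (s - g)) (hook_pairs S) \<^bold>* F (\<lambda>z. \<phi> \<bar>x - z\<bar>) (addable S - {x}) \<^bold>* \<phi> 1"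
proof -
  let ?h = "\<lambda>(s, g). \<phi> (s - g)" and ?\<psi> = "\<lambda>z. \<phi> \<bar>x - z\<bar>"
  let ?R = "{s\<in>S. s > x}" and ?L = "{g. g \<notin> S \<and> g < x - 1}"
  have x: "x - 1 \<in> S" "x \<notin> S" "x \<notin> removable S" using assms by (auto simp: addable_def removable_def)
  obtain K where K: "F ?h (hook_pairs S) = K \<^bold>* F (\<lambda>s. ?h (s, x)) ?R \<^bold>* F (\<lambda>g. ?h (x - 1, g)) ?L"
    "F ?h (hook_pairs (add_box x S)) = K \<^bold>* F (\<lambda>s. ?h (s, x - 1)) ?R \<^bold>* F (\<lambda>g. ?h (x, g)) ?L \<^bold>* ?h (x, x - 1)"
    using hook_pairs_add_box[OF assms, of ?h] by blast
  have 1: "F (\<lambda>s. ?h (s, x)) ?R = F ?\<psi> ?R" "F (\<lambda>g. ?h (x, g)) ?L = F ?\<psi> ?L"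
     "F (\<lambda>s. ?h (s, x - 1)) ?R = F (\<lambda>s. ?\<psi> (s + 1)) ?R" "F (\<lambda>g. ?h (x - 1, g)) ?L = F (\<lambda>s. ?\<psi> (s + 1)) ?L"
    by (auto intro!: cong arg_cong[where f = \<phi>])
  have 2: "F ?\<psi> (removable S) = F ?\<psi> {y\<in>removable S. y > x} \<^bold>* F ?\<psi> {y\<in>removable S. y < x}"
    using split_at[of "removable S" ?\<psi> x] assms x by simp
  note 3 = split_at[of "addable S" ?\<psi> x, OF finite_addable[OF assms(1)]]
  have 4: "F (\<lambda>s. ?\<psi> (s + 1)) ?R \<^bold>* F ?\<psi> {y\<in>removable S. y > x} = F ?\<psi> ?R \<^bold>* F ?\<psi> {y\<in>addable S. y > x}"
    "F (\<lambda>g. ?\<psi> (g + 1)) ?L \<^bold>* F ?\<psi> {y\<in>addable S. y < x} = F ?\<psi> ?L \<^bold>* F ?\<psi> {y\<in>removable S. y < x}"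
    using telescope_right[OF assms(1), of ?\<psi> x] telescope_left[OF assms(1), of ?\<psi> x] x(1,2) by simp_all
  have "F ?h (hook_pairs (add_box x S)) \<^bold>* F ?\<psi> (removable S) =
     K \<^bold>* (F (\<lambda>s. ?\<psi> (s + 1)) ?R \<^bold>* F ?\<psi> {y\<in>removable S. y > x}) \<^bold>* (F ?\<psi> ?L \<^bold>* F ?\<psi> {y\<in>removable S. y < x}) \<^bold>* \<phi> 1"
    unfolding K 1 2 by (simp add: ac_simps)
  also have "\<dots> = F ?h (hook_pairs S) \<^bold>* F ?\<psi> (addable S - {x}) \<^bold>* \<phi> 1"
    unfolding K 1 3 unfolding 4(1) 4(2)[symmetric] by (simp add: ac_simps)
  finally show ?thesis .
qed

text \<open>Not an instance of \<open>hooks_add_box\<close>, since the corners are those of the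
  larger diagram. As \<open>x\<close> is a bead and \<open>x - 1\<close> a gap, both telescoping
  lemmas contribute a boundary term equal to \<open>\<phi> 1\<close>: one is the hook of the deleted
  box, the other remains in the statement.\<close>

lemma hooks_del_box:
  fixes \<phi> :: "int \<Rightarrow> 'a"
  assumes "maya S" "x \<in> removable S"
  shows "F (\<lambda>(s, g). \<phi> (s - g)) (hook_pairs S) \<^bold>* F (\<lambda>y. \<phi> \<bar>x - y\<bar>) (removable S - {x}) \<^bold>* \<phi> 1
       = F (\<lambda>(s, g). \<phi> (s - g)) (hook_pairs (del_box x S)) \<^bold>* F (\<lambda>z. \<phi> \<bar>x - z\<bar>) (addable S)"
proof -
  let ?h = "\<lambda>(s, g). \<phi> (s - g)" and ?\<psi> = "\<lambda>z. \<phi> \<bar>x - z\<bar>"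
  let ?R = "{s\<in>S. s > x}" and ?L = "{g. g \<notin> S \<and> g < x - 1}"
  have x: "x - 1 \<notin> S" "x \<in> S" "x \<notin> addable S" using assms by (auto simp: addable_def removable_def)
  have RL: "{s\<in>del_box x S. s > x} = ?R" "{g. g \<notin> del_box x S \<and> g < x - 1} = ?L"
    by (auto simp: del_box_def)
  obtain K where K: "F ?h (hook_pairs (del_box x S)) = K \<^bold>* F (\<lambda>s. ?h (s, x)) ?R \<^bold>* F (\<lambda>g. ?h (x - 1, g)) ?L"
    "F ?h (hook_pairs S) = K \<^bold>* F (\<lambda>s. ?h (s, x - 1)) ?R \<^bold>* F (\<lambda>g. ?h (x, g)) ?L \<^bold>* ?h (x, x - 1)"
    using hook_pairs_add_box[of "del_box x S" x ?h] assms
    by (auto simp: RL addable_del_box add_box_del_box)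
  have 1: "F (\<lambda>s. ?h (s, x)) ?R = F ?\<psi> ?R" "F (\<lambda>g. ?h (x, g)) ?L = F ?\<psi> ?L"
     "F (\<lambda>s. ?h (s, x - 1)) ?R = F (\<lambda>s. ?\<psi> (s + 1)) ?R" "F (\<lambda>g. ?h (x - 1, g)) ?L = F (\<lambda>s. ?\<psi> (s + 1)) ?L"
    by (auto intro!: cong arg_cong[where f = \<phi>])
  have 2: "F ?\<psi> (addable S) = F ?\<psi> {y\<in>addable S. y > x} \<^bold>* F ?\<psi> {y\<in>addable S. y < x}"
    using split_at[of "addable S" ?\<psi> x] assms x by simp
  note 3 = split_at[of "removable S" ?\<psi> x, OF finite_removable[OF assms(1)]]
  have 4: "F ?\<psi> ?R \<^bold>* F ?\<psi> {y\<in>addable S. y > x} = F (\<lambda>s. ?\<psi> (s + 1)) ?R \<^bold>* F ?\<psi> {y\<in>removable S. y > x} \<^bold>* ?\<psi> (x + 1)"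
    "F (\<lambda>g. ?\<psi> (g + 1)) ?L \<^bold>* F ?\<psi> {y\<in>addable S. y < x} = F ?\<psi> ?L \<^bold>* F ?\<psi> {y\<in>removable S. y < x} \<^bold>* ?\<psi> (x - 1)"
    using telescope_right[OF assms(1), of ?\<psi> x] telescope_left[OF assms(1), of ?\<psi> x] x(1,2) by simp_all
  have "F ?h (hook_pairs (del_box x S)) \<^bold>* F ?\<psi> (addable S) =
     K \<^bold>* (F ?\<psi> ?R \<^bold>* F ?\<psi> {y\<in>addable S. y > x}) \<^bold>* (F (\<lambda>s. ?\<psi> (s + 1)) ?L \<^bold>* F ?\<psi> {y\<in>addable S. y < x})"
    unfolding K 1 2 by (simp add: ac_simps)
  also have "\<dots> = F ?h (hook_pairs S) \<^bold>* F ?\<psi> (removable S - {x}) \<^bold>* \<phi> 1"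
    unfolding K 1 3 unfolding 4 by (simp add: ac_simps)
  finally show ?thesis ..
qed

end

lemma card_corners_above:
  assumes "maya S" "x \<notin> S"
  shows "card {y\<in>removable S. y > x} = card {y\<in>addable S. y > x}"
  using sum.telescope_right[OF assms(1), of "\<lambda>_. 1::nat" x] assms(2) by simp

lemma card_corners_above':
  assumes "maya S" "x \<in> S"
  shows "Suc (card {y\<in>removable S. y > x}) = card {y\<in>addable S. y > x}"
  using sum.telescope_right[OF assms(1), of "\<lambda>_. 1::nat" x] assms(2) by simp

section \<open>Partial fractions\<close>

lemma lagrange_interpolation:
  fixes P :: "'a::field poly"
  assumes "finite X" "degree P < card X"
  shows "P = (\<Sum>x\<in>X. smult (poly P x / (\<Prod>z\<in>X - {x}. x - z)) (\<Prod>z\<in>X - {x}. [:-z, 1:]))" (is "P = ?Q")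
proof (rule poly_eqI_degree)
  fix x assume x: "x \<in> X"
  have "poly ?Q x = (\<Sum>y\<in>X. if y = x then poly P x else 0)"
    unfolding poly_sum
  proof (intro sum.cong refl)
    fix y assume y: "y \<in> X"
    show "poly (smult (poly P y / (\<Prod>z\<in>X - {y}. y - z)) (\<Prod>z\<in>X - {y}. [:-z, 1:])) x = (if y = x then poly P x else 0)"
    proof (cases "y = x")
      case True
      then show ?thesis using assms by (simp add: poly_prod)
    next
      case False
      then have "(\<Prod>z\<in>X - {y}. x - z) = 0" using x assms by (intro prod_zero) auto
      then show ?thesis using False by (simp add: poly_prod)
    qed
  qed
  then show "poly P x = poly ?Q x" using x assms by simp
next
  have "degree ?Q \<le> card X - 1"
  proof (rule degree_sum_le)
    fix x assume x: "x \<in> X"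
    have "degree (\<Prod>z\<in>X - {x}. [:-z, 1:]) \<le> sum (degree \<circ> (\<lambda>z. [:-z, 1:])) (X - {x})"
      using assms by (intro degree_prod_sum_le) auto
    also have "\<dots> \<le> card X - 1" using x assms by simp
    finally show "degree (smult (poly P x / (\<Prod>z\<in>X - {x}. x - z)) (\<Prod>z\<in>X - {x}. [:-z, 1:])) \<le> card X - 1"
      using degree_smult_le order_trans by blast
  qed (use assms in auto)
  then show "degree ?Q < card X" using assms by simp
qed (use assms in auto)

text \<open>Substituting \<open>1 / u\<close> for the variable makes the Lagrange basis compatible with
  the geometric series \<open>1 / (1 - x u)\<close>, which generate the moments \<open>x ^ k\<close>.\<close>

lemma lagrange_reversed:
  fixes P :: "'a::field poly"
  assumes "finite X" "degree P < card X" "u \<noteq> 0"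
  shows "u ^ (card X - 1) * poly P (1 / u)
    = (\<Sum>x\<in>X. poly P x / (\<Prod>z\<in>X - {x}. x - z) * (\<Prod>z\<in>X - {x}. 1 - z * u))"
proof -
  have "u ^ (card X - 1) * poly P (1 / u) =
    (\<Sum>x\<in>X. poly P x / (\<Prod>z\<in>X - {x}. x - z) * (u ^ (card X - 1) * (\<Prod>z\<in>X - {x}. 1 / u - z)))"
    by (subst lagrange_interpolation[OF assms(1,2)])
      (simp add: poly_sum poly_prod sum_distrib_left mult_ac)
  also have "\<dots> = (\<Sum>x\<in>X. poly P x / (\<Prod>z\<in>X - {x}. x - z) * (\<Prod>z\<in>X - {x}. 1 - z * u))"
  proof (intro sum.cong refl arg_cong2[where f = "(*)"])
    fix x assume "x \<in> X"
    then have "u ^ (card X - 1) * (\<Prod>z\<in>X - {x}. 1 / u - z) = (\<Prod>z\<in>X - {x}. u * (1 / u - z))"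
      using assms by (simp add: prod.distrib)
    then show "u ^ (card X - 1) * (\<Prod>z\<in>X - {x}. 1 / u - z) = (\<Prod>z\<in>X - {x}. 1 - z * u)"
      using assms by (simp add: right_diff_distrib mult.commute)
  qed
  finally show ?thesis .
qed

lemma poly_eqI_nonzero:
  fixes p q :: "'a::field_char_0 poly"
  assumes "\<And>u. u \<noteq> 0 \<Longrightarrow> poly p u = poly q u"
  shows "p = q"
proof (rule ccontr)
  assume "p \<noteq> q"
  then have "finite {u. poly (p - q) u = 0}" by (intro poly_roots_finite) simp
  then have "finite (UNIV - {0::'a})" by (rule finite_subset[rotated]) (use assms in auto)
  then show False using infinite_UNIV_char_0[where 'a = 'a] by simp
qed

section \<open>Newton's identities as power series, and residues\<close>

definition linear_factors :: "'a::field set \<Rightarrow> 'a fps" where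
  "linear_factors A = (\<Prod>a\<in>A. 1 - fps_const a * fps_X)"

text \<open>The constant coefficient is set to 0, which makes the series minus \<open>fps_X\<close>
  times the logarithmic derivative of \<open>linear_factors A\<close>.\<close>

definition power_sum_series :: "'a::field set \<Rightarrow> 'a fps" where
  "power_sum_series A = Abs_fps (\<lambda>k. if k = 0 then 0 else \<Sum>a\<in>A. a ^ k)"

lemma linear_factors_nth_0 [simp]: "finite A \<Longrightarrow> fps_nth (linear_factors A) 0 = 1"
  by (induction A rule: finite_induct) (auto simp: linear_factors_def)

lemma fps_of_poly_linear_factors:
  "fps_of_poly (\<Prod>a\<in>A. [:1, -a:]) = linear_factors A"
  by (simp add: fps_of_poly_prod linear_factors_def fps_of_poly_pCons mult.commute flip: fps_const_neg)

lemma geometric_fps: "Abs_fps (\<lambda>k. x ^ k) * (1 - fps_const x * fps_X) = (1 :: 'a::field fps)"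
proof (rule fps_ext)
  fix n
  have "Abs_fps (\<lambda>k. x ^ k) * (1 - fps_const x * fps_X) = Abs_fps (\<lambda>k. x ^ k) - fps_const x * (Abs_fps (\<lambda>k. x ^ k) * fps_X)"
    by (simp add: algebra_simps)
  then show "fps_nth (Abs_fps (\<lambda>k. x ^ k) * (1 - fps_const x * fps_X)) n = fps_nth 1 n"
    by (cases n) auto
qed

lemma log_deriv_linear_factors:
  assumes "finite A"
  shows "fps_X * fps_deriv (linear_factors A) = - (linear_factors A * power_sum_series A)"
  using assms
proof (induction A rule: finite_induct)
  case (insert a A)
  have 1: "linear_factors (insert a A) = (1 - fps_const a * fps_X) * linear_factors A"
    using insert by (simp add: linear_factors_def)
  have 2: "power_sum_series (insert a A) = (Abs_fps (\<lambda>k. a ^ k) - 1) + power_sum_series A"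
    using insert by (auto simp: power_sum_series_def fps_eq_iff)
  have 3: "(1 - fps_const a * fps_X) * (Abs_fps (\<lambda>k. a ^ k) - 1) = fps_const a * fps_X"
    using geometric_fps[of a] by (simp add: algebra_simps)
  have "fps_X * fps_deriv (linear_factors (insert a A)) =
      - (fps_const a * fps_X) * linear_factors A + (1 - fps_const a * fps_X) * (fps_X * fps_deriv (linear_factors A))"
    unfolding 1 by (simp add: algebra_simps)
  also have "\<dots> = - ((1 - fps_const a * fps_X) * (Abs_fps (\<lambda>k. a ^ k) - 1)) * linear_factors A
       + (1 - fps_const a * fps_X) * (fps_X * fps_deriv (linear_factors A))"
    by (simp only: 3)
  also have "\<dots> = - (linear_factors (insert a A) * power_sum_series (insert a A))"
    unfolding 1 2 insert.IH by (simp add: ring_distribs mult_ac)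
  finally show ?case .
qed (simp add: linear_factors_def power_sum_series_def fps_eq_iff)

text \<open>\<open>F\<close> is a quotient of two products of linear factors, so its logarithmic
  derivative is the difference of theirs. Coefficientwise these are Newton's identities.\<close>

lemma newton_quotient:
  fixes F :: "'a::field fps"
  assumes "finite X" "finite Y" and eq: "F * linear_factors X = linear_factors Y"
  shows "fps_X * fps_deriv F = F * (power_sum_series X - power_sum_series Y)"
proof -
  have d: "fps_deriv F * linear_factors X + F * fps_deriv (linear_factors X) = fps_deriv (linear_factors Y)"
    unfolding eq[symmetric] by (simp add: algebra_simps)
  have "linear_factors X * (fps_X * fps_deriv F)
      = fps_X * fps_deriv (linear_factors Y) - F * (fps_X * fps_deriv (linear_factors X))"
    unfolding d[symmetric] by (simp add: algebra_simps)
  also have "\<dots> = linear_factors X * (F * (power_sum_series X - power_sum_series Y))"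
    unfolding log_deriv_linear_factors[OF assms(1)] log_deriv_linear_factors[OF assms(2)]
    unfolding eq[symmetric] by (simp add: algebra_simps)
  finally have "linear_factors X * (fps_X * fps_deriv F) = linear_factors X * (F * (power_sum_series X - power_sum_series Y))" .
  moreover have "linear_factors X \<noteq> 0" using assms(1) by (metis fps_zero_nth linear_factors_nth_0 zero_neq_one)
  ultimately show ?thesis by (metis mult_left_cancel)
qed

lemma sum_geometric_linear_factors:
  assumes "finite X"
  shows "Abs_fps (\<lambda>k. \<Sum>x\<in>X. c x * x ^ k) * linear_factors X
       = (\<Sum>x\<in>X. fps_const (c x) * linear_factors (X - {x}))"
proof -
  have "Abs_fps (\<lambda>k. \<Sum>x\<in>X. c x * x ^ k) = (\<Sum>x\<in>X. fps_const (c x) * Abs_fps (\<lambda>k. x ^ k))"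
    by (auto simp: fps_eq_iff fps_sum_nth)
  then have "Abs_fps (\<lambda>k. \<Sum>x\<in>X. c x * x ^ k) * linear_factors X
      = (\<Sum>x\<in>X. fps_const (c x) * (Abs_fps (\<lambda>k. x ^ k) * linear_factors X))"
    by (simp only: sum_distrib_right mult.assoc)
  also have "\<dots> = (\<Sum>x\<in>X. fps_const (c x) * linear_factors (X - {x}))"
  proof (intro sum.cong refl arg_cong2[where f = "(*)"])
    fix x assume "x \<in> X"
    then have "linear_factors X = (1 - fps_const x * fps_X) * linear_factors (X - {x})"
      unfolding linear_factors_def using assms by (rule prod.remove[rotated])
    then show "Abs_fps (\<lambda>k. x ^ k) * linear_factors X = linear_factors (X - {x})"
      using geometric_fps[of x] by (simp flip: mult.assoc)
  qed
  finally show ?thesis .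
qed

lemma sum_linear_factors_poly:
  "(\<Sum>x\<in>X. fps_const (c x) * linear_factors (X - {x})) = fps_of_poly (\<Sum>x\<in>X. smult (c x) (\<Prod>z\<in>X - {x}. [:1, -z:]))"
  by (simp add: fps_of_poly_sum fps_of_poly_smult fps_of_poly_linear_factors)

lemma degree_monic_product:
  "finite A \<Longrightarrow> degree (\<Prod>a\<in>A. [:-a, 1::'a::field:]) = card A"
  by (subst degree_prod_eq_sum_degree) auto

text \<open>The numbers \<open>c x\<close> are the residues of the rational function with poles
  \<open>X\<close> and zeros \<open>Y\<close>. Its numerator has degree below \<open>card X\<close>,
  so Lagrange interpolation reproduces it exactly, and expansion at infinity turns the residues into
  a series of moments.\<close>

lemma residues_up:
  fixes X Y :: "'a::field_char_0 set"
  assumes fin: "finite X" "finite Y" and card: "card X = Suc (card Y)"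
  defines "c \<equiv> \<lambda>x. (\<Prod>y\<in>Y. x - y) / (\<Prod>z\<in>X - {x}. x - z)"
  shows "Abs_fps (\<lambda>k. \<Sum>x\<in>X. c x * x ^ k) * linear_factors X = linear_factors Y"
proof -
  have "(\<Sum>x\<in>X. smult (c x) (\<Prod>z\<in>X - {x}. [:1, -z:])) = (\<Prod>y\<in>Y. [:1, -y:])"
  proof (rule poly_eqI_nonzero)
    fix u :: 'a assume u: "u \<noteq> 0"
    define P where "P = (\<Prod>y\<in>Y. [:-y, 1:])"
    have P: "degree P < card X" "poly P x = (\<Prod>y\<in>Y. x - y)" for x
      using fin card by (auto simp: P_def degree_monic_product poly_prod)
    have "poly (\<Sum>x\<in>X. smult (c x) (\<Prod>z\<in>X - {x}. [:1, -z:])) u = u ^ card Y * poly P (1 / u)"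
      using lagrange_reversed[OF fin(1) P(1) u] card P(2)
      by (simp add: poly_sum poly_prod c_def mult.commute)
    also have "\<dots> = (\<Prod>y\<in>Y. u * (1 / u - y))" using fin by (simp add: P(2) prod.distrib)
    also have "\<dots> = poly (\<Prod>y\<in>Y. [:1, -y:]) u" using u by (simp add: poly_prod right_diff_distrib)
    finally show "poly (\<Sum>x\<in>X. smult (c x) (\<Prod>z\<in>X - {x}. [:1, -z:])) u = poly (\<Prod>y\<in>Y. [:1, -y:]) u" .
  qed
  then show ?thesis
    by (simp add: sum_geometric_linear_factors[OF fin(1)] sum_linear_factors_poly fps_of_poly_linear_factors)
qed

text \<open>Here the numerator has the larger degree and a linear polynomial splits off. At infinity
  it only affects the coefficients 0 and 1, so the sum of the residues is coefficient 2. Equality of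
  the first power sums makes coefficient 1 vanish, and the second Newton identity gives coefficient
  2.\<close>

lemma residues_down:
  fixes X Y :: "'a::field_char_0 set"
  assumes fin: "finite X" "finite Y" and card: "card X = Suc (card Y)" and sums: "(\<Sum>x\<in>X. x) = (\<Sum>y\<in>Y. y)"
  defines "c \<equiv> \<lambda>y. (\<Prod>x\<in>X. y - x) / (\<Prod>z\<in>Y - {y}. y - z)"
  shows "2 * (\<Sum>y\<in>Y. c y) = (\<Sum>y\<in>Y. y ^ 2) - (\<Sum>x\<in>X. x ^ 2)"
proof -
  define P Q where "P = (\<Prod>y\<in>Y. [:-y, 1:])" and "Q = (\<Prod>x\<in>X. [:-x, 1:])"
  have P: "degree P = card Y" "poly P x = (\<Prod>y\<in>Y. x - y)" for x
    using fin card by (auto simp: P_def degree_monic_product poly_prod)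
  have Q: "degree Q = card X" "poly Q x = (\<Prod>y\<in>X. x - y)" for x
    using fin card by (auto simp: Q_def degree_monic_product poly_prod)
  have [simp]: "P \<noteq> 0" using fin by (auto simp: P_def)
  define D R where "D = Q div P" and "R = Q mod P"
  have QDR: "Q = D * P + R" by (simp add: D_def R_def)
  have R: "R = 0 \<or> degree R < card Y" using degree_mod_less[of P Q] P by (auto simp: R_def)
  have degR: "degree R < degree Q" using R Q(1) card by auto
  have "D \<noteq> 0" using degR QDR by auto
  then have DP: "degree (D * P) = degree D + card Y" using P(1) by (simp add: degree_mult_eq)
  then have "R = 0 \<or> degree R < degree (D * P)" using R by linarith
  then have "degree Q = degree (D * P)" unfolding QDR by (auto intro: degree_add_eq_left)
  then have degD: "degree D = 1" using DP Q(1) card by simp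
  obtain a b where D: "D = [:a, b:]"
    using degD by (metis One_nat_def degree_eq_zeroE degree_pCons_eq_if nat.inject pCons_cases zero_neq_one)
  have Rc: "poly R y = (\<Prod>x\<in>X. y - x)" if "y \<in> Y" for y
  proof -
    have "poly P y = 0" using that fin P(2) by (auto intro: prod_zero)
    then show ?thesis using Q(2)[of y] unfolding QDR by simp
  qed
  have eq: "(\<Prod>x\<in>X. [:1, -x:]) = [:b, a:] * (\<Prod>y\<in>Y. [:1, -y:])
      + monom 1 2 * (\<Sum>y\<in>Y. smult (c y) (\<Prod>z\<in>Y - {y}. [:1, -z:]))" (is "?L = ?R")
  proof (rule poly_eqI_nonzero)
    fix u :: 'a assume u: "u \<noteq> 0"
    have S: "u * u ^ card Y * poly R (1 / u) = u ^ 2 * (\<Sum>y\<in>Y. c y * (\<Prod>z\<in>Y - {y}. 1 - z * u))"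
    proof (cases "R = 0")
      case True
      then have "c y = 0" if "y \<in> Y" for y using Rc that by (simp add: c_def)
      then show ?thesis using True by simp
    next
      case False
      then have R: "degree R < card Y" using R by simp
      then have "u * u ^ card Y = u ^ 2 * u ^ (card Y - 1)"
        by (cases "card Y") (auto simp: power2_eq_square)
      then have "u * u ^ card Y * poly R (1 / u) = u ^ 2 * (u ^ (card Y - 1) * poly R (1 / u))" by simp
      also have "u ^ (card Y - 1) * poly R (1 / u) = (\<Sum>y\<in>Y. c y * (\<Prod>z\<in>Y - {y}. 1 - z * u))"
        unfolding lagrange_reversed[OF fin(2) R u] by (intro sum.cong refl) (simp add: c_def Rc)
      finally show ?thesis .
    qed
    have "poly ?L u = (\<Prod>x\<in>X. u * (1 / u - x))" using u by (simp add: poly_prod right_diff_distrib)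
    also have "\<dots> = u * u ^ card Y * poly Q (1 / u)" using card by (simp add: Q(2) prod.distrib)
    also have "\<dots> = (u * poly D (1 / u)) * (u ^ card Y * poly P (1 / u)) + u * u ^ card Y * poly R (1 / u)"
      unfolding QDR by (simp add: algebra_simps)
    also have "u * poly D (1 / u) = b + a * u" using u by (simp add: D algebra_simps)
    also have "u ^ card Y * poly P (1 / u) = (\<Prod>y\<in>Y. u * (1 / u - y))" by (simp add: P(2) prod.distrib)
    also have "\<dots> = (\<Prod>y\<in>Y. 1 - y * u)" using u by (simp add: right_diff_distrib mult.commute)
    also have "(b + a * u) * \<dots> + u * u ^ card Y * poly R (1 / u) = poly ?R u"
      unfolding S by (simp add: poly_sum poly_prod poly_monom algebra_simps)
    finally show "poly ?L u = poly ?R u" .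
  qed
  \<comment> \<open>The expansion of \<open>Q / P\<close> at infinity in reversed form: the linear
    quotient \<open>D\<close> supplies the first two coefficients, the residues all others.\<close>
  define G where "G = fps_const b + fps_const a * fps_X + fps_X ^ 2 * Abs_fps (\<lambda>k. \<Sum>y\<in>Y. c y * y ^ k)"
  have "G * linear_factors Y = (fps_const b + fps_const a * fps_X) * linear_factors Y
     + fps_X ^ 2 * (Abs_fps (\<lambda>k. \<Sum>y\<in>Y. c y * y ^ k) * linear_factors Y)"
    by (simp add: G_def algebra_simps)
  also have "\<dots> = fps_of_poly ?R"
  proof -
    have "fps_of_poly [:b, a:] = fps_const b + fps_const a * fps_X"
      by (simp add: fps_of_poly_pCons mult.commute)
    moreover have "fps_of_poly (monom 1 2) = (fps_X ^ 2 :: 'a fps)" by (simp add: fps_of_poly_monom)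
    ultimately show ?thesis
      unfolding sum_geometric_linear_factors[OF fin(2)] sum_linear_factors_poly
      by (simp only: fps_of_poly_mult fps_of_poly_add fps_of_poly_linear_factors)
  qed
  also have "\<dots> = linear_factors X" unfolding eq[symmetric] by (rule fps_of_poly_linear_factors)
  finally have G: "G * linear_factors Y = linear_factors X" .
  have G0: "fps_nth G 0 = 1" using arg_cong[OF G, of "\<lambda>f. fps_nth f 0"] fin by simp
  have G2: "fps_nth G 2 = (\<Sum>y\<in>Y. c y)" by (simp add: G_def fps_X_power_mult_nth)
  note N = newton_quotient[OF fin(2,1) G]
  have "fps_nth G 1 = 0"
    using arg_cong[OF N, of "\<lambda>f. fps_nth f 1"] G0 sums by (simp add: fps_mult_nth power_sum_series_def)
  then have "2 * fps_nth G 2 = (\<Sum>y\<in>Y. y ^ 2) - (\<Sum>x\<in>X. x ^ 2)"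
    using arg_cong[OF N, of "\<lambda>f. fps_nth f 2"] G0
    by (simp add: fps_mult_nth power_sum_series_def numeral_2_eq_2)
  then show ?thesis by (simp add: G2)
qed

section \<open>Corners of a Maya diagram\<close>

definition corner_sum :: "(int \<Rightarrow> int) \<Rightarrow> int set \<Rightarrow> int" where
  "corner_sum f S = (\<Sum>x\<in>addable S. f x) - (\<Sum>y\<in>removable S. f y)"

text \<open>Cutting off below every gap turns the renormalised sum into a difference of two finite
  sums, to which the telescoping lemmas apply.\<close>

lemma msum_truncate:
  assumes "maya S" "x < 0" "\<And>z. z \<notin> S \<Longrightarrow> x < z"
  shows "msum f S = (\<Sum>s\<in>{s\<in>S. s > x}. f s) - (\<Sum>s\<in>{x<..<0}. f s)"
proof -
  have fin: "finite (S \<inter> {0..})" "finite ({..<0} - S)" "finite (S \<inter> {x<..<0})"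
    using assms(1) by (auto simp: maya_def)
  have "{s\<in>S. s > x} = (S \<inter> {0..}) \<union> (S \<inter> {x<..<0})" using assms(2) by auto
  moreover have "sum f ((S \<inter> {0..}) \<union> (S \<inter> {x<..<0})) = (\<Sum>s\<in>S \<inter> {0..}. f s) + (\<Sum>s\<in>S \<inter> {x<..<0}. f s)"
    using fin by (intro sum.union_disjoint) auto
  ultimately have 1: "(\<Sum>s\<in>{s\<in>S. s > x}. f s) = (\<Sum>s\<in>S \<inter> {0..}. f s) + (\<Sum>s\<in>S \<inter> {x<..<0}. f s)"
    by metis
  have "{x<..<0} = ({..<0} - S) \<union> (S \<inter> {x<..<0})" using assms(3) by auto
  moreover have "sum f (({..<0} - S) \<union> (S \<inter> {x<..<0})) = (\<Sum>s\<in>{..<0} - S. f s) + (\<Sum>s\<in>S \<inter> {x<..<0}. f s)"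
    using fin by (intro sum.union_disjoint) auto
  ultimately have 2: "(\<Sum>s\<in>{x<..<0}. f s) = (\<Sum>s\<in>{..<0} - S. f s) + (\<Sum>s\<in>S \<inter> {x<..<0}. f s)"
    by metis
  show ?thesis unfolding msum_def 1 2 by simp
qed

lemma addable_lessThan [simp]: "addable {..<c} = {c}"
  by (auto simp: addable_def)

lemma removable_lessThan [simp]: "removable {..<c} = {}"
  by (auto simp: removable_def)

text \<open>Telescoping above a point that lies below every gap. The same identity for
  \<open>{..<0}\<close>, whose only corner is the addable 0, accounts for the term
  \<open>f 0\<close>.\<close>

lemma corner_sum_eq:
  assumes "maya S" shows "corner_sum f S = f 0 + msum (\<lambda>z. f (z + 1) - f z) S"
proof -
  obtain n where n: "n \<ge> 0" "\<And>z. z \<notin> S \<Longrightarrow> -n < z" using maya_bounds[OF assms] by metis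
  define x where "x = -n - 1"
  have x: "x < 0" "x \<in> S" "\<And>z. z \<notin> S \<Longrightarrow> x < z"
    using n(2)[of x] n(1) n(2) unfolding x_def by fastforce+
  have above: "{y\<in>removable S. y > x} = removable S" "{y\<in>addable S. y > x} = addable S"
    using x(3) unfolding removable_def addable_def by fastforce+
  have "(\<Sum>s | s \<in> S \<and> x < s. f (s + 1)) + sum f (removable S) + f (x + 1) = sum f {s\<in>S. x < s} + sum f (addable S)"
    using sum.telescope_right[OF assms, of f x] x(2) above by simp
  moreover have "(\<Sum>s\<in>{x<..<0}. f (s + 1)) + f (x + 1) = (\<Sum>s\<in>{x<..<0}. f s) + f 0"
  proof -
    have "{s \<in> {..<0}. x < s} = {x<..<0}" "{y. y = 0 \<and> x < y} = {0}" using x(1) by auto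
    then show ?thesis using sum.telescope_right[of "{..<0}" f x] x(1) by simp
  qed
  moreover have "msum (\<lambda>z. f (z + 1) - f z) S
     = (\<Sum>s | s \<in> S \<and> x < s. f (s + 1)) - sum f {s\<in>S. x < s} - ((\<Sum>s\<in>{x<..<0}. f (s + 1)) - (\<Sum>s\<in>{x<..<0}. f s))"
    using msum_truncate[OF assms x(1,3)] by (simp add: sum_subtractf)
  ultimately show ?thesis by (simp add: corner_sum_def)
qed

lemma corner_sum_add_box:
  assumes "maya S" "x \<in> addable S"
  shows "corner_sum f (add_box x S) = corner_sum f S + f (x + 1) + f (x - 1) - 2 * f x"
  using assms by (simp add: corner_sum_eq msum_add_box)

lemma card_addable:
  assumes "maya S" shows "card (addable S) = Suc (card (removable S))"
  using corner_sum_eq[OF assms, of "\<lambda>_. 1"] msum_const[of 0 S] by (simp add: corner_sum_def)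

section \<open>Ratios of hook products and their moments\<close>

definition hook_prod :: "int set \<Rightarrow> rat" where
  "hook_prod S = (\<Prod>(s, g)\<in>hook_pairs S. of_int (s - g))"

lemma hook_prod_pos: "hook_prod S > 0"
  unfolding hook_prod_def by (intro prod_pos) (auto simp: hook_pairs_def)

lemma hook_prod_nonzero [simp]: "hook_prod S \<noteq> 0"
  using hook_prod_pos[of S] by simp

lemma prod_abs_diff:
  assumes "finite A"
  shows "(\<Prod>y\<in>A. of_int \<bar>x - y\<bar> :: rat) = (-1) ^ card {y\<in>A. y > x} * (\<Prod>y\<in>A. of_int (x - y))"
  using assms
proof (induction A rule: finite_induct)
  case (insert a A)
  show ?case
  proof (cases "a > x")
    case True
    then have "{y\<in>insert a A. y > x} = insert a {y\<in>A. y > x}" by auto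
    then show ?thesis using insert True by (simp add: algebra_simps)
  next
    case False
    then have "{y\<in>insert a A. y > x} = {y\<in>A. y > x}" by auto
    then show ?thesis using insert False by simp
  qed
qed simp

text \<open>Equally many addable and removable corners lie above the gap \<open>x\<close>, so the
  signs cancel and the ratio is the residue at \<open>x\<close> of
  \<open>residues_up\<close>.\<close>

lemma hook_ratio_add_box:
  assumes "maya S" "x \<in> addable S"
  shows "hook_prod S / hook_prod (add_box x S)
     = (\<Prod>y\<in>removable S. of_int (x - y)) / (\<Prod>z\<in>addable S - {x}. of_int (x - z))"
proof -
  have x: "x \<notin> S" using assms(2) by (simp add: addable_def)
  have "{z\<in>addable S - {x}. z > x} = {z\<in>addable S. z > x}" by auto
  then have c: "card {z\<in>addable S - {x}. z > x} = card {y\<in>removable S. y > x}"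
    using card_corners_above[OF assms(1) x] by simp
  have "hook_prod (add_box x S) * (\<Prod>y\<in>removable S. of_int \<bar>x - y\<bar>)
      = hook_prod S * (\<Prod>z\<in>addable S - {x}. of_int \<bar>x - z\<bar>)"
    using prod.hooks_add_box[OF assms, of "of_int :: int \<Rightarrow> rat"] unfolding hook_prod_def by simp
  moreover have "(\<Prod>y\<in>removable S. of_int \<bar>x - y\<bar>) =
      ((-1) ^ card {y\<in>removable S. y > x} * (\<Prod>y\<in>removable S. of_int (x - y)) :: rat)"
    using assms(1) by (intro prod_abs_diff) simp
  moreover have "(\<Prod>y\<in>addable S - {x}. of_int \<bar>x - y\<bar>) =
      ((-1) ^ card {y\<in>removable S. y > x} * (\<Prod>y\<in>addable S - {x}. of_int (x - y)) :: rat)"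
    unfolding c[symmetric] using assms(1) by (intro prod_abs_diff) simp
  ultimately have "hook_prod (add_box x S) * (\<Prod>y\<in>removable S. of_int (x - y))
      = hook_prod S * (\<Prod>z\<in>addable S - {x}. of_int (x - z))"
    by (simp only: mult.left_commute[of _ "(-1) ^ _"]) simp
  moreover have "(\<Prod>z\<in>addable S - {x}. of_int (x - z) :: rat) \<noteq> 0" using assms(1) by simp
  ultimately show ?thesis by (simp add: field_simps)
qed

text \<open>Above the bead \<open>x\<close> there is one more addable than removable corner; this
  produces the minus sign.\<close>

lemma hook_ratio_del_box:
  assumes "maya S" "x \<in> removable S"
  shows "hook_prod S / hook_prod (del_box x S)
     = - (\<Prod>z\<in>addable S. of_int (x - z)) / (\<Prod>y\<in>removable S - {x}. of_int (x - y))"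
proof -
  have x: "x \<in> S" using assms(2) by (simp add: removable_def)
  have "{z\<in>removable S - {x}. z > x} = {z\<in>removable S. z > x}" by auto
  then have c: "card {y\<in>addable S. y > x} = Suc (card {z\<in>removable S - {x}. z > x})"
    using card_corners_above'[OF assms(1) x] by simp
  have "hook_prod S * (\<Prod>y\<in>removable S - {x}. of_int \<bar>x - y\<bar>)
      = hook_prod (del_box x S) * (\<Prod>z\<in>addable S. of_int \<bar>x - z\<bar>)"
    using prod.hooks_del_box[OF assms, of "of_int :: int \<Rightarrow> rat"] unfolding hook_prod_def by simp
  moreover have "(\<Prod>y\<in>removable S - {x}. of_int \<bar>x - y\<bar>) =
      ((-1) ^ card {z\<in>removable S - {x}. z > x} * (\<Prod>y\<in>removable S - {x}. of_int (x - y)) :: rat)"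
    using assms(1) by (intro prod_abs_diff) simp
  moreover have "(\<Prod>y\<in>addable S. of_int \<bar>x - y\<bar>) =
      ((-1) ^ Suc (card {z\<in>removable S - {x}. z > x}) * (\<Prod>y\<in>addable S. of_int (x - y)) :: rat)"
    unfolding c[symmetric] using assms(1) by (intro prod_abs_diff) simp
  ultimately have "(-1) ^ card {z\<in>removable S - {x}. z > x} *
     (hook_prod S * (\<Prod>y\<in>removable S - {x}. of_int (x - y)) + hook_prod (del_box x S) * (\<Prod>z\<in>addable S. of_int (x - z))) = 0"
    unfolding distrib_left by (simp only: mult.left_commute[of _ "(-1) ^ _"] power_Suc mult.assoc)
  then have "hook_prod S * (\<Prod>y\<in>removable S - {x}. of_int (x - y))
      = - (hook_prod (del_box x S) * (\<Prod>z\<in>addable S. of_int (x - z)))"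
    unfolding mult_eq_0_iff eq_neg_iff_add_eq_0 by simp
  moreover have "(\<Prod>z\<in>removable S - {x}. of_int (x - z) :: rat) \<noteq> 0" using assms(1) by simp
  ultimately show ?thesis by (simp add: field_simps)
qed

definition psum :: "nat \<Rightarrow> int set \<Rightarrow> rat" where
  "psum k S = of_int (corner_sum (\<lambda>x. x ^ k) S)"

definition moment :: "nat \<Rightarrow> int set \<Rightarrow> rat" where
  "moment k S = (\<Sum>x\<in>addable S. hook_prod S / hook_prod (add_box x S) * of_int x ^ k)"

lemma inj_of_int: "inj_on (of_int :: int \<Rightarrow> rat) A"
  by (simp add: inj_on_def)

lemma of_int_image_remove: "of_int ` A - {of_int x :: rat} = of_int ` (A - {x})"
  by auto

lemma power_sum_series_corners:
  assumes "maya S"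
  shows "fps_nth (power_sum_series (of_int ` addable S) - power_sum_series (of_int ` removable S)) k
       = (if k = 0 then 0 else psum k S)"
  by (simp add: power_sum_series_def psum_def corner_sum_def sum.reindex inj_of_int)

lemma moment_fps:
  assumes "maya S"
  shows "Abs_fps (\<lambda>k. moment k S) * linear_factors (of_int ` addable S) = linear_factors (of_int ` removable S)"
proof -
  have "moment k S = (\<Sum>x\<in>of_int ` addable S. (\<Prod>y\<in>of_int ` removable S. x - y) / (\<Prod>z\<in>of_int ` addable S - {x}. x - z) * x ^ k)" for k
    unfolding moment_def using assms
    by (simp add: sum.reindex prod.reindex inj_of_int of_int_image_remove hook_ratio_add_box)
  then show ?thesis
    using residues_up[of "of_int ` addable S" "of_int ` removable S :: rat set"] assms
    by (simp add: card_image inj_of_int card_addable)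
qed

lemma moment_recurrence:
  assumes "maya S"
  shows "of_nat k * moment k S = (\<Sum>i<k. moment i S * psum (k - i) S)"
proof -
  have N: "fps_X * fps_deriv (Abs_fps (\<lambda>k. moment k S))
      = Abs_fps (\<lambda>k. moment k S) * (power_sum_series (of_int ` addable S) - power_sum_series (of_int ` removable S))"
    using assms by (intro newton_quotient moment_fps) auto
  have "of_nat k * moment k S = fps_nth (fps_X * fps_deriv (Abs_fps (\<lambda>k. moment k S))) k"
    by (cases k) auto
  also have "\<dots> = (\<Sum>i\<in>{0..k}. moment i S * (if k - i = 0 then 0 else psum (k - i) S))"
    unfolding N fps_mult_nth power_sum_series_corners[OF assms] by simp
  also have "\<dots> = (\<Sum>i<k. moment i S * psum (k - i) S)"
    by (intro sum.mono_neutral_cong_right) auto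
  finally show ?thesis .
qed

lemma moment_0:
  assumes "maya S" shows "moment 0 S = 1"
  using arg_cong[OF moment_fps[OF assms], of "\<lambda>f. fps_nth f 0"] assms by simp

text \<open>The branching rule for the numbers \<open>n! / hook_prod S\<close>. For charge 0 the
  first corner power sum is 0 and the second is twice the energy, so \<open>residues_down\<close>
  applies; its sign cancels the one in \<open>hook_ratio_del_box\<close>.\<close>

lemma sum_hook_ratio_del_box:
  assumes "maya S" "charge S = 0"
  shows "(\<Sum>y\<in>removable S. hook_prod S / hook_prod (del_box y S)) = of_int (energy S)"
proof -
  let ?X = "of_int ` addable S :: rat set" and ?Y = "of_int ` removable S :: rat set"
  have c1: "corner_sum (\<lambda>x. x) S = 0" using assms by (simp add: corner_sum_eq)
  have c2: "corner_sum (\<lambda>x. x ^ 2) S = 2 * energy S"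
  proof -
    have "msum (\<lambda>z. (z + 1) ^ 2 - z ^ 2) S = msum (\<lambda>z. 2 * z + 1) S" by (simp add: power2_sum algebra_simps)
    also have "\<dots> = 2 * energy S + charge S" by (simp only: msum_add msum_cmult)
    finally show ?thesis using assms by (simp add: corner_sum_eq)
  qed
  have "2 * (\<Sum>y\<in>?Y. (\<Prod>x\<in>?X. y - x) / (\<Prod>z\<in>?Y - {y}. y - z)) = (\<Sum>y\<in>?Y. y ^ 2) - (\<Sum>x\<in>?X. x ^ 2)"
  proof (rule residues_down)
    show "(\<Sum>x\<in>?X. x) = (\<Sum>y\<in>?Y. y)"
      using arg_cong[OF c1, of "of_int :: int \<Rightarrow> rat"] by (simp add: sum.reindex inj_of_int corner_sum_def)
  qed (use assms in \<open>simp_all add: card_image inj_of_int card_addable\<close>)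
  also have "\<dots> = - of_int (corner_sum (\<lambda>x. x ^ 2) S)"
    by (simp add: sum.reindex inj_of_int corner_sum_def)
  also have "(\<Sum>y\<in>?Y. (\<Prod>x\<in>?X. y - x) / (\<Prod>z\<in>?Y - {y}. y - z)) = - (\<Sum>y\<in>removable S. hook_prod S / hook_prod (del_box y S))"
    using assms by (simp add: sum.reindex prod.reindex inj_of_int of_int_image_remove hook_ratio_del_box sum_negf)
  finally show ?thesis by (simp add: c2)
qed

text \<open>The degree filtration of the algebra generated by the corner power sums, where
  \<open>psum k\<close> has degree \<open>k\<close>; functions matter only through their values on Maya diagrams.\<close>

inductive filt :: "nat \<Rightarrow> (int set \<Rightarrow> rat) \<Rightarrow> bool" where
  filt_const: "filt d (\<lambda>_. c)"
| filt_psum: "k \<le> d \<Longrightarrow> filt d (psum k)"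
| filt_add: "filt d \<phi> \<Longrightarrow> filt d \<psi> \<Longrightarrow> filt d (\<lambda>S. \<phi> S + \<psi> S)"
| filt_mult: "filt a \<phi> \<Longrightarrow> filt b \<psi> \<Longrightarrow> a + b \<le> d \<Longrightarrow> filt d (\<lambda>S. \<phi> S * \<psi> S)"
| filt_cong: "filt d \<phi> \<Longrightarrow> (\<And>S. maya S \<Longrightarrow> \<phi> S = \<psi> S) \<Longrightarrow> filt d \<psi>"

lemma filt_cmult: "filt d \<phi> \<Longrightarrow> filt d (\<lambda>S. c * \<phi> S)"
  using filt_mult[OF filt_const[of 0 c], of d \<phi> d] by simp

lemma filt_sum:
  "finite A \<Longrightarrow> (\<And>i. i \<in> A \<Longrightarrow> filt d (\<phi> i)) \<Longrightarrow> filt d (\<lambda>S. \<Sum>i\<in>A. \<phi> i S)"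
  by (induction A rule: finite_induct) (auto intro: filt_const filt_add)

text \<open>The recurrence expresses \<open>moment k\<close> by lower moments times power sums of
  complementary degree, and division by \<open>k\<close> is possible over the rationals.\<close>

lemma filt_moment: "filt k (moment k)"
proof (induction k rule: less_induct)
  case (less k)
  show ?case
  proof (cases "k = 0")
    case True
    then show ?thesis using filt_cong[OF filt_const[of 0 1]] moment_0 by force
  next
    case False
    have "filt k (\<lambda>S. 1 / of_nat k * (\<Sum>i<k. moment i S * psum (k - i) S))"
      using less by (intro filt_cmult filt_sum filt_mult[OF _ filt_psum]) auto
    then show ?thesis
    proof (rule filt_cong)
      fix S assume "maya S"
      from moment_recurrence[OF this, of k, symmetric] False
      show "1 / of_nat k * (\<Sum>i<k. moment i S * psum (k - i) S) = moment k S" by simp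
    qed
  qed
qed

text \<open>Polynomials in the content \<open>x\<close> of an added box, with coefficients in the filtration and \<open>x\<close>
  of degree 1, whose total degree stays 2 below \<open>d\<close>: the increment of a function of degree \<open>d\<close>
  is of this kind, since \<open>psum k\<close> grows by a second difference of \<open>x ^ k\<close>.\<close>

inductive expansion :: "nat \<Rightarrow> (int set \<Rightarrow> int \<Rightarrow> rat) \<Rightarrow> bool" where
  expansion_zero: "expansion d (\<lambda>_ _. 0)"
| expansion_term: "filt j c \<Longrightarrow> j + k + 2 \<le> d \<Longrightarrow> expansion d (\<lambda>S x. of_int x ^ k * c S)"
| expansion_add: "expansion d e \<Longrightarrow> expansion d e' \<Longrightarrow> expansion d (\<lambda>S x. e S x + e' S x)"
| expansion_cong: "expansion d e \<Longrightarrow> (\<And>S x. maya S \<Longrightarrow> x \<in> addable S \<Longrightarrow> e S x = e' S x) \<Longrightarrow> expansion d e'"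

lemma expansion_sum:
  "finite A \<Longrightarrow> (\<And>i. i \<in> A \<Longrightarrow> expansion d (e i)) \<Longrightarrow> expansion d (\<lambda>S x. \<Sum>i\<in>A. e i S x)"
  by (induction A rule: finite_induct) (auto intro: expansion_zero expansion_add)

lemma expansion_mult_filt:
  assumes "expansion a e" "filt b \<psi>" "a + b \<le> d"
  shows "expansion d (\<lambda>S x. e S x * \<psi> S)"
  using assms
proof (induction rule: expansion.induct)
  case (expansion_zero a)
  then show ?case by (simp add: expansion.expansion_zero)
next
  case (expansion_term j c k a)
  then have "expansion d (\<lambda>S x. of_int x ^ k * (c S * \<psi> S))"
    by (intro expansion.expansion_term[where j = "j + b"] filt_mult) auto
  then show ?case by (simp add: mult.assoc)
next
  case (expansion_add a e e')
  then show ?case by (auto simp: ring_distribs intro: expansion.expansion_add)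
next
  case (expansion_cong a e e')
  then have "expansion d (\<lambda>S x. e S x * \<psi> S)" by auto
  then show ?case by (rule expansion.expansion_cong) (use expansion_cong in auto)
qed

text \<open>Each factor lies 2 below its bound, so the product lies 4 below \<open>a + b\<close>,
  more than is asked for.\<close>

lemma expansion_mult:
  assumes "expansion a e" "expansion b f" "a + b \<le> d"
  shows "expansion d (\<lambda>S x. e S x * f S x)"
  using assms
proof (induction rule: expansion.induct)
  case (expansion_zero a)
  then show ?case by (simp add: expansion.expansion_zero)
next
  case (expansion_term j c k a)
  from expansion_term.prems(1) show ?case using expansion_term(1,2) expansion_term.prems(2)
  proof (induction rule: expansion.induct)
    case (expansion_zero b)
    then show ?case by (simp add: expansion.expansion_zero)
  next
    case (expansion_term j' c' k' b)
    then have "expansion d (\<lambda>S x. of_int x ^ (k + k') * (c S * c' S))"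
      by (intro expansion.expansion_term[where j = "j + j'"] filt_mult) auto
    then show ?case by (simp add: power_add mult_ac)
  next
    case (expansion_add b e e')
    then show ?case by (auto simp: ring_distribs intro: expansion.expansion_add)
  next
    case (expansion_cong b f f')
    then have "expansion d (\<lambda>S x. of_int x ^ k * c S * f S x)" by auto
    then show ?case by (rule expansion.expansion_cong) (use expansion_cong in auto)
  qed
next
  case (expansion_add a e e')
  then show ?case by (auto simp: ring_distribs intro: expansion.expansion_add)
next
  case (expansion_cong a e e')
  then have "expansion d (\<lambda>S x. e S x * f S x)" by auto
  then show ?case by (rule expansion.expansion_cong) (use expansion_cong in auto)
qed

lemma second_difference_power:
  fixes x :: rat
  shows "(x + 1) ^ k + (x - 1) ^ k - 2 * x ^ k
     = (\<Sum>j\<le>k. x ^ j * (of_nat (k choose j) * (1 + (-1) ^ (k - j)) - (if j = k then 2 else 0)))"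
proof -
  have "(x - 1) ^ k = (\<Sum>j\<le>k. of_nat (k choose j) * x ^ j * (-1) ^ (k - j))"
    using binomial_ring[of x "-1" k] by simp
  moreover have "(x + 1) ^ k = (\<Sum>j\<le>k. of_nat (k choose j) * x ^ j)"
    using binomial_ring[of x 1 k] by simp
  moreover have "2 * x ^ k = (\<Sum>j\<le>k. x ^ j * (if j = k then 2 else 0))"
  proof -
    have "(\<Sum>j\<le>k. x ^ j * (if j = k then 2 else 0)) = (\<Sum>j\<le>k. if j = k then 2 * x ^ k else 0)"
      by (intro sum.cong) auto
    then show ?thesis by simp
  qed
  ultimately show ?thesis
    by (simp add: sum_subtractf[symmetric] sum.distrib[symmetric] algebra_simps)
qed

lemma expansion_psum:
  assumes "k \<le> d"
  shows "expansion d (\<lambda>S x. psum k (add_box x S) - psum k S)"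
proof (rule expansion_cong)
  define C :: "nat \<Rightarrow> rat" where "C j = of_nat (k choose j) * (1 + (-1) ^ (k - j)) - (if j = k then 2 else 0)" for j
  show "expansion d (\<lambda>S x. \<Sum>j\<le>k. of_int x ^ j * C j)"
  proof (rule expansion_sum)
    fix j assume j: "j \<in> {..k}"
    show "expansion d (\<lambda>S x. of_int x ^ j * C j)"
    proof (cases "j + 2 \<le> k")
      case True
      then show ?thesis using assms by (intro expansion_term[where j = 0] filt_const) auto
    next
      case False
      \<comment> \<open>In a second difference the terms of degree \<open>k\<close> and
        \<open>k - 1\<close> cancel; this is the origin of the drop by 2.\<close>
      then have "j = k \<or> Suc j = k" using j by auto
      then have "C j = 0" by (auto simp: C_def)
      then show ?thesis by (simp add: expansion_zero)
    qed
  qed auto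
  fix S x assume S: "maya S" "x \<in> addable S"
  have "psum k (add_box x S) - psum k S = (of_int x + 1) ^ k + (of_int x - 1) ^ k - 2 * of_int x ^ k"
    using S by (simp add: psum_def corner_sum_add_box)
  then show "(\<Sum>j\<le>k. of_int x ^ j * C j) = psum k (add_box x S) - psum k S"
    unfolding C_def by (simp only: second_difference_power)
qed

lemma filt_expansion:
  assumes "filt d \<phi>" shows "expansion d (\<lambda>S x. \<phi> (add_box x S) - \<phi> S)"
  using assms
proof (induction rule: filt.induct)
  case (filt_const d c)
  then show ?case by (simp add: expansion_zero)
next
  case (filt_psum k d)
  then show ?case by (rule expansion_psum)
next
  case (filt_add d \<phi> \<psi>)
  from expansion_add[OF filt_add.IH] show ?case by (simp add: algebra_simps)
next
  case (filt_mult a \<phi> b \<psi> d)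
  \<comment> \<open>The discrete product rule, whose third term is the product of both
    increments.\<close>
  have "expansion d (\<lambda>S x. ((\<phi> (add_box x S) - \<phi> S) * \<psi> S + (\<psi> (add_box x S) - \<psi> S) * \<phi> S)
       + (\<phi> (add_box x S) - \<phi> S) * (\<psi> (add_box x S) - \<psi> S))"
    using filt_mult.hyps filt_mult.IH
    by (intro expansion_add expansion_mult_filt[of a _ b] expansion_mult_filt[of b _ a] expansion_mult[of a _ b]) auto
  then show ?case by (simp add: algebra_simps)
next
  case (filt_cong d \<phi> \<psi>)
  from filt_cong.IH show ?case by (rule expansion_cong) (use filt_cong.hyps in simp)
qed

text \<open>The ratios of hook products are the transition probabilities of Plancherel growth. Their
  moments are the functions \<open>moment k\<close>, which have degree \<open>k\<close> by Newton's identities.\<close>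

definition up_average :: "(int set \<Rightarrow> int \<Rightarrow> rat) \<Rightarrow> int set \<Rightarrow> rat" where
  "up_average e S = (\<Sum>x\<in>addable S. hook_prod S / hook_prod (add_box x S) * e S x)"

text \<open>Averaging replaces \<open>x ^ k\<close> by \<open>moment k\<close>, which again has
  degree \<open>k\<close>, so the drop by 2 of the increment persists.\<close>

lemma expansion_average:
  assumes "expansion d e" "2 \<le> d" shows "filt (d - 2) (up_average e)"
  using assms
proof (induction rule: expansion.induct)
  case (expansion_zero d)
  have "up_average (\<lambda>_ _. 0) = (\<lambda>_. 0)" by (auto simp: up_average_def)
  then show ?case using filt_const by simp
next
  case (expansion_term j c k d)
  have "up_average (\<lambda>S x. of_int x ^ k * c S) = (\<lambda>S. moment k S * c S)"
    by (simp add: up_average_def moment_def sum_distrib_right mult.assoc fun_eq_iff)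
  then show ?case using filt_mult[OF filt_moment expansion_term(1)] expansion_term(2) by simp
next
  case (expansion_add d e e')
  have "up_average (\<lambda>S x. e S x + e' S x) = (\<lambda>S. up_average e S + up_average e' S)"
    by (auto simp: up_average_def sum.distrib ring_distribs)
  then show ?case using expansion_add by (simp add: filt_add)
next
  case (expansion_cong d e e')
  have "filt (d - 2) (up_average e)" using expansion_cong by simp
  then show ?case
    by (rule filt_cong) (use expansion_cong in \<open>auto simp: up_average_def intro!: sum.cong\<close>)
qed

lemma expansion_trivial:
  assumes "expansion d e" "d < 2" "maya S" "x \<in> addable S" shows "e S x = 0"
  using assms by (induction rule: expansion.induct) auto

section \<open>Plancherel averages\<close>

definition level :: "nat \<Rightarrow> int set set" where
  "level n = {S. maya S \<and> charge S = 0 \<and> energy S = int n}"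

lemma finite_maya_between: "finite {S. maya S \<and> S \<inter> {0..} \<subseteq> {..m} \<and> {..<0} - S \<subseteq> {-m..}}"
proof (rule finite_subset)
  show "{S. maya S \<and> S \<inter> {0..} \<subseteq> {..m} \<and> {..<0} - S \<subseteq> {-m..}} \<subseteq> (\<lambda>T. T \<union> {..<min 0 (-m)}) ` Pow {min 0 (-m)..max 0 m}"
  proof
    fix S assume "S \<in> {S. maya S \<and> S \<inter> {0..} \<subseteq> {..m} \<and> {..<0} - S \<subseteq> {-m..}}"
    then have S: "\<And>z. z \<in> S \<Longrightarrow> 0 \<le> z \<Longrightarrow> z \<le> m" "\<And>z. z < 0 \<Longrightarrow> z \<notin> S \<Longrightarrow> -m \<le> z" by auto
    have "S = (S \<inter> {min 0 (-m)..max 0 m}) \<union> {..<min 0 (-m)}"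
    proof (rule set_eqI)
      fix z show "z \<in> S \<longleftrightarrow> z \<in> (S \<inter> {min 0 (-m)..max 0 m}) \<union> {..<min 0 (-m)}"
        using S(1)[of z] S(2)[of z] by (cases "z \<in> S"; cases "z < 0") auto
    qed
    then show "S \<in> (\<lambda>T. T \<union> {..<min 0 (-m)}) ` Pow {min 0 (-m)..max 0 m}" by blast
  qed
qed auto

text \<open>Every bead at \<open>z \<ge> 0\<close> and every gap at \<open>z < 0\<close> contributes
  at least \<open>\<bar>z\<bar>\<close>, so the value of the sum confines all of them. This serves
  both the energy and the affine weights of residue classes.\<close>

lemma msum_fiber:
  assumes pos: "\<And>z. z \<ge> 0 \<Longrightarrow> z \<le> f z" and neg: "\<And>z. z < 0 \<Longrightarrow> f z \<le> z"
  assumes S: "maya S"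
  shows "0 \<le> msum f S" "S \<inter> {0..} \<subseteq> {..msum f S}" "{..<0} - S \<subseteq> {- msum f S..}"
proof -
  have 1: "f z \<ge> 0" if "z \<ge> 0" for z using pos[OF that] that by simp
  have 2: "f z \<le> 0" if "z < 0" for z using neg[OF that] that by simp
  have A: "(\<Sum>s\<in>S \<inter> {0..}. f s) \<ge> 0" and B: "(\<Sum>s\<in>{..<0} - S. - f s) \<ge> 0"
    using 1 2 by (auto intro!: sum_nonneg)
  show "0 \<le> msum f S" using A B by (simp add: msum_def sum_negf)
  show "S \<inter> {0..} \<subseteq> {..msum f S}"
  proof
    fix z assume z: "z \<in> S \<inter> {0..}"
    have "f z \<le> (\<Sum>s\<in>S \<inter> {0..}. f s)"
      using 1 z S by (intro member_le_sum) (auto simp: maya_def)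
    then show "z \<in> {..msum f S}" using B pos[of z] z by (simp add: msum_def sum_negf)
  qed
  show "{..<0} - S \<subseteq> {- msum f S..}"
  proof
    fix z assume z: "z \<in> {..<0} - S"
    have "- f z \<le> (\<Sum>s\<in>{..<0} - S. - f s)"
      using 2 z S by (intro member_le_sum[of z _ "\<lambda>s. - f s"]) (auto simp: maya_def)
    then show "z \<in> {- msum f S..}" using A neg[of z] z by (simp add: msum_def sum_negf)
  qed
qed

lemma finite_msum_fiber:
  assumes "\<And>z. z \<ge> 0 \<Longrightarrow> z \<le> f z" "\<And>z. z < 0 \<Longrightarrow> f z \<le> z"
  shows "finite {S. maya S \<and> msum f S = n}"
proof (rule finite_subset[OF _ finite_maya_between[of n]], rule subsetI)
  fix S assume "S \<in> {S. maya S \<and> msum f S = n}"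
  then show "S \<in> {S. maya S \<and> S \<inter> {0..} \<subseteq> {..n} \<and> {..<0} - S \<subseteq> {-n..}}"
    using msum_fiber(2,3)[of f S, OF assms] by blast
qed

lemma finite_level [simp]: "finite (level n)"
  by (rule finite_subset[OF _ finite_msum_fiber[of "\<lambda>s. s" "int n"]]) (auto simp: level_def)

lemma energy_0:
  assumes "maya S" "charge S = 0" "energy S = 0" shows "S = {..<0}"
proof -
  have "removable S = {}"
  proof (rule ccontr)
    assume "removable S \<noteq> {}"
    then obtain y where "y \<in> removable S" by auto
    then have "energy (del_box y S) = -1" using assms by (simp add: msum_del_box)
    then show False using energy_nonneg[of "del_box y S"] by simp
  qed
  then show ?thesis using maya_no_removable assms by metis
qed

lemma level_0: "level 0 = {{..<0}}"
  by (auto simp: level_def dest: energy_0)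

text \<open>The weights \<open>fact n / hook_prod S ^ 2\<close> are those of Plancherel measure;
  that they sum to 1 is a consequence drawn in \<open>plancherel_one\<close>.\<close>

definition plancherel :: "(int set \<Rightarrow> rat) \<Rightarrow> nat \<Rightarrow> rat" where
  "plancherel \<phi> n = fact n * (\<Sum>S\<in>level n. \<phi> S / hook_prod S ^ 2)"

lemma plancherel_add: "plancherel (\<lambda>S. \<phi> S + \<psi> S) n = plancherel \<phi> n + plancherel \<psi> n"
  by (simp add: plancherel_def sum.distrib add_divide_distrib ring_distribs)

lemma plancherel_cmult: "plancherel (\<lambda>S. c * \<phi> S) n = c * plancherel \<phi> n"
  by (simp add: plancherel_def sum_distrib_left mult_ac)

lemma plancherel_cong:
  "(\<And>S. S \<in> level n \<Longrightarrow> \<phi> S = \<psi> S) \<Longrightarrow> plancherel \<phi> n = plancherel \<psi> n"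
  by (simp add: plancherel_def)

text \<open>Double counting of the pairs where \<open>T\<close> arises from \<open>S\<close> by
  adding a box, with weight \<open>\<phi> T / (hook_prod S * hook_prod T)\<close>. Grouped by
  \<open>S\<close> they form the average over growth; grouped by \<open>T\<close> the branching rule
  yields the factor \<open>n + 1\<close>.\<close>

lemma plancherel_Suc:
  "plancherel \<phi> (Suc n) = plancherel (up_average (\<lambda>S x. \<phi> (add_box x S))) n"
proof -
  let ?A = "SIGMA S:level n. addable S" and ?B = "SIGMA S:level (Suc n). removable S"
  let ?w = "\<lambda>S T. \<phi> T / (hook_prod S * hook_prod T)"
  have fin: "finite (addable S)" if "S \<in> level n" for S using that by (simp add: level_def)
  have fin': "finite (removable S)" if "S \<in> level (Suc n)" for S using that by (simp add: level_def)
  have "plancherel (up_average (\<lambda>S x. \<phi> (add_box x S))) n = fact n * (\<Sum>S\<in>level n. \<Sum>x\<in>addable S. ?w S (add_box x S))"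
    unfolding plancherel_def up_average_def
    by (simp add: sum_divide_distrib power2_eq_square mult.commute)
  also have "(\<Sum>S\<in>level n. \<Sum>x\<in>addable S. ?w S (add_box x S)) = (\<Sum>(S, x)\<in>?A. ?w S (add_box x S))"
    using fin by (simp add: sum.Sigma)
  also have "\<dots> = (\<Sum>(T, y)\<in>?B. ?w (del_box y T) T)"
    by (rule sum.reindex_bij_witness[where i = "\<lambda>(T, y). (del_box y T, y)" and j = "\<lambda>(S, x). (add_box x S, x)"])
      (auto simp: level_def msum_add_box msum_del_box add_box_del_box del_box_add_box addable_del_box removable_add_box)
  also have "\<dots> = (\<Sum>T\<in>level (Suc n). \<Sum>y\<in>removable T. ?w (del_box y T) T)"
    using fin' by (simp add: sum.Sigma)
  also have "\<dots> = (\<Sum>T\<in>level (Suc n). of_nat (Suc n) * (\<phi> T / hook_prod T ^ 2))"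
  proof (rule sum.cong)
    fix T assume T: "T \<in> level (Suc n)"
    have "(\<Sum>y\<in>removable T. ?w (del_box y T) T) = \<phi> T / hook_prod T ^ 2 * (\<Sum>y\<in>removable T. hook_prod T / hook_prod (del_box y T))"
      unfolding sum_distrib_left by (intro sum.cong refl) (simp add: power2_eq_square)
    also have "(\<Sum>y\<in>removable T. hook_prod T / hook_prod (del_box y T)) = of_nat (Suc n)"
      using T by (subst sum_hook_ratio_del_box) (auto simp: level_def)
    finally show "(\<Sum>y\<in>removable T. ?w (del_box y T) T) = of_nat (Suc n) * (\<phi> T / hook_prod T ^ 2)" by simp
  qed simp
  finally show ?thesis by (simp add: plancherel_def sum_distrib_left algebra_simps)
qed

text \<open>The transition probabilities sum to 1 by \<open>moment_0\<close>, so the old value can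
  be moved under the average.\<close>

lemma plancherel_difference:
  "plancherel \<phi> (Suc n) - plancherel \<phi> n = plancherel (up_average (\<lambda>S x. \<phi> (add_box x S) - \<phi> S)) n"
proof -
  have "plancherel (up_average (\<lambda>S x. \<phi> (add_box x S))) n
     = plancherel (\<lambda>S. up_average (\<lambda>S x. \<phi> (add_box x S) - \<phi> S) S + \<phi> S) n"
  proof (rule plancherel_cong)
    fix S assume "S \<in> level n"
    then have "moment 0 S = 1" by (simp add: level_def moment_0)
    moreover have "up_average (\<lambda>S x. \<phi> S) S = moment 0 S * \<phi> S"
      by (simp add: moment_def up_average_def sum_distrib_right)
    ultimately have "\<phi> S = up_average (\<lambda>S x. \<phi> S) S" by simp
    then show "up_average (\<lambda>S x. \<phi> (add_box x S)) S = up_average (\<lambda>S x. \<phi> (add_box x S) - \<phi> S) S + \<phi> S"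
      by (simp add: up_average_def right_diff_distrib sum_subtractf)
  qed
  then show ?thesis by (simp add: plancherel_Suc plancherel_add)
qed

section \<open>Polynomial dependence on the size, by finite differences\<close>

fun difference_vanishes :: "nat \<Rightarrow> (nat \<Rightarrow> rat) \<Rightarrow> bool" where
  "difference_vanishes 0 f = (\<forall>n. f n = 0)"
| "difference_vanishes (Suc m) f = difference_vanishes m (\<lambda>n. f (Suc n) - f n)"

lemma difference_vanishes_add:
  "difference_vanishes m f \<Longrightarrow> difference_vanishes m g \<Longrightarrow> difference_vanishes m (\<lambda>n. f n + g n)"
proof (induction m arbitrary: f g)
  case (Suc m)
  then show ?case using Suc.IH[of "\<lambda>n. f (Suc n) - f n" "\<lambda>n. g (Suc n) - g n"] by (simp add: algebra_simps)
qed simp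

lemma difference_vanishes_cmult:
  "difference_vanishes m f \<Longrightarrow> difference_vanishes m (\<lambda>n. c * f n)"
proof (induction m arbitrary: f)
  case (Suc m)
  then show ?case using Suc.IH[of "\<lambda>n. f (Suc n) - f n"] by (simp add: algebra_simps)
qed simp

lemma difference_vanishes_Suc:
  "difference_vanishes m f \<Longrightarrow> difference_vanishes (Suc m) f"
proof (induction m arbitrary: f)
  case (Suc m)
  then have "difference_vanishes m (\<lambda>n. f (Suc n) - f n)" by simp
  then have "difference_vanishes (Suc m) (\<lambda>n. f (Suc n) - f n)" by (rule Suc.IH)
  then show ?case by (simp only: difference_vanishes.simps)
qed simp

text \<open>Newton's forward interpolation, in which all terms but the last vanish.\<close>

lemma difference_vanishes_binomial:
  assumes "difference_vanishes (Suc m) f" "\<And>i. i < m \<Longrightarrow> f i = 0"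
  shows "f n = f m * of_nat (n choose m)"
  using assms
proof (induction m arbitrary: f n)
  case 0
  then have "f (Suc n) = f n" for n by simp
  then show ?case by (induction n) auto
next
  case (Suc m)
  have g: "f (Suc n) - f n = f (Suc m) * of_nat (n choose m)" for n
    using Suc.IH[of "\<lambda>n. f (Suc n) - f n" n] Suc.prems by simp
  show ?case
  proof (induction n)
    case 0
    then show ?case using Suc.prems(2)[of 0] by simp
  next
    case (Suc n)
    then show ?case using g[of n] by (simp add: algebra_simps)
  qed
qed

text \<open>One difference in \<open>n\<close> lowers the degree by 2, so degree \<open>d\<close>
  leads to a polynomial in \<open>n\<close> of degree at most \<open>d div 2\<close>.\<close>

lemma filt_plancherel:
  "filt d \<phi> \<Longrightarrow> difference_vanishes (Suc (d div 2)) (plancherel \<phi>)"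
proof (induction d arbitrary: \<phi> rule: less_induct)
  case (less d)
  note e = filt_expansion[OF less.prems]
  show ?case
  proof (cases "d < 2")
    case True
    have "plancherel \<phi> (Suc n) - plancherel \<phi> n = plancherel (\<lambda>_. 0) n" for n
      unfolding plancherel_difference using expansion_trivial[OF e True]
      by (intro plancherel_cong) (auto simp: up_average_def level_def intro!: sum.neutral)
    then show ?thesis using True by (simp add: plancherel_def)
  next
    case False
    then have "filt (d - 2) (up_average (\<lambda>S x. \<phi> (add_box x S) - \<phi> S))"
      using expansion_average[OF e] by simp
    then have "difference_vanishes (Suc ((d - 2) div 2)) (plancherel (up_average (\<lambda>S x. \<phi> (add_box x S) - \<phi> S)))"
      using False by (intro less.IH) auto
    moreover have "Suc ((d - 2) div 2) = d div 2" using False by simp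
    ultimately show ?thesis by (simp add: plancherel_difference)
  qed
qed

section \<open>Even power sums of hook lengths\<close>

definition hook_power_sum :: "nat \<Rightarrow> int set \<Rightarrow> rat" where
  "hook_power_sum k S = (\<Sum>(s, g)\<in>hook_pairs S. of_int (s - g) ^ (2 * k))"

text \<open>By \<open>sum.hooks_add_box\<close> the increment consists of even powers of the
  differences \<open>x - z\<close> to the corners, so absolute values disappear and the binomial
  theorem separates \<open>x\<close> from the corner power sums. The constant is 1 for the new box
  minus the term of the corner \<open>x\<close> itself, which is nonzero only for
  \<open>k = 0\<close>.\<close>

lemma expansion_hook_power_sum:
  "expansion (2 * k + 2) (\<lambda>S x. hook_power_sum k (add_box x S) - hook_power_sum k S)"
proof (rule expansion_cong)
  show "expansion (2 * k + 2) (\<lambda>S x. of_int x ^ 0 * (1 - 0 ^ (2 * k))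
      + (\<Sum>j\<le>2 * k. of_int x ^ j * (of_nat (2 * k choose j) * (-1) ^ (2 * k - j) * psum (2 * k - j) S)))"
    by (intro expansion_add expansion_sum expansion_term[where j = 0] expansion_term[where j = "2 * k - _"]
        filt_const filt_cmult filt_psum) auto
  fix S x assume S: "maya S" "x \<in> addable S"
  have ev: "of_int \<bar>a\<bar> ^ (2 * k) = (of_int a ^ (2 * k) :: rat)" for a by (simp add: power_mult)
  have "hook_power_sum k (add_box x S) + (\<Sum>y\<in>removable S. of_int (x - y) ^ (2 * k))
      = hook_power_sum k S + (\<Sum>z\<in>addable S - {x}. of_int (x - z) ^ (2 * k)) + 1"
    using sum.hooks_add_box[OF S, of "\<lambda>d. of_int d ^ (2 * k) :: rat"] by (simp only: ev hook_power_sum_def) simp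
  moreover have "(\<Sum>z\<in>addable S. of_int (x - z) ^ (2 * k) :: rat) = 0 ^ (2 * k) + (\<Sum>z\<in>addable S - {x}. of_int (x - z) ^ (2 * k))"
    using S by (subst sum.remove[of _ x]) auto
  ultimately have "hook_power_sum k (add_box x S) - hook_power_sum k S
      = (1 - 0 ^ (2 * k)) + of_int (corner_sum (\<lambda>z. (x - z) ^ (2 * k)) S)"
    by (simp add: corner_sum_def)
  also have "corner_sum (\<lambda>z. (x - z) ^ (2 * k)) S
      = (\<Sum>j\<le>2 * k. x ^ j * (int (2 * k choose j) * (-1) ^ (2 * k - j) * corner_sum (\<lambda>z. z ^ (2 * k - j)) S))"
  proof -
    have b: "(x - z) ^ (2 * k) = (\<Sum>j\<le>2 * k. x ^ j * (int (2 * k choose j) * (-1) ^ (2 * k - j) * z ^ (2 * k - j)))" for z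
      using binomial_ring[of x "- z" "2 * k"] by (simp add: mult_ac power_minus[of z])
    show ?thesis
      unfolding corner_sum_def b
      by (subst (1 2) sum.swap) (simp add: sum_distrib_left right_diff_distrib sum_subtractf)
  qed
  finally show "of_int x ^ 0 * (1 - 0 ^ (2 * k))
      + (\<Sum>j\<le>2 * k. of_int x ^ j * (of_nat (2 * k choose j) * (-1) ^ (2 * k - j) * psum (2 * k - j) S))
      = hook_power_sum k (add_box x S) - hook_power_sum k S"
    by (simp add: psum_def)
qed

text \<open>The averaged increment has degree \<open>2 * k\<close> in the filtration; passing from
  the increment to the sum costs one more difference.\<close>

lemma hook_power_sum_plancherel: "difference_vanishes (k + 2) (plancherel (hook_power_sum k))"
proof -
  have "filt (2 * k) (up_average (\<lambda>S x. hook_power_sum k (add_box x S) - hook_power_sum k S))"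
    using expansion_average[OF expansion_hook_power_sum[of k]] by simp
  then have "difference_vanishes (Suc k) (\<lambda>n. plancherel (hook_power_sum k) (Suc n) - plancherel (hook_power_sum k) n)"
    using filt_plancherel[of "2 * k"] by (simp add: plancherel_difference)
  then show ?thesis by simp
qed

text \<open>The extra power \<open>2 * k\<close> is what an induction on \<open>r\<close>
  generalises over; the statistic evaluated in the end has \<open>k = 0\<close>.\<close>

definition hook_statistic :: "nat \<Rightarrow> nat \<Rightarrow> int set \<Rightarrow> rat" where
  "hook_statistic r k S = (\<Sum>(s, g)\<in>hook_pairs S.
     of_int (s - g) ^ (2 * k) * (\<Prod>i=1..r. of_int (s - g) ^ 2 - of_nat i ^ 2))"

lemma hook_statistic_Suc:
  "hook_statistic (Suc r) k S = hook_statistic r (Suc k) S + (- (of_nat (Suc r) ^ 2)) * hook_statistic r k S"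
  unfolding hook_statistic_def sum_distrib_left sum.distrib[symmetric]
  by (intro sum.cong refl) (auto simp: algebra_simps power2_eq_square)

lemma hook_statistic_plancherel: "difference_vanishes (r + k + 2) (plancherel (hook_statistic r k))"
proof (induction r arbitrary: k)
  case 0
  have "hook_statistic 0 k = hook_power_sum k" by (simp add: fun_eq_iff hook_statistic_def hook_power_sum_def)
  then show ?case using hook_power_sum_plancherel[of k] by simp
next
  case (Suc r)
  have "hook_statistic (Suc r) k = (\<lambda>S. hook_statistic r (Suc k) S + (- (of_nat (Suc r) ^ 2)) * hook_statistic r k S)"
    using hook_statistic_Suc by (simp add: fun_eq_iff)
  moreover have "plancherel (\<lambda>S. hook_statistic r (Suc k) S + (- (of_nat (Suc r) ^ 2)) * hook_statistic r k S)
     = (\<lambda>n. plancherel (hook_statistic r (Suc k)) n + (- (of_nat (Suc r) ^ 2)) * plancherel (hook_statistic r k) n)"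
    by (simp only: fun_eq_iff plancherel_add plancherel_cmult simp_thms)
  moreover have "difference_vanishes (Suc r + k + 2) (plancherel (hook_statistic r (Suc k)))"
    using Suc.IH[of "Suc k"] by simp
  moreover have "difference_vanishes (Suc r + k + 2) (plancherel (hook_statistic r k))"
    using difference_vanishes_Suc[OF Suc.IH[of k]] by (simp only: add_Suc)
  ultimately show ?case
    by (simp only:) (intro difference_vanishes_add difference_vanishes_cmult)
qed

section \<open>Hooks of maximal length and hook shapes\<close>

text \<open>Moving a bead down from \<open>s\<close> to \<open>g\<close> removes the rim hook of
  length \<open>s - g\<close>.\<close>

lemma swap_bead:
  assumes "maya S" "(s, g) \<in> hook_pairs S"
  defines "T \<equiv> insert g (S - {s})"
  shows "maya T" "msum f T = msum f S - f s + f g"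
proof -
  have sg: "s \<in> S" "g \<notin> S - {s}" using assms(2) by (auto simp: hook_pairs_def)
  show "maya T" using assms(1) by (simp add: T_def)
  have "maya (S - {s})" using assms(1) by simp
  then show "msum f T = msum f S - f s + f g"
    unfolding T_def using msum_insert[OF _ sg(2)] msum_remove[OF assms(1) sg(1)] by metis
qed

text \<open>Removing the rim hook leaves a diagram, whose energy cannot be negative.\<close>

lemma hook_le_level:
  assumes "S \<in> level n" "(s, g) \<in> hook_pairs S" shows "s - g \<le> int n"
proof -
  have "maya S" using assms(1) by (simp add: level_def)
  from swap_bead(2)[OF this assms(2), of "\<lambda>s. s"] energy_nonneg[of "insert g (S - {s})"] assms(1)
  show ?thesis by (simp add: level_def)
qed

lemma hook_statistic_eq_0:
  assumes "S \<in> level n" "n \<le> r" shows "hook_statistic r k S = 0"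
  unfolding hook_statistic_def
proof (rule sum.neutral, clarify)
  fix s g assume sg: "(s, g) \<in> hook_pairs S"
  define h where "h = nat (s - g)"
  have h: "of_int (s - g) = (of_nat h :: rat)" "h \<in> {1..r}"
    using hook_le_level[OF assms(1) sg] sg assms(2) by (auto simp: h_def hook_pairs_def)
  then have "(\<Prod>i=1..r. of_int (s - g) ^ 2 - of_nat i ^ 2 :: rat) = 0"
    by (intro prod_zero) auto
  then show "of_int (s - g) ^ (2 * k) * (\<Prod>i=1..r. of_int (s - g) ^ 2 - of_nat i ^ 2 :: rat) = 0"
    by simp
qed

text \<open>The partition whose main diagonal has a single box, of arm \<open>a\<close> and leg
  \<open>l\<close>: in the empty diagram the bead \<open>- l - 1\<close> is moved to
  \<open>a\<close>.\<close>

definition hook_shape :: "nat \<Rightarrow> nat \<Rightarrow> int set" where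
  "hook_shape a l = insert (int a) ({..<0} - {- int l - 1})"

lemma hook_pairs_hook_shape:
  "hook_pairs (hook_shape a l) = insert (int a, - int l - 1)
     (Pair (int a) ` {0..<int a} \<union> (\<lambda>z. (z, - int l - 1)) ` {- int l - 1<..<0})"
  by (auto simp: hook_pairs_def hook_shape_def image_iff)

lemma prod_fact_up: "(\<Prod>z\<in>{c<..<c + 1 + int l}. of_int (z - c) :: rat) = fact l"
proof -
  have "(\<Prod>z\<in>{c<..<c + 1 + int l}. of_int (z - c) :: rat) = (\<Prod>i=1..l. of_nat i)"
    by (rule prod.reindex_bij_witness[where i = "\<lambda>i. c + int i" and j = "\<lambda>z. nat (z - c)"]) auto
  then show ?thesis by (simp add: fact_prod)
qed

lemma prod_fact_down: "(\<Prod>z\<in>{0..<int a}. of_int (int a - z) :: rat) = fact a"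
proof -
  have "(\<Prod>z\<in>{0..<int a}. of_int (int a - z) :: rat) = (\<Prod>i=1..a. of_nat i)"
    by (rule prod.reindex_bij_witness[where i = "\<lambda>i. int a - int i" and j = "\<lambda>z. nat (int a - z)"]) auto
  then show ?thesis by (simp add: fact_prod)
qed

lemma hook_prod_hook_shape: "hook_prod (hook_shape a l) = of_nat (a + l + 1) * fact a * fact l"
proof -
  let ?g = "- int l - 1"
  let ?A = "Pair (int a) ` {0..<int a}" and ?B = "(\<lambda>z. (z, ?g)) ` {?g<..<0}"
  have inj: "inj_on (Pair (int a)) A" "inj_on (\<lambda>z. (z, ?g)) A" for A by (auto simp: inj_on_def)
  have "hook_prod (hook_shape a l) = of_int (int a - ?g) * (\<Prod>(s, g)\<in>?A \<union> ?B. of_int (s - g))"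
    unfolding hook_prod_def hook_pairs_hook_shape by (subst prod.insert) auto
  also have "(\<Prod>(s, g)\<in>?A \<union> ?B. of_int (s - g) :: rat) = (\<Prod>(s, g)\<in>?A. of_int (s - g)) * (\<Prod>(s, g)\<in>?B. of_int (s - g))"
    by (intro prod.union_disjoint) auto
  also have "(\<Prod>(s, g)\<in>?A. of_int (s - g) :: rat) = fact a"
    by (subst prod.reindex[OF inj(1)]) (simp only: o_def prod.case prod_fact_down)
  also have "(\<Prod>(s, g)\<in>?B. of_int (s - g) :: rat) = fact l"
    using prod_fact_up[of ?g l] by (subst prod.reindex[OF inj(2)]) (simp only: o_def prod.case, simp)
  finally show ?thesis by (simp add: algebra_simps)
qed

lemma hook_shape_level: "hook_shape a l \<in> level (a + l + 1)"
proof -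
  have "msum f ({..<0} - {- int l - 1}) = - f (- int l - 1)" for f by (subst msum_remove) auto
  then show ?thesis by (simp add: level_def hook_shape_def msum_insert)
qed

text \<open>Removing a hook of length \<open>n\<close> from a diagram of size \<open>n\<close>
  leaves the empty diagram, so a single bead of \<open>{..<0}\<close> has been moved.\<close>

lemma full_hook:
  assumes "S \<in> level n" "(s, g) \<in> hook_pairs S" "s - g = int n"
  shows "0 \<le> s" "g < 0" "S = insert s ({..<0} - {g})"
proof -
  have "maya S" using assms(1) by (simp add: level_def)
  from swap_bead[OF this assms(2)] assms(1,3) have "insert g (S - {s}) = {..<0}"
    by (intro energy_0) (auto simp: level_def)
  note T = this
  have sg: "s \<in> S" "g \<notin> S" using assms(2) by (auto simp: hook_pairs_def)
  have "g \<in> {..<0}" "s \<notin> {..<0}" unfolding T[symmetric] using sg by auto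
  then show "0 \<le> s" "g < 0" by simp_all
  show "S = insert s ({..<0} - {g})" unfolding T[symmetric] using sg by blast
qed

text \<open>The diagrams concerned are the hook shapes of arm \<open>a \<le> r\<close> and leg
  \<open>r - a\<close>. Their hook product is \<open>(r + 1)!\<close> divided by
  \<open>r choose a\<close>, so Vandermonde's sum of squared binomial coefficients appears.\<close>

lemma full_hook_sum:
  "(\<Sum>S\<in>level (Suc r). \<Sum>(s, g)\<in>{p\<in>hook_pairs S. fst p - snd p = int (Suc r)}. 1 / hook_prod S ^ 2)
     = of_nat (2 * r choose r) / fact (Suc r) ^ 2"
proof -
  let ?A = "SIGMA S:level (Suc r). {p\<in>hook_pairs S. fst p - snd p = int (Suc r)}"
  have fin: "finite {p\<in>hook_pairs S. fst p - snd p = int (Suc r)}" if "S \<in> level (Suc r)" for S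
    using that by (simp add: level_def)
  have "(\<Sum>S\<in>level (Suc r). \<Sum>(s, g)\<in>{p\<in>hook_pairs S. fst p - snd p = int (Suc r)}. 1 / hook_prod S ^ 2)
     = (\<Sum>(S, p)\<in>?A. 1 / hook_prod S ^ 2)"
    by (subst sum.Sigma) (use fin in \<open>simp_all add: split_def\<close>)
  also have "\<dots> = (\<Sum>a\<le>r. 1 / hook_prod (hook_shape a (r - a)) ^ 2)"
  proof (rule sum.reindex_bij_witness[where j = "\<lambda>(S, s, g). nat s" and i = "\<lambda>a. (hook_shape a (r - a), int a, int a - int (Suc r))"])
    fix a assume a: "a \<in> {..r}"
    then show "(hook_shape a (r - a), int a, int a - int (Suc r)) \<in> ?A"
      using hook_shape_level[of a "r - a"] by (auto simp: hook_pairs_hook_shape of_nat_diff)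
  next
    fix x assume "x \<in> ?A"
    then obtain S s g where x: "x = (S, s, g)" "S \<in> level (Suc r)" "(s, g) \<in> hook_pairs S" "s - g = int (Suc r)"
      by force
    note f = full_hook[OF x(2,3,4)]
    have g: "- int (r - nat s) - 1 = g" using x(4) f(1,2) by (simp add: of_nat_diff)
    have S: "hook_shape (nat s) (r - nat s) = S" unfolding hook_shape_def g f(3) using f(1) by simp
    show "(\<lambda>a. (hook_shape a (r - a), int a, int a - int (Suc r))) ((\<lambda>(S, s, g). nat s) x) = x"
      using S f(1) x(1,4) by simp
    show "(\<lambda>(S, s, g). nat s) x \<in> {..r}" using x(1,4) f by simp
    show "1 / hook_prod (hook_shape ((\<lambda>(S, s, g). nat s) x) (r - (\<lambda>(S, s, g). nat s) x)) ^ 2 = (\<lambda>(S, p). 1 / hook_prod S ^ 2) x"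
      using S x(1) by simp
  qed auto
  also have "\<dots> = (\<Sum>a\<le>r. of_nat ((r choose a) ^ 2) / fact (Suc r) ^ 2)"
  proof (intro sum.cong refl)
    fix a assume "a \<in> {..r}"
    then have a: "a \<le> r" by simp
    have "(of_nat (r choose a) :: rat) = fact r / (fact a * fact (r - a))"
      using a by (rule binomial_fact)
    moreover have "hook_prod (hook_shape a (r - a)) = of_nat (Suc r) * (fact a * fact (r - a))"
      using a unfolding hook_prod_hook_shape by simp
    ultimately show "1 / hook_prod (hook_shape a (r - a)) ^ 2 = of_nat ((r choose a) ^ 2) / fact (Suc r) ^ 2"
      by (simp add: power_divide power_mult_distrib fact_Suc del: of_nat_Suc)
  qed
  also have "\<dots> = of_nat (\<Sum>a\<le>r. (r choose a) ^ 2) / fact (Suc r) ^ 2"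
    by (simp add: sum_divide_distrib)
  finally show ?thesis by (simp only: choose_square_sum)
qed

lemma prod_diff_squares:
  "(\<Prod>i=1..r. of_nat (Suc r) ^ 2 - of_nat i ^ 2 :: rat) = fact r * fact (2 * r + 1) / fact (Suc r)"
proof -
  have "(\<Prod>i=1..r. of_nat (Suc r) ^ 2 - of_nat i ^ 2 :: rat)
      = (\<Prod>i=1..r. of_nat (Suc r) - of_nat i) * (\<Prod>i=1..r. of_nat (Suc r) + of_nat i)"
    unfolding prod.distrib[symmetric] by (simp only: power2_eq_square square_diff_square_factored mult.commute)
  also have "(\<Prod>i=1..r. of_nat (Suc r) - of_nat i :: rat) = (\<Prod>i=1..r. of_nat i)"
    by (rule prod.reindex_bij_witness[where i = "\<lambda>i. Suc r - i" and j = "\<lambda>i. Suc r - i"]) (auto simp: of_nat_diff)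
  also have "\<dots> = fact r" by (simp add: fact_prod)
  also have "(\<Prod>i=1..m. of_nat (Suc r) + of_nat i :: rat) = fact (Suc r + m) / fact (Suc r)" for m
  proof (induction m)
    case (Suc m)
    have "fact (Suc r + Suc m) = ((of_nat (Suc r) + of_nat (Suc m)) * fact (Suc r + m) :: rat)"
      unfolding of_nat_add[symmetric] add_Suc_right by (rule fact_Suc)
    then show ?case using Suc by (simp del: fact_Suc of_nat_Suc)
  qed simp
  finally show ?thesis by (simp add: mult_2 del: fact_Suc)
qed

text \<open>Equivalently, \<open>C_coeff r\<close> is the product of the values found in
  \<open>full_hook_sum\<close> and \<open>prod_diff_squares\<close>; this is the origin of the
  constant.\<close>

lemma C_coeff_eq:
  "C_coeff r * fact (Suc r) ^ 3 = of_nat (2 * r choose r) * fact r * fact (2 * r + 1)"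
proof -
  have "(of_nat (2 * r + 2 choose (r + 1)) :: rat) = fact (2 * r + 2) / (fact (r + 1) * fact (r + 1))"
    by (subst binomial_fact) simp_all
  moreover have "1 / (2 * n ^ 2) * B * (F' / (F * F)) * F ^ 3 = B * (F * F' / (2 * n ^ 2))"
    if "F \<noteq> 0" for F F' B n :: rat
    using that by (simp add: power3_eq_cube)
  ultimately have "C_coeff r * fact (Suc r) ^ 3 = of_nat (2 * r choose r) * (fact (Suc r) * fact (2 * r + 2) / (2 * of_nat (Suc r) ^ 2))"
    unfolding C_coeff_def by (simp del: fact_Suc of_nat_Suc add: Suc_eq_plus1[symmetric])
  also have "fact (Suc r) * fact (2 * r + 2) / (2 * of_nat (Suc r) ^ 2) = (fact r * fact (2 * r + 1) :: rat)"
  proof -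
    have "fact (Suc r) = (of_nat (Suc r) * fact r :: rat)"
      "fact (2 * r + 2) = (2 * of_nat (Suc r) * fact (2 * r + 1) :: rat)" by simp_all
    moreover have "n * f * (2 * n * g) / (2 * n ^ 2) = f * g" if "n \<noteq> 0" for n f g :: rat
      using that by (simp add: power2_eq_square)
    ultimately show ?thesis by (simp del: fact_Suc of_nat_Suc)
  qed
  finally show ?thesis by (simp del: fact_Suc of_nat_Suc)
qed

text \<open>The average is a polynomial of degree at most \<open>r + 1\<close> in \<open>n\<close>, it vanishes for
  \<open>n \<le> r\<close> because all hooks are then at most \<open>r\<close>, and for \<open>n = r + 1\<close> only hook shapes contribute.\<close>

lemma plancherel_hook_statistic:
  "plancherel (hook_statistic r 0) n = fact (Suc r) * C_coeff r * of_nat (n choose Suc r)"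
proof -
  \<comment> \<open>The value of the product at hook length \<open>r + 1\<close>; every shorter hook
    makes one factor vanish.\<close>
  define c where "c = (\<Prod>i=1..r. of_nat (Suc r) ^ 2 - of_nat i ^ 2 :: rat)"
  have "hook_statistic r 0 S / hook_prod S ^ 2 = c * (\<Sum>(s, g)\<in>{p\<in>hook_pairs S. fst p - snd p = int (Suc r)}. 1 / hook_prod S ^ 2)"
    if S: "S \<in> level (Suc r)" for S
  proof -
    have "hook_statistic r 0 S = (\<Sum>p\<in>hook_pairs S. if fst p - snd p = int (Suc r) then c else 0)"
      unfolding hook_statistic_def
    proof (intro sum.cong refl, clarify)
      fix s g assume sg: "(s, g) \<in> hook_pairs S"
      show "of_int (s - g) ^ (2 * 0) * (\<Prod>i=1..r. of_int (s - g) ^ 2 - of_nat i ^ 2) = (if fst (s, g) - snd (s, g) = int (Suc r) then c else 0)"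
      proof (cases "s - g = int (Suc r)")
        case True
        then show ?thesis by (simp add: c_def)
      next
        case False
        define h where "h = nat (s - g)"
        have "of_int (s - g) = (of_nat h :: rat)" "h \<in> {1..r}"
          using hook_le_level[OF S sg] sg False by (auto simp: h_def hook_pairs_def)
        then have "(\<Prod>i=1..r. of_int (s - g) ^ 2 - of_nat i ^ 2 :: rat) = 0"
          by (intro prod_zero) auto
        then show ?thesis using False by simp
      qed
    qed
    also have "\<dots> = (\<Sum>p\<in>{p\<in>hook_pairs S. fst p - snd p = int (Suc r)}. c)"
      using S by (subst sum.inter_filter) (auto simp: level_def)
    finally show ?thesis by (simp add: split_def)
  qed
  then have "plancherel (hook_statistic r 0) (Suc r) = fact (Suc r) * (c * (of_nat (2 * r choose r) / fact (Suc r) ^ 2))"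
    unfolding plancherel_def full_hook_sum[symmetric] sum_distrib_left[of c] by (simp cong: sum.cong)
  also have "\<dots> = fact (Suc r) * C_coeff r"
    using C_coeff_eq[of r] unfolding c_def prod_diff_squares
    by (simp add: field_simps power2_eq_square power3_eq_cube del: fact_Suc)
  finally have v: "plancherel (hook_statistic r 0) (Suc r) = fact (Suc r) * C_coeff r" .
  have "plancherel (hook_statistic r 0) i = 0" if "i < Suc r" for i
    using that hook_statistic_eq_0 by (simp add: plancherel_def)
  moreover have "difference_vanishes (Suc (Suc r)) (plancherel (hook_statistic r 0))"
    using hook_statistic_plancherel[of r 0] by simp
  ultimately show ?thesis
    using difference_vanishes_binomial[of "Suc r" "plancherel (hook_statistic r 0)" n] v by presburger
qed

section \<open>The two sums over partitions in closed form\<close>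

text \<open>A constant has increment 0, so the total mass keeps its value for the empty
  diagram.\<close>

lemma plancherel_one: "(\<Sum>S\<in>level n. 1 / hook_prod S ^ 2) = 1 / fact n"
proof -
  have "plancherel (\<lambda>_. 1) n = 1"
  proof (induction n)
    case 0
    have "hook_pairs {..<0} = {}" by (auto simp: hook_pairs_def)
    then show ?case by (simp add: plancherel_def level_0 hook_prod_def)
  next
    case (Suc n)
    have "plancherel (\<lambda>_. 1) (Suc n) - plancherel (\<lambda>_. 1) n = plancherel (\<lambda>_. 0) n"
      unfolding plancherel_difference by (intro plancherel_cong) (simp add: up_average_def)
    moreover have "plancherel (\<lambda>_. 0) n = 0" by (simp add: plancherel_def)
    ultimately show ?case using Suc by simp
  qed
  then show ?thesis by (simp add: plancherel_def field_simps)
qed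

text \<open>Splitting \<open>h ^ 2\<close> as \<open>(h ^ 2 - (i + 1) ^ 2) + (i + 1) ^ 2\<close>
  turns multiplication by \<open>h ^ 2\<close> into the recurrence of the central factorial
  numbers.\<close>

lemma power_central_factorial:
  fixes h :: rat
  shows "h ^ (2 * k) = (\<Sum>i\<le>k. of_nat (central_factorial (k + 1) (i + 1)) * (\<Prod>j=1..i. h ^ 2 - of_nat j ^ 2))"
proof (induction k)
  case (Suc k)
  let ?T = "\<lambda>k i. of_nat (central_factorial k i) :: rat" and ?P = "\<lambda>i. \<Prod>j=1..i. h ^ 2 - of_nat j ^ 2"
  \<comment> \<open>This lets the second of the two sums below run up to
    \<open>Suc k\<close>.\<close>
  have top: "central_factorial k i = 0" if "k < i" for k i
    using that by (induction k i rule: central_factorial.induct) auto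
  have "h ^ (2 * Suc k) = h ^ 2 * h ^ (2 * k)" by (simp add: power2_eq_square)
  also have "\<dots> = (\<Sum>i\<le>k. ?T (k + 1) (i + 1) * (?P (Suc i) + of_nat (i + 1) ^ 2 * ?P i))"
    unfolding Suc.IH sum_distrib_left by (intro sum.cong refl) (simp add: algebra_simps)
  also have "\<dots> = (\<Sum>i\<le>k. ?T (k + 1) (i + 1) * ?P (Suc i)) + (\<Sum>i\<le>k. of_nat (i + 1) ^ 2 * ?T (k + 1) (i + 1) * ?P i)"
    by (simp only: distrib_left sum.distrib mult_ac)
  also have "(\<Sum>i\<le>k. of_nat (i + 1) ^ 2 * ?T (k + 1) (i + 1) * ?P i) = (\<Sum>i\<le>Suc k. of_nat (i + 1) ^ 2 * ?T (k + 1) (i + 1) * ?P i)"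
    using top[of "k + 1" "Suc k + 1"] by (simp del: central_factorial.simps)
  also have "(\<Sum>i\<le>k. ?T (k + 1) (i + 1) * ?P (Suc i)) = (\<Sum>i\<le>Suc k. ?T (k + 1) i * ?P i)"
    by (subst sum.atMost_Suc_shift) (simp del: central_factorial.simps(3) prod.cl_ivl_Suc)
  also have "(\<Sum>i\<le>Suc k. ?T (k + 1) i * ?P i) + (\<Sum>i\<le>Suc k. of_nat (i + 1) ^ 2 * ?T (k + 1) (i + 1) * ?P i)
      = (\<Sum>i\<le>Suc k. ?T (Suc k + 1) (i + 1) * ?P i)"
    unfolding sum.distrib[symmetric] by (intro sum.cong refl) (simp add: algebra_simps)
  finally show ?case .
qed simp

text \<open>Division by \<open>fact n\<close> turns \<open>fact (Suc i) * (n choose Suc i)\<close>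
  into \<open>1 / fact (n - Suc i)\<close>, a shifted exponential coefficient. This is why an
  exponential splits off in the generating function.\<close>

lemma okada_panova:
  "(\<Sum>S\<in>level n. hook_power_sum k S / hook_prod S ^ 2)
     = (\<Sum>i\<le>k. of_nat (central_factorial (k + 1) (i + 1)) * C_coeff i * (if Suc i \<le> n then 1 / fact (n - Suc i) else 0))"
proof -
  have "hook_power_sum k = (\<lambda>S. \<Sum>i\<le>k. of_nat (central_factorial (k + 1) (i + 1)) * hook_statistic i 0 S)"
    unfolding hook_power_sum_def hook_statistic_def sum_distrib_left
    by (subst sum.swap) (simp add: power_central_factorial fun_eq_iff split_def)
  then have "(\<Sum>S\<in>level n. hook_power_sum k S / hook_prod S ^ 2)
      = (\<Sum>i\<le>k. of_nat (central_factorial (k + 1) (i + 1)) * (\<Sum>S\<in>level n. hook_statistic i 0 S / hook_prod S ^ 2))"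
    unfolding sum_distrib_left by (subst sum.swap) (simp add: sum_divide_distrib)
  also have "\<dots> = (\<Sum>i\<le>k. of_nat (central_factorial (k + 1) (i + 1)) * (C_coeff i * (if Suc i \<le> n then 1 / fact (n - Suc i) else 0)))"
  proof (intro sum.cong refl arg_cong2[where f = "(*)"])
    fix i
    have "(\<Sum>S\<in>level n. hook_statistic i 0 S / hook_prod S ^ 2) = C_coeff i * (fact (Suc i) * of_nat (n choose Suc i) / fact n)"
      using plancherel_hook_statistic[of i n] by (simp add: plancherel_def field_simps del: fact_Suc)
    also have "fact (Suc i) * of_nat (n choose Suc i) / fact n = (if Suc i \<le> n then 1 / fact (n - Suc i) else 0 :: rat)"
      by (auto simp: binomial_fact simp del: fact_Suc)
    finally show "(\<Sum>S\<in>level n. hook_statistic i 0 S / hook_prod S ^ 2) = C_coeff i * (if Suc i \<le> n then 1 / fact (n - Suc i) else 0)" .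
  qed
  finally show ?thesis by (simp add: mult.assoc)
qed

section \<open>Generating functions\<close>

definition graded :: "'i set \<Rightarrow> ('i \<Rightarrow> nat) \<Rightarrow> bool" where
  "graded A w \<longleftrightarrow> (\<forall>n. finite {a\<in>A. w a = n})"

text \<open>Each coefficient is a sum over a fibre of \<open>w\<close>. Over an infinite fibre the
  sum would be 0 by default; \<open>graded\<close> excludes this.\<close>

definition gf :: "'i set \<Rightarrow> ('i \<Rightarrow> nat) \<Rightarrow> ('i \<Rightarrow> 'a::comm_ring_1) \<Rightarrow> 'a fps" where
  "gf A w c = Abs_fps (\<lambda>n. \<Sum>a\<in>{a\<in>A. w a = n}. c a)"

lemma gf_cong:
  assumes "\<And>a. a \<in> A \<Longrightarrow> w a = v a" "\<And>a. a \<in> A \<Longrightarrow> c a = d a"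
  shows "gf A w c = gf A v d"
proof (rule fps_ext)
  fix n
  have "{a\<in>A. w a = n} = {a\<in>A. v a = n}" using assms(1) by auto
  moreover have "(\<Sum>a\<in>{a\<in>A. v a = n}. c a) = (\<Sum>a\<in>{a\<in>A. v a = n}. d a)"
    using assms(2) by (intro sum.cong) auto
  ultimately show "fps_nth (gf A w c) n = fps_nth (gf A v d) n" unfolding gf_def by simp
qed

lemma bij_betw_level:
  assumes "bij_betw f A B" "\<And>a. a \<in> A \<Longrightarrow> v (f a) = w a"
  shows "bij_betw f {a\<in>A. w a = n} {b\<in>B. v b = n}"
  by (rule bij_betw_subset[OF assms(1)]) (use assms in \<open>auto simp: bij_betw_def\<close>)

lemma gf_reindex:
  assumes "bij_betw f A B" "\<And>a. a \<in> A \<Longrightarrow> v (f a) = w a" "\<And>a. a \<in> A \<Longrightarrow> d (f a) = c a"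
  shows "gf B v d = gf A w c"
  unfolding gf_def
proof (intro arg_cong[where f = Abs_fps] ext)
  fix n
  have "(\<Sum>a\<in>{a\<in>A. w a = n}. c a) = (\<Sum>a\<in>{a\<in>A. w a = n}. d (f a))"
    using assms(3) by (intro sum.cong) auto
  also have "\<dots> = (\<Sum>b\<in>{b\<in>B. v b = n}. d b)"
    by (intro sum.reindex_bij_betw bij_betw_level assms)
  finally show "(\<Sum>b\<in>{b\<in>B. v b = n}. d b) = (\<Sum>a\<in>{a\<in>A. w a = n}. c a)" ..
qed

lemma graded_reindex:
  assumes "bij_betw f A B" "\<And>a. a \<in> A \<Longrightarrow> v (f a) = w a" "graded A w"
  shows "graded B v"
  unfolding graded_def
proof
  fix n
  have "finite {a\<in>A. w a = n}" using assms(3) by (simp add: graded_def)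
  then show "finite {b\<in>B. v b = n}"
    using bij_betw_finite[OF bij_betw_level[of f A B v w n, OF assms(1,2)]] by blast
qed

lemma graded_subset: "graded A w \<Longrightarrow> B \<subseteq> A \<Longrightarrow> graded B w"
proof -
  assume AB: "graded A w" "B \<subseteq> A"
  then have "{a\<in>B. w a = n} \<subseteq> {a\<in>A. w a = n}" "finite {a\<in>A. w a = n}" for n
    by (auto simp: graded_def)
  then show ?thesis unfolding graded_def using finite_subset by blast
qed

lemma graded_times:
  assumes "graded A w" "graded B v"
  shows "graded (A \<times> B) (\<lambda>(a, b). w a + v b)"
  unfolding graded_def
proof
  fix n
  have "{p\<in>A \<times> B. (\<lambda>(a, b). w a + v b) p = n} \<subseteq> (\<Union>i\<le>n. {a\<in>A. w a = i}) \<times> (\<Union>i\<le>n. {b\<in>B. v b = i})"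
    by auto
  then show "finite {p\<in>A \<times> B. (\<lambda>(a, b). w a + v b) p = n}"
    by (rule finite_subset) (use assms in \<open>auto simp: graded_def\<close>)
qed

lemma gf_times:
  assumes "graded A w" "graded B v"
  shows "gf (A \<times> B) (\<lambda>(a, b). w a + v b) (\<lambda>(a, b). c a * d b) = gf A w c * gf B v d"
proof (rule fps_ext)
  fix n
  have fin: "finite {a\<in>A. w a = i}" "finite {b\<in>B. v b = i}" for i using assms by (auto simp: graded_def)
  have "fps_nth (gf A w c * gf B v d) n = (\<Sum>i=0..n. \<Sum>(a, b)\<in>{a\<in>A. w a = i} \<times> {b\<in>B. v b = n - i}. c a * d b)"
    by (simp add: gf_def fps_mult_nth sum_product sum.cartesian_product)
  also have "\<dots> = (\<Sum>(i, a, b)\<in>(SIGMA i:{0..n}. {a\<in>A. w a = i} \<times> {b\<in>B. v b = n - i}). c a * d b)"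
    using fin by (subst sum.Sigma) auto
  also have "\<dots> = (\<Sum>(a, b)\<in>{p\<in>A \<times> B. (\<lambda>(a, b). w a + v b) p = n}. c a * d b)"
    by (rule sum.reindex_bij_witness[where i = "\<lambda>(a, b). (w a, a, b)" and j = snd]) auto
  finally show "fps_nth (gf (A \<times> B) (\<lambda>(a, b). w a + v b) (\<lambda>(a, b). c a * d b)) n = fps_nth (gf A w c * gf B v d) n"
    by (simp add: gf_def)
qed

text \<open>Both claims are proved together, since \<open>gf_times\<close> asks at each step for the
  gradedness of the product already formed.\<close>

lemma gf_graded_PiE:
  assumes "finite I" "\<And>i. i \<in> I \<Longrightarrow> graded (A i) (w i)"
  shows "gf (PiE I A) (\<lambda>f. \<Sum>i\<in>I. w i (f i)) (\<lambda>f. \<Prod>i\<in>I. c i (f i)) = (\<Prod>i\<in>I. gf (A i) (w i) (c i))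
    \<and> graded (PiE I A) (\<lambda>f. \<Sum>i\<in>I. w i (f i))"
  using assms
proof (induction I rule: finite_induct)
  case empty
  have "finite {f. f = (\<lambda>x. undefined) \<and> P}" for P by simp
  moreover have "{a. a = (\<lambda>x. undefined) \<and> n = (0::nat)} = (if n = 0 then {\<lambda>x. undefined} else {})" for n by auto
  ultimately show ?case by (auto simp: gf_def graded_def fps_eq_iff)
next
  case (insert i I)
  let ?h = "\<lambda>(y, g). g(i := y)"
  let ?w = "\<lambda>f. \<Sum>j\<in>insert i I. w j (f j)" and ?c = "\<lambda>f. \<Prod>j\<in>insert i I. c j (f j)"
  have bij: "bij_betw ?h (A i \<times> PiE I A) (PiE (insert i I) A)"
    unfolding bij_betw_def by (intro conjI inj_combinator insert.hyps(2) PiE_insert_eq[symmetric])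
  have w: "?w (?h p) = (\<lambda>(a, b). w i a + (\<Sum>j\<in>I. w j (b j))) p"
    and c: "?c (?h p) = (\<lambda>(a, b). c i a * (\<Prod>j\<in>I. c j (b j))) p" for p
  proof -
    obtain y g where p: "p = (y, g)" by (cases p)
    have "(\<Sum>j\<in>I. w j ((g(i := y)) j)) = (\<Sum>j\<in>I. w j (g j))" "(\<Prod>j\<in>I. c j ((g(i := y)) j)) = (\<Prod>j\<in>I. c j (g j))"
      using insert.hyps(2) by (auto intro!: sum.cong prod.cong)
    then show "?w (?h p) = (\<lambda>(a, b). w i a + (\<Sum>j\<in>I. w j (b j))) p"
      "?c (?h p) = (\<lambda>(a, b). c i a * (\<Prod>j\<in>I. c j (b j))) p"
      using insert.hyps by (simp_all add: p)
  qed
  have gr: "graded (A i) (w i)" "graded (PiE I A) (\<lambda>f. \<Sum>i\<in>I. w i (f i))"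
    using insert.prems insert.IH by blast+
  have "gf (PiE (insert i I) A) ?w ?c = gf (A i \<times> PiE I A) (\<lambda>(a, b). w i a + (\<Sum>j\<in>I. w j (b j))) (\<lambda>(a, b). c i a * (\<Prod>j\<in>I. c j (b j)))"
    by (rule gf_reindex[OF bij], rule w, rule c)
  also have "\<dots> = gf (A i) (w i) (c i) * gf (PiE I A) (\<lambda>f. \<Sum>i\<in>I. w i (f i)) (\<lambda>f. \<Prod>i\<in>I. c i (f i))"
    by (rule gf_times[OF gr])
  also have "\<dots> = (\<Prod>j\<in>insert i I. gf (A j) (w j) (c j))"
  proof -
    have "gf (PiE I A) (\<lambda>f. \<Sum>i\<in>I. w i (f i)) (\<lambda>f. \<Prod>i\<in>I. c i (f i)) = (\<Prod>i\<in>I. gf (A i) (w i) (c i))"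
      using insert.IH insert.prems by blast
    then show ?thesis by (simp only: prod.insert[OF insert.hyps])
  qed
  finally have "gf (PiE (insert i I) A) ?w ?c = (\<Prod>j\<in>insert i I. gf (A j) (w j) (c j))" .
  moreover have "graded (PiE (insert i I) A) ?w"
    by (rule graded_reindex[OF bij], rule w, rule graded_times[OF gr])
  ultimately show ?case by blast
qed

lemma gf_cmult: "gf A w (\<lambda>a. k * c a) = fps_const k * gf A w c"
  by (simp add: gf_def fps_eq_iff sum_distrib_left)

lemma gf_sum: "gf A w (\<lambda>a. \<Sum>i\<in>I. c i a) = (\<Sum>i\<in>I. gf A w (c i))"
  by (simp add: gf_def fps_eq_iff fps_sum_nth) (auto intro: sum.swap)

text \<open>In each degree the partial sums are constant as soon as they include the finite fibre of
  \<open>w\<close>.\<close>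

lemma has_sum_gf:
  assumes "graded A w"
  shows "((\<lambda>a. fps_X ^ w a * fps_const (c a)) has_sum gf A w c) A"
  unfolding has_sum_def
proof (rule tendsto_fpsI)
  fix n
  have fin: "finite {a\<in>A. w a = n}" using assms by (simp add: graded_def)
  show "eventually (\<lambda>X. fps_nth (\<Sum>a\<in>X. fps_X ^ w a * fps_const (c a)) n = fps_nth (gf A w c) n) (finite_subsets_at_top A)"
    unfolding eventually_finite_subsets_at_top
  proof (intro exI conjI allI impI)
    fix X assume X: "finite X \<and> {a\<in>A. w a = n} \<subseteq> X \<and> X \<subseteq> A"
    have "fps_nth (\<Sum>a\<in>X. fps_X ^ w a * fps_const (c a)) n = (\<Sum>a\<in>X. if w a = n then c a else 0)"
      by (simp add: fps_sum_nth fps_X_power_mult_nth) (intro sum.cong, auto)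
    also have "\<dots> = (\<Sum>a\<in>{a\<in>A. w a = n}. c a)"
      using X by (intro sum.mono_neutral_cong_right) auto
    finally show "fps_nth (\<Sum>a\<in>X. fps_X ^ w a * fps_const (c a)) n = fps_nth (gf A w c) n"
      by (simp add: gf_def)
  qed (use fin in auto)
qed

section \<open>Infinite products, coefficient by coefficient\<close>

text \<open>For \<open>j \<ge> N\<close> the power \<open>z ^ j\<close> has no terms up to degree
  \<open>n\<close>, so the later factors leave this coefficient alone.\<close>

lemma qpoch_inf_nth:
  assumes "fps_nth a 0 = 0" "fps_nth z 0 = 0" "n < N"
  shows "fps_nth (qpoch_inf a z) n = fps_nth (\<Prod>j<N. 1 - a * z ^ j) n"
proof -
  let ?f = "\<lambda>j. 1 - a * z ^ j"
  have "?f i \<noteq> 0" for i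
  proof
    assume "?f i = 0"
    from arg_cong[OF this, of "\<lambda>f. fps_nth f 0"] show False using assms by simp
  qed
  then have "raw_has_prod ?f 0 (qpoch_inf a z)"
    using qpoch_has_prod[OF assms(1,2)] unfolding has_prod_def by blast
  then have "(\<lambda>m. \<Prod>i\<le>m. ?f i) \<longlonglongrightarrow> qpoch_inf a z" by (simp add: raw_has_prod_def)
  then have "eventually (\<lambda>m. fps_nth (\<Prod>i\<le>m. ?f i) n = fps_nth (qpoch_inf a z) n) sequentially"
    by (simp add: tendsto_fps_iff)
  then obtain M where M: "\<And>m. m \<ge> M \<Longrightarrow> fps_nth (\<Prod>i\<le>m. ?f i) n = fps_nth (qpoch_inf a z) n"
    unfolding eventually_sequentially by blast
  have step: "fps_nth (\<Prod>j<N + d. ?f j) n = fps_nth (\<Prod>j<N. ?f j) n" for d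
  proof (induction d)
    case (Suc d)
    have "fps_nth ((\<Prod>j<N + d. ?f j) * a * z ^ (N + d)) n = 0"
    proof (subst fps_mult_nth, intro sum.neutral ballI)
      fix i assume "i \<in> {0..n}"
      then have "fps_nth (z ^ (N + d)) (n - i) = 0"
        using startsby_zero_power_prefix[OF assms(2), of "N + d"] assms(3) by simp
      then show "fps_nth ((\<Prod>j<N + d. ?f j) * a) i * fps_nth (z ^ (N + d)) (n - i) = 0" by simp
    qed
    moreover have "(\<Prod>j<N + Suc d. ?f j) = (\<Prod>j<N + d. ?f j) - (\<Prod>j<N + d. ?f j) * a * z ^ (N + d)"
      by (simp add: right_diff_distrib mult.assoc)
    ultimately show ?case using Suc.IH by simp
  qed simp
  have "fps_nth (qpoch_inf a z) n = fps_nth (\<Prod>j<Suc (N + M). ?f j) n"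
    using M[of "N + M"] by (simp add: lessThan_Suc_atMost)
  also have "\<dots> = fps_nth (\<Prod>j<N. ?f j) n" using step[of "Suc M"] by simp
  finally show ?thesis .
qed

lemma fps_mult_nth_cong:
  fixes f f' g g' :: "'a::comm_ring_1 fps"
  assumes "\<And>i. i \<le> n \<Longrightarrow> fps_nth f i = fps_nth f' i" "\<And>i. i \<le> n \<Longrightarrow> fps_nth g i = fps_nth g' i"
  shows "fps_nth (f * g) n = fps_nth (f' * g') n"
proof -
  have "fps_nth f i * fps_nth g (n - i) = fps_nth f' i * fps_nth g' (n - i)" if "i \<in> {0..n}" for i
    using that assms(1)[of i] assms(2)[of "n - i"] by simp
  then show ?thesis unfolding fps_mult_nth by (intro sum.cong) blast+
qed

text \<open>Expanding the product chooses a subset of \<open>{..<N}\<close>. Because of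
  \<open>a < w a\<close>, a set of weight \<open>n\<close> has no elements outside this
  range.\<close>

lemma gf_finite_sets:
  fixes c :: "nat \<Rightarrow> 'a::comm_ring_1"
  assumes w: "\<And>a. a < w a" and "n < N"
  shows "fps_nth (gf {A. finite A} (\<lambda>A. \<Sum>a\<in>A. w a) (\<lambda>A. \<Prod>a\<in>A. c a)) n
       = fps_nth (\<Prod>a<N. 1 + fps_const (c a) * fps_X ^ w a) n"
proof -
  have mon: "(\<Prod>a\<in>A. fps_const (c a) * fps_X ^ w a) = fps_const (\<Prod>a\<in>A. c a) * fps_X ^ (\<Sum>a\<in>A. w a)" for A
    by (induction A rule: infinite_finite_induct) (simp_all add: power_add mult_ac flip: fps_const_mult)
  have "(\<Prod>a<N. 1 + fps_const (c a) * fps_X ^ w a) = (\<Sum>A\<in>Pow {..<N}. fps_const (\<Prod>a\<in>A. c a) * fps_X ^ (\<Sum>a\<in>A. w a))"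
    using prod_add[of "{..<N}" "\<lambda>a. fps_const (c a) * fps_X ^ w a" "\<lambda>_. 1"] by (simp add: mon add.commute)
  then have "fps_nth (\<Prod>a<N. 1 + fps_const (c a) * fps_X ^ w a) n
      = (\<Sum>A\<in>Pow {..<N}. if (\<Sum>a\<in>A. w a) = n then \<Prod>a\<in>A. c a else 0)"
    by (simp add: fps_sum_nth) (intro sum.cong, auto)
  also have "\<dots> = (\<Sum>A\<in>{A. finite A \<and> (\<Sum>a\<in>A. w a) = n}. \<Prod>a\<in>A. c a)"
  proof (intro sum.mono_neutral_cong)
    have "A \<subseteq> {..<N}" if "finite A" "(\<Sum>a\<in>A. w a) = n" for A
    proof
      fix a assume "a \<in> A"
      then have "w a \<le> n" using that member_le_sum[of a A w] by simp
      then show "a \<in> {..<N}" using w[of a] assms(2) by simp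
    qed
    then have "{A. finite A \<and> (\<Sum>a\<in>A. w a) = n} \<subseteq> Pow {..<N}" by auto
    then show "finite {A. finite A \<and> (\<Sum>a\<in>A. w a) = n}" by (rule finite_subset) auto
    show "(\<Prod>a\<in>A. c a) = 0" if "A \<in> {A. finite A \<and> (\<Sum>a\<in>A. w a) = n} - Pow {..<N}" for A
      using that \<open>{A. finite A \<and> (\<Sum>a\<in>A. w a) = n} \<subseteq> Pow {..<N}\<close> by auto
  qed (auto dest: finite_subset)
  finally show ?thesis by (simp add: gf_def)
qed

section \<open>The coefficient ring and exponential series\<close>

lemma b_pow_0 [simp]: "b_pow 0 = 1"
  by (simp add: b_pow_def flip: single_one)

lemma b_pow_add: "b_pow (m + n) = b_pow m * b_pow n"
  by (simp add: b_pow_def mult_single)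

lemma b_pow_sum: "b_pow (\<Sum>i\<in>I. f i) = (\<Prod>i\<in>I. b_pow (f i))"
  by (induction I rule: infinite_finite_induct) (simp_all add: b_pow_add)

lemma scalar_0 [simp]: "scalar 0 = 0"
  by (simp add: scalar_def)

lemma scalar_1 [simp]: "scalar 1 = 1"
  by (simp add: scalar_def one_pCons flip: single_one)

lemma scalar_add: "scalar (a + b) = scalar a + scalar b"
  by (simp add: scalar_def flip: single_add)

lemma scalar_mult: "scalar (a * b) = scalar a * scalar b"
  by (simp add: scalar_def mult_single mult.commute)

lemma scalar_sum: "scalar (\<Sum>i\<in>I. f i) = (\<Sum>i\<in>I. scalar (f i))"
  by (induction I rule: infinite_finite_induct) (simp_all add: scalar_add)

lemma scalar_prod: "scalar (\<Prod>i\<in>I. f i) = (\<Prod>i\<in>I. scalar (f i))"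
  by (induction I rule: infinite_finite_induct) (simp_all add: scalar_mult)

lemma scalar_power: "scalar (a ^ n) = scalar a ^ n"
  by (induction n) (simp_all add: scalar_mult)

lemma scalar_of_nat: "scalar (of_nat n) = of_nat n"
  by (induction n) (simp_all add: scalar_add)

text \<open>The exponential of \<open>a * fps_X\<close>. Keeping \<open>a\<close> in the
  coefficients reduces the exponential law to the binomial theorem in the coefficient ring.\<close>

definition exp_series :: "laurent \<Rightarrow> laurent fps" where
  "exp_series a = Abs_fps (\<lambda>n. a ^ n * scalar (1 / fact n))"

lemma exp_series_add: "exp_series (a + b) = exp_series a * exp_series b"
proof (rule fps_ext)
  fix n
  have "fps_nth (exp_series a * exp_series b) n = (\<Sum>i\<le>n. a ^ i * b ^ (n - i) * scalar (1 / (fact i * fact (n - i))))"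
    unfolding fps_mult_nth exp_series_def atLeast0AtMost
    by (intro sum.cong refl) (simp add: mult_ac flip: scalar_mult)
  also have "\<dots> = (\<Sum>i\<le>n. of_nat (n choose i) * a ^ i * b ^ (n - i) * scalar (1 / fact n))"
  proof (intro sum.cong refl)
    fix i assume "i \<in> {..n}"
    then have "1 / (fact i * fact (n - i)) = (of_nat (n choose i) * (1 / fact n) :: rat)"
      by (simp add: binomial_fact)
    then have "scalar (1 / (fact i * fact (n - i))) = of_nat (n choose i) * scalar (1 / fact n)"
      by (simp only: scalar_mult scalar_of_nat)
    then show "a ^ i * b ^ (n - i) * scalar (1 / (fact i * fact (n - i))) = of_nat (n choose i) * a ^ i * b ^ (n - i) * scalar (1 / fact n)"
      by (simp add: mult_ac)
  qed
  also have "\<dots> = (a + b) ^ n * scalar (1 / fact n)"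
    by (simp only: binomial_ring sum_distrib_right)
  finally show "fps_nth (exp_series (a + b)) n = fps_nth (exp_series a * exp_series b) n"
    by (simp add: exp_series_def)
qed

lemma exp_series_power: "exp_series a ^ m = exp_series (of_nat m * a)"
proof (induction m)
  case 0
  show ?case by (auto simp: fps_eq_iff exp_series_def)
next
  case (Suc m)
  then show ?case by (simp add: exp_series_add[symmetric] algebra_simps)
qed

lemma exp_fps_monomial: "exp_fps (fps_const a * fps_X ^ d) = exp_series a oo (fps_X ^ d)"
proof (rule fps_ext)
  fix n
  have "fps_nth ((fps_const a * fps_X ^ d) ^ i) n = a ^ i * fps_nth ((fps_X ^ d) ^ i) n" for i
    by (simp only: power_mult_distrib fps_const_power fps_mult_left_const_nth)
  then show "fps_nth (exp_fps (fps_const a * fps_X ^ d)) n = fps_nth (exp_series a oo (fps_X ^ d)) n"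
    unfolding exp_fps_def exp_series_def fps_compose_nth
    by (simp only: fps_nth_Abs_fps) (simp only: mult.left_commute mult.assoc)
qed

lemma exp_fps_power:
  assumes "d > 0"
  shows "exp_fps (fps_const a * fps_X ^ d) ^ m = exp_fps (fps_const (of_nat m * a) * fps_X ^ d)"
proof -
  have "fps_nth (fps_X ^ d :: laurent fps) 0 = 0" using assms by simp
  from fps_compose_power[OF this, of "exp_series a" m]
  show ?thesis by (simp only: exp_fps_monomial exp_series_power)
qed

lemma exp_fps_nth:
  assumes "d > 0"
  shows "fps_nth (exp_fps (fps_const a * fps_X ^ d)) n
       = (if d dvd n then a ^ (n div d) * scalar (1 / fact (n div d)) else 0)"
proof -
  have "fps_nth (exp_fps (fps_const a * fps_X ^ d)) n = (\<Sum>i=0..n. if n = d * i then a ^ i * scalar (1 / fact i) else 0)"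
    unfolding exp_fps_monomial fps_compose_nth exp_series_def
    by (intro sum.cong refl) (simp flip: power_mult)
  also have "\<dots> = (\<Sum>i\<in>(if d dvd n then {n div d} else {}). a ^ i * scalar (1 / fact i))"
    using assms by (intro sum.mono_neutral_cong_right) (auto split: if_splits)
  finally show ?thesis by simp
qed

section \<open>Generating functions over Maya diagrams\<close>

definition maya0 :: "int set set" where
  "maya0 = {S. maya S \<and> charge S = 0}"

lemma gf_maya0_nth:
  assumes "d > 0"
  shows "fps_nth (gf maya0 (\<lambda>S. d * nat (energy S)) c) n = (if d dvd n then \<Sum>S\<in>level (n div d). c S else 0)"
proof (cases "d dvd n")
  case True
  then obtain m where n: "n = d * m" by auto
  have "{S\<in>maya0. d * nat (energy S) = n} = level m"
  proof (intro set_eqI iffI)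
    fix S assume "S \<in> {S\<in>maya0. d * nat (energy S) = n}"
    then have "maya S" "charge S = 0" "nat (energy S) = m" using assms n by (simp_all add: maya0_def)
    then show "S \<in> level m" using energy_nonneg[of S] by (simp add: level_def)
  next
    fix S assume "S \<in> level m"
    then show "S \<in> {S\<in>maya0. d * nat (energy S) = n}" by (simp add: level_def maya0_def n)
  qed
  then show ?thesis using assms by (simp add: gf_def n)
next
  case False
  then have "{S\<in>maya0. d * nat (energy S) = n} = {}" by auto
  then show ?thesis using False unfolding gf_def by (simp only: fps_nth_Abs_fps sum.empty if_False)
qed

lemma graded_maya0:
  assumes "d > 0" shows "graded maya0 (\<lambda>S. d * nat (energy S))"
  unfolding graded_def
proof
  fix n
  have "{S\<in>maya0. d * nat (energy S) = n} \<subseteq> level (n div d)"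
  proof
    fix S assume "S \<in> {S\<in>maya0. d * nat (energy S) = n}"
    then have "maya S" "charge S = 0" "nat (energy S) = n div d" using assms by (auto simp: maya0_def)
    then show "S \<in> level (n div d)" using energy_nonneg[of S] by (simp add: level_def)
  qed
  then show "finite {S\<in>maya0. d * nat (energy S) = n}" by (rule finite_subset) simp
qed

lemma gf_plancherel:
  assumes "d > 0"
  shows "gf maya0 (\<lambda>S. d * nat (energy S)) (\<lambda>S. a ^ nat (energy S) * scalar (1 / hook_prod S ^ 2))
       = exp_fps (fps_const a * fps_X ^ d)"
proof (rule fps_ext)
  fix n
  have "(\<Sum>S\<in>level m. a ^ nat (energy S) * scalar (1 / hook_prod S ^ 2)) = a ^ m * scalar (1 / fact m)" for m
  proof -
    have "(\<Sum>S\<in>level m. a ^ nat (energy S) * scalar (1 / hook_prod S ^ 2)) = (\<Sum>S\<in>level m. a ^ m * scalar (1 / hook_prod S ^ 2))"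
      by (intro sum.cong refl) (simp add: level_def)
    then show ?thesis by (simp add: plancherel_one flip: sum_distrib_left scalar_sum)
  qed
  then show "fps_nth (gf maya0 (\<lambda>S. d * nat (energy S)) (\<lambda>S. a ^ nat (energy S) * scalar (1 / hook_prod S ^ 2))) n
      = fps_nth (exp_fps (fps_const a * fps_X ^ d)) n"
    unfolding gf_maya0_nth[OF assms] exp_fps_nth[OF assms] by simp
qed

text \<open>The number \<open>1 / fact (n - Suc i)\<close> is an exponential coefficient delayed by
  \<open>i + 1\<close>, so the summand for \<open>i\<close> is the exponential times the
  \<open>(i + 1)\<close>-st power of the monomial.\<close>

lemma gf_okada_panova:
  assumes "d > 0"
  shows "gf maya0 (\<lambda>S. d * nat (energy S)) (\<lambda>S. a ^ nat (energy S) * scalar (hook_power_sum k S / hook_prod S ^ 2))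
       = exp_fps (fps_const a * fps_X ^ d) *
         (\<Sum>i=0..k. fps_const (scalar (of_nat (central_factorial (k + 1) (i + 1)) * C_coeff i)) * (fps_const a * fps_X ^ d) ^ (i + 1))"
proof (rule fps_ext)
  fix n
  define T where "T i = of_nat (central_factorial (k + 1) (i + 1)) * C_coeff i" for i
  let ?E = "exp_fps (fps_const a * fps_X ^ d)"
  have summand: "fps_nth (?E * (fps_const (scalar (T i)) * (fps_const a * fps_X ^ d) ^ (i + 1))) n
     = (if d dvd n then a ^ (n div d) * scalar (T i * (if Suc i \<le> n div d then 1 / fact (n div d - Suc i) else 0)) else 0)" for i
  proof -
    have 1: "?E * (fps_const (scalar (T i)) * (fps_const a * fps_X ^ d) ^ (i + 1))
        = fps_const (scalar (T i) * a ^ (i + 1)) * (?E * fps_X ^ (d * (i + 1)))"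
    proof -
      have "(fps_const a * fps_X ^ d) ^ (i + 1) = fps_const (a ^ (i + 1)) * fps_X ^ (d * (i + 1))"
        by (simp only: power_mult_distrib fps_const_power power_mult)
      moreover have "E * (s * (A * X)) = (s * A) * (E * X)" for E s A X :: "laurent fps"
        by (simp add: mult_ac)
      ultimately show ?thesis by (simp only: fps_const_mult[symmetric])
    qed
    have 2: "fps_nth (?E * (fps_const (scalar (T i)) * (fps_const a * fps_X ^ d) ^ (i + 1))) n
        = scalar (T i) * a ^ (i + 1) * (if n < d * (i + 1) then 0 else fps_nth ?E (n - d * (i + 1)))"
      unfolding 1 fps_mult_left_const_nth fps_X_power_mult_right_nth ..
    show ?thesis
    proof (cases "d dvd n")
      case True
      then obtain m where n: "n = d * m" by auto
      have lt: "n < d * (i + 1) \<longleftrightarrow> \<not> Suc i \<le> m" 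
        using nat_mult_less_cancel1[OF assms, of m "i + 1"] unfolding n by linarith
      have sub: "n - d * (i + 1) = d * (m - Suc i)" by (simp add: n diff_mult_distrib2)
      show ?thesis
      proof (cases "Suc i \<le> m")
        case True
        have nd: "d dvd n" "n div d = m" "d dvd d * (m - Suc i)" "d * (m - Suc i) div d = m - Suc i"
          using assms by (simp_all add: n)
        have am: "a ^ m = a ^ (i + 1) * a ^ (m - Suc i)" by (subst power_add[symmetric]) (use True in simp)
        show ?thesis
          unfolding 2 lt sub exp_fps_nth[OF assms]
          by (simp only: True nd not_True_eq_False if_False if_True scalar_mult am mult_ac)
      next
        case False
        then show ?thesis unfolding 2 lt using assms by (simp add: n)
      qed
    next
      case False
      then have "\<not> d dvd n - d * (i + 1) \<or> n < d * (i + 1)"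
        by (meson dvd_diffD dvd_triv_left not_le)
      then have "(if n < d * (i + 1) then 0 else fps_nth ?E (n - d * (i + 1))) = 0"
        unfolding exp_fps_nth[OF assms] by (elim disjE) (simp_all only: if_False if_True if_cancel)
      then show ?thesis unfolding 2 using False by (simp only: if_False mult_zero_right)
    qed
  qed
  have lev: "(\<Sum>S\<in>level m. a ^ nat (energy S) * scalar (hook_power_sum k S / hook_prod S ^ 2))
      = (\<Sum>i=0..k. a ^ m * scalar (T i * (if Suc i \<le> m then 1 / fact (m - Suc i) else 0)))" for m
  proof -
    have "(\<Sum>S\<in>level m. a ^ nat (energy S) * scalar (hook_power_sum k S / hook_prod S ^ 2))
        = (\<Sum>S\<in>level m. a ^ m * scalar (hook_power_sum k S / hook_prod S ^ 2))"
      by (intro sum.cong refl) (simp add: level_def)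
    also have "\<dots> = a ^ m * scalar (\<Sum>S\<in>level m. hook_power_sum k S / hook_prod S ^ 2)"
      by (simp only: sum_distrib_left scalar_sum)
    finally show ?thesis unfolding okada_panova T_def by (simp only: sum_distrib_left scalar_sum atLeast0AtMost)
  qed
  show "fps_nth (gf maya0 (\<lambda>S. d * nat (energy S)) (\<lambda>S. a ^ nat (energy S) * scalar (hook_power_sum k S / hook_prod S ^ 2))) n
     = fps_nth (?E * (\<Sum>i=0..k. fps_const (scalar (of_nat (central_factorial (k + 1) (i + 1)) * C_coeff i)) * (fps_const a * fps_X ^ d) ^ (i + 1))) n"
    unfolding gf_maya0_nth[OF assms] lev T_def[symmetric] sum_distrib_left[of ?E] fps_sum_nth summand by simp
qed

section \<open>Translated diagrams: a charge and a partition\<close>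

definition shift :: "int \<Rightarrow> int set \<Rightarrow> int set" where
  "shift c S = (\<lambda>z. z + c) ` S"

lemma mem_shift: "z \<in> shift c S \<longleftrightarrow> z - c \<in> S"
  by (auto simp: shift_def intro!: image_eqI[where x = "z - c"])

lemma shift_lessThan: "shift c {..<d} = {..<d + c}"
  by (auto simp: mem_shift)

lemma shift_add_box: "shift c (add_box x S) = add_box (x + c) (shift c S)"
  by (auto simp: mem_shift add_box_def)

lemma addable_shift: "x + c \<in> addable (shift c S) \<longleftrightarrow> x \<in> addable S"
  by (simp add: addable_def mem_shift algebra_simps)

lemma shift_shift [simp]: "shift c (shift d S) = shift (c + d) S"
  by (auto simp: mem_shift algebra_simps)

lemma shift_0 [simp]: "shift 0 S = S"
  by (auto simp: mem_shift)

lemma maya_shift [simp]: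
  assumes "maya S" shows "maya (shift c S)"
  using assms by (induction rule: maya_induct) (simp_all add: shift_lessThan shift_add_box)

lemma msum_shift:
  assumes "maya S"
  shows "msum f (shift c S) = msum (\<lambda>z. f (z + c)) S + msum f {..<c}"
  using assms
proof (induction rule: maya_induct)
  case (lessThan d)
  show ?case unfolding shift_lessThan
  proof (induction d rule: int_induct[where k = 0])
    case (step1 i)
    then show ?case using msum_lessThan_Suc[of f "i + c"] msum_lessThan_Suc[of "\<lambda>z. f (z + c)" i]
      by (simp add: algebra_simps)
  next
    case (step2 i)
    then show ?case using msum_lessThan_Suc[of f "i - 1 + c"] msum_lessThan_Suc[of "\<lambda>z. f (z + c)" "i - 1"]
      by (simp add: algebra_simps)
  qed simp
next
  case (add S x)
  have "x + c \<in> addable (shift c S)" using add by (simp add: addable_shift)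
  then show ?case using add
    by (simp add: shift_add_box msum_add_box algebra_simps)
qed

lemma charge_shift: "maya S \<Longrightarrow> charge (shift c S) = charge S + c"
  by (simp add: msum_shift)

lemma hook_pairs_shift: "hook_pairs (shift c S) = (\<lambda>(s, g). (s + c, g + c)) ` hook_pairs S"
proof (rule set_eqI)
  fix p :: "int \<times> int"
  obtain s g where p: "p = (s, g)" by (cases p)
  show "p \<in> hook_pairs (shift c S) \<longleftrightarrow> p \<in> (\<lambda>(s, g). (s + c, g + c)) ` hook_pairs S"
  proof
    assume "p \<in> hook_pairs (shift c S)"
    then have "(s - c, g - c) \<in> hook_pairs S" by (simp add: p hook_pairs_def mem_shift)
    then show "p \<in> (\<lambda>(s, g). (s + c, g + c)) ` hook_pairs S" by (rule image_eqI[rotated]) (simp add: p)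
  qed (auto simp: hook_pairs_def mem_shift)
qed

definition hooks :: "int set \<Rightarrow> nat multiset" where
  "hooks S = image_mset (\<lambda>(s, g). nat (s - g)) (mset_set (hook_pairs S))"

lemma hooks_shift: "hooks (shift c S) = hooks S"
proof -
  have inj: "inj_on (\<lambda>(s, g). (s + c, g + c)) (hook_pairs S)" by (auto simp: inj_on_def)
  show ?thesis
    unfolding hooks_def hook_pairs_shift image_mset_mset_set[OF inj, symmetric]
    by (simp add: image_mset.compositionality o_def split_def)
qed

text \<open>The addable corners other than \<open>x\<close> are as many as the removable ones, so in
  \<open>sum.hooks_add_box\<close> with the constant 1 only the term of the new box is left
  over.\<close>

lemma size_hooks:
  assumes "S \<in> maya0" shows "size (hooks S) = nat (energy S)"
proof -
  have "maya S" "charge S = 0" using assms by (simp_all add: maya0_def)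
  then have "int (card (hook_pairs S)) = energy S"
  proof (induction rule: maya0_induct)
    case empty
    have "hook_pairs {..<0} = {}" by (auto simp: hook_pairs_def)
    then show ?case by simp
  next
    case (add S x)
    have "int (card (hook_pairs (add_box x S))) + int (card (removable S))
        = int (card (hook_pairs S)) + int (card (addable S - {x})) + 1"
      using sum.hooks_add_box[OF add(1) \<open>x \<in> addable S\<close>, of "\<lambda>_. 1 :: int"] by simp
    then show ?case using add card_addable[OF add(1)] by (simp add: msum_add_box)
  qed
  then show ?thesis by (simp add: hooks_def)
qed

lemma prod_hooks: "(\<Prod>h\<in>#hooks S. of_nat h) = hook_prod S"
proof -
  have "(\<Prod>h\<in>#hooks S. of_nat h) = (\<Prod>p\<in>hook_pairs S. of_nat (case p of (s, g) \<Rightarrow> nat (s - g)) :: rat)"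
    by (simp add: hooks_def prod_unfold_prod_mset image_mset.compositionality o_def)
  also have "\<dots> = hook_prod S"
    unfolding hook_prod_def by (intro prod.cong refl) (auto simp: hook_pairs_def)
  finally show ?thesis .
qed

lemma sum_hooks: "(\<Sum>h\<in>#hooks S. of_nat h ^ (2 * k)) = hook_power_sum k S"
proof -
  have "(\<Sum>h\<in>#hooks S. of_nat h ^ (2 * k)) = (\<Sum>p\<in>hook_pairs S. of_nat (case p of (s, g) \<Rightarrow> nat (s - g)) ^ (2 * k) :: rat)"
    by (simp add: hooks_def sum_unfold_sum_mset image_mset.compositionality o_def)
  also have "\<dots> = hook_power_sum k S"
    unfolding hook_power_sum_def by (intro sum.cong refl) (auto simp: hook_pairs_def)
  finally show ?thesis .
qed

lemma msum_affine: "msum (\<lambda>z. d * z + e) S = d * energy S + e * charge S"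
  by (simp only: msum_add msum_cmult msum_const[of e])

context
  fixes d e :: int
  assumes de: "0 \<le> e" "e < d"
begin

lemma affine_nonneg: "z \<le> d * z + e" if "0 \<le> z" for z
proof -
  have "1 * z \<le> d * z" using de that by (intro mult_right_mono) auto
  then show ?thesis using de by linarith
qed

lemma affine_neg: "d * z + e \<le> z" if "z < 0" for z
proof -
  have "(d - 1) * z \<le> (d - 1) * (-1)" using de that by (intro mult_left_mono) auto
  then have "d * z - z \<le> 1 - d" by (simp add: left_diff_distrib)
  then show ?thesis using de by linarith
qed

lemma affine_msum_nonneg: "maya S \<Longrightarrow> 0 \<le> msum (\<lambda>z. d * z + e) S"
  by (rule msum_fiber(1)[OF affine_nonneg affine_neg])

lemma graded_affine: "graded {S. maya S} (\<lambda>S. nat (msum (\<lambda>z. d * z + e) S))"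
  unfolding graded_def
proof
  fix n
  have "{S\<in>{S. maya S}. nat (msum (\<lambda>z. d * z + e) S) = n} \<subseteq> {S. maya S \<and> msum (\<lambda>z. d * z + e) S = int n}"
    using affine_msum_nonneg by fastforce
  moreover have "finite {S. maya S \<and> msum (\<lambda>z. d * z + e) S = int n}"
    by (rule finite_msum_fiber[OF affine_nonneg affine_neg])
  ultimately show "finite {S\<in>{S. maya S}. nat (msum (\<lambda>z. d * z + e) S) = n}" by (rule finite_subset)
qed

lemma graded_charges: "graded UNIV (\<lambda>c. nat (msum (\<lambda>z. d * z + e) {..<c}))"
  unfolding graded_def
proof
  fix n
  let ?A = "{c\<in>UNIV. nat (msum (\<lambda>z. d * z + e) {..<c}) = n}"
  have "(\<lambda>c. {..<c}) ` ?A \<subseteq> {S\<in>{S. maya S}. nat (msum (\<lambda>z. d * z + e) S) = n}" by auto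
  moreover have "finite {S\<in>{S. maya S}. nat (msum (\<lambda>z. d * z + e) S) = n}"
    using graded_affine unfolding graded_def by blast
  ultimately have "finite ((\<lambda>c. {..<c}) ` ?A)" by (rule finite_subset)
  moreover have "inj_on (\<lambda>c::int. {..<c}) ?A" by (auto simp: inj_on_def)
  ultimately show "finite ?A" by (rule finite_imageD)
qed

text \<open>Every diagram is a diagram of charge 0 translated by its charge. The cross term of the
  affine weight is a multiple of the charge of the untranslated diagram, hence 0, so the weights
  add; the hooks do not notice the translation.\<close>

lemma gf_charge_split:
  fixes \<beta> :: int and F :: "nat multiset \<Rightarrow> laurent"
  shows "gf {S. maya S} (\<lambda>S. nat (msum (\<lambda>z. d * z + e) S)) (\<lambda>S. b_pow (\<beta> * charge S) * F (hooks S))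
       = gf UNIV (\<lambda>c. nat (msum (\<lambda>z. d * z + e) {..<c})) (\<lambda>c. b_pow (\<beta> * c))
         * gf maya0 (\<lambda>S. nat d * nat (energy S)) (\<lambda>S. F (hooks S))"
proof -
  let ?f = "\<lambda>z. d * z + e"
  have bij: "bij_betw (\<lambda>(c, S). shift c S) (UNIV \<times> maya0) {S. maya S}"
    by (rule bij_betw_byWitness[where f' = "\<lambda>S. (charge S, shift (- charge S) S)"])
      (auto simp: maya0_def charge_shift)
  have "gf {S. maya S} (\<lambda>S. nat (msum ?f S)) (\<lambda>S. b_pow (\<beta> * charge S) * F (hooks S))
      = gf (UNIV \<times> maya0) (\<lambda>(c, S). nat (msum ?f {..<c}) + nat d * nat (energy S)) (\<lambda>(c, S). b_pow (\<beta> * c) * F (hooks S))"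
  proof (rule gf_reindex[OF bij])
    fix p :: "int \<times> int set" assume p: "p \<in> UNIV \<times> maya0"
    obtain c S where cS: "p = (c, S)" by (cases p)
    have S: "maya S" "charge S = 0" using p by (simp_all add: cS maya0_def)
    have "msum (\<lambda>z. ?f (z + c)) S = msum (\<lambda>z. d * z + (d * c + e)) S"
      by (intro arg_cong[where f = "\<lambda>f. msum f S"] ext) (simp add: algebra_simps)
    also have "\<dots> = d * energy S" using S by (simp add: msum_affine)
    finally have "msum ?f (shift c S) = msum ?f {..<c} + d * energy S" using S by (simp add: msum_shift)
    moreover have "msum ?f {..<c} \<ge> 0" by (rule affine_msum_nonneg) simp
    ultimately show "nat (msum ?f (case p of (c, S) \<Rightarrow> shift c S)) = (case p of (c, S) \<Rightarrow> nat (msum ?f {..<c}) + nat d * nat (energy S))"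
      using energy_nonneg[of S] de by (simp add: cS nat_add_distrib nat_mult_distrib)
    show "b_pow (\<beta> * charge (case p of (c, S) \<Rightarrow> shift c S)) * F (hooks (case p of (c, S) \<Rightarrow> shift c S))
       = (case p of (c, S) \<Rightarrow> b_pow (\<beta> * c) * F (hooks S))"
      using S by (simp add: cS charge_shift hooks_shift)
  qed
  also have "\<dots> = gf UNIV (\<lambda>c. nat (msum ?f {..<c})) (\<lambda>c. b_pow (\<beta> * c)) * gf maya0 (\<lambda>S. nat d * nat (energy S)) (\<lambda>S. F (hooks S))"
    by (rule gf_times[OF graded_charges graded_maya0]) (use de in simp)
  finally show ?thesis .
qed

end

section \<open>Euler's product for partitions\<close>

lemma gf_add_weight: "gf A (\<lambda>a. w a + m) c = fps_X ^ m * gf A w c"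
proof (rule fps_ext)
  fix n
  show "fps_nth (gf A (\<lambda>a. w a + m) c) n = fps_nth (fps_X ^ m * gf A w c) n"
  proof (cases "n < m")
    case True
    then have "{a\<in>A. w a + m = n} = {}" by auto
    then show ?thesis using True unfolding gf_def fps_X_power_mult_nth fps_nth_Abs_fps by (simp only: sum.empty if_True)
  next
    case False
    then have "w a + m = n \<longleftrightarrow> w a = n - m" for a by auto
    then show ?thesis using False by (simp add: gf_def fps_X_power_mult_nth)
  qed
qed

lemma gf_Un:
  assumes "graded (A \<union> B) w" "A \<inter> B = {}"
  shows "gf (A \<union> B) w c = gf A w c + gf B w c"
proof (rule fps_ext)
  fix n
  have "{a\<in>A \<union> B. w a = n} = {a\<in>A. w a = n} \<union> {a\<in>B. w a = n}" by auto
  moreover have "finite {a\<in>A. w a = n}" "finite {a\<in>B. w a = n}"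
    using graded_subset[OF assms(1)] by (auto simp: graded_def)
  ultimately show "fps_nth (gf (A \<union> B) w c) n = fps_nth (gf A w c + gf B w c) n"
    using assms(2) by (simp add: gf_def sum.union_disjoint disjoint_iff)
qed

text \<open>These are the partitions with at most \<open>N\<close> parts: below \<open>- N\<close>
  there are only the beads of empty parts.\<close>

definition maya0_above :: "nat \<Rightarrow> int set set" where
  "maya0_above N = {S\<in>maya0. {..<- int N} \<subseteq> S}"

lemma maya0_above_0: "maya0_above 0 = {{..<0}}"
proof -
  have "S = {..<0}" if "maya S" "charge S = 0" "{..<0} \<subseteq> S" for S
  proof -
    have "{..<0} - S = {}" using that by auto
    then have "charge S = int (card (S \<inter> {0..}))" unfolding msum_def by (simp only:) simp
    then have "S \<inter> {0..} = {}" using that by (simp add: maya_def)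
    then show ?thesis using that by force
  qed
  then show ?thesis by (auto simp: maya0_above_def maya0_def)
qed

text \<open>This adds 1 to each of the first \<open>N + 1\<close> parts. Removing the bead
  \<open>- N - 2\<close> of an empty part makes the charge -1, and the translation by 1 restores
  charge 0. A gap at \<open>- N - 1\<close> in the image says that there are exactly
  \<open>N + 1\<close> parts.\<close>

lemma maya0_above_bij:
  "bij_betw (\<lambda>S. shift 1 (S - {- int N - 2})) (maya0_above (Suc N)) {S\<in>maya0_above (Suc N). - int N - 1 \<notin> S}"
proof (rule bij_betw_byWitness[where f' = "\<lambda>S. insert (- int N - 2) (shift (-1) S)"])
  show "\<forall>S\<in>maya0_above (Suc N). insert (- int N - 2) (shift (-1) (shift 1 (S - {- int N - 2}))) = S"
    by (auto simp: maya0_above_def)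
  show "\<forall>S\<in>{S\<in>maya0_above (Suc N). - int N - 1 \<notin> S}. shift 1 (insert (- int N - 2) (shift (-1) S) - {- int N - 2}) = S"
  proof (intro ballI set_eqI)
    fix S z assume "S \<in> {S\<in>maya0_above (Suc N). - int N - 1 \<notin> S}"
    then show "z \<in> shift 1 (insert (- int N - 2) (shift (-1) S) - {- int N - 2}) \<longleftrightarrow> z \<in> S"
      by (cases "z = - int N - 1") (auto simp: mem_shift)
  qed
  show "(\<lambda>S. shift 1 (S - {- int N - 2})) ` maya0_above (Suc N) \<subseteq> {S\<in>maya0_above (Suc N). - int N - 1 \<notin> S}"
  proof (rule image_subsetI)
    fix S assume "S \<in> maya0_above (Suc N)"
    then have S: "maya S" "charge S = 0" "\<And>z. z < - int N - 1 \<Longrightarrow> z \<in> S" by (auto simp: maya0_above_def maya0_def)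
    have "maya (S - {- int N - 2})" "charge (S - {- int N - 2}) = -1" using S by (simp_all add: msum_remove)
    then have "shift 1 (S - {- int N - 2}) \<in> maya0" by (simp add: maya0_def charge_shift)
    then show "shift 1 (S - {- int N - 2}) \<in> {S\<in>maya0_above (Suc N). - int N - 1 \<notin> S}"
      using S(3) by (auto simp: maya0_above_def mem_shift)
  qed
  show "(\<lambda>S. insert (- int N - 2) (shift (-1) S)) ` {S\<in>maya0_above (Suc N). - int N - 1 \<notin> S} \<subseteq> maya0_above (Suc N)"
  proof (rule image_subsetI)
    fix S assume "S \<in> {S\<in>maya0_above (Suc N). - int N - 1 \<notin> S}"
    then have S: "maya S" "charge S = 0" "\<And>z. z < - int N - 1 \<Longrightarrow> z \<in> S" "- int N - 1 \<notin> S"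
      by (auto simp: maya0_above_def maya0_def)
    have "- int N - 2 - (-1) = - int N - 1" by simp
    then have "- int N - 2 \<notin> shift (-1) S" unfolding mem_shift by (metis S(4))
    then have "charge (insert (- int N - 2) (shift (-1) S)) = 0" using S(1,2) by (simp add: msum_insert charge_shift)
    moreover have mem: "z \<in> insert (- int N - 2) (shift (-1) S)" if "z < - int N - 1" for z
    proof (cases "z = - int N - 2")
      case False
      then have "z + 1 < - int N - 1" using that by linarith
      then show ?thesis using S(3) by (simp add: mem_shift)
    qed simp
    moreover have "{..<- int (Suc N)} \<subseteq> insert (- int N - 2) (shift (-1) S)"
      by (rule subsetI, rule mem) simp
    ultimately show "insert (- int N - 2) (shift (-1) S) \<in> maya0_above (Suc N)"
      using S(1) by (simp add: maya0_above_def maya0_def)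
  qed
qed

lemma energy_shift_remove:
  assumes "S \<in> maya0_above (Suc N)"
  shows "energy (shift 1 (S - {- int N - 2})) = energy S + int N + 1"
proof -
  have S: "maya S" "charge S = 0" "- int N - 2 \<in> S" using assms by (auto simp: maya0_above_def maya0_def)
  have "energy {..<1} = 0" using msum_lessThan_Suc[of "\<lambda>z. z" 0] by simp
  then show ?thesis
    using S msum_shift[of "S - {- int N - 2}" "\<lambda>z. z" 1] by (simp add: msum_add msum_remove)
qed

text \<open>A partition with at most \<open>N + 1\<close> parts has at most \<open>N\<close> parts,
  or exactly \<open>N + 1\<close> parts from each of which 1 can be subtracted. This recursion
  supplies one factor of the product.\<close>

lemma gf_maya0_above:
  assumes "d > 0"
  shows "gf (maya0_above N) (\<lambda>S. d * nat (energy S)) (\<lambda>_. 1 :: laurent) * (\<Prod>j<N. 1 - fps_X ^ d * (fps_X ^ d) ^ j) = 1"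
proof (induction N)
  case 0
  have "{S\<in>{{..<0}}. d * nat (energy S) = n} = (if n = 0 then {{..<0}} else {})" for n by auto
  then show ?case by (simp add: maya0_above_0 gf_def fps_eq_iff)
next
  case (Suc N)
  let ?w = "\<lambda>S. d * nat (energy S)" and ?c = "\<lambda>_::int set. 1 :: laurent"
  let ?B = "{S\<in>maya0_above (Suc N). - int N - 1 \<notin> S}"
  have split: "maya0_above (Suc N) = maya0_above N \<union> ?B"
  proof (rule set_eqI)
    fix S
    have "z \<in> S" if "{..<- int (Suc N)} \<subseteq> S" "- int N - 1 \<in> S" "z < - int N" for z
      using that by (cases "z = - int N - 1") auto
    then show "S \<in> maya0_above (Suc N) \<longleftrightarrow> S \<in> maya0_above N \<union> ?B"
      by (fastforce simp: maya0_above_def)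
  qed
  have "graded (maya0_above (Suc N)) ?w"
    by (rule graded_subset[OF graded_maya0[OF assms]]) (auto simp: maya0_above_def)
  then have "graded (maya0_above N \<union> ?B) ?w" by (simp only: split[symmetric])
  moreover have "maya0_above N \<inter> ?B = {}"
  proof -
    have "- int N - 1 \<in> {..<- int N}" by simp
    then show ?thesis unfolding maya0_above_def by blast
  qed
  ultimately have "gf (maya0_above N \<union> ?B) ?w ?c = gf (maya0_above N) ?w ?c + gf ?B ?w ?c"
    by (rule gf_Un)
  then have "gf (maya0_above (Suc N)) ?w ?c = gf (maya0_above N) ?w ?c + gf ?B ?w ?c"
    by (simp only: split[symmetric])
  also have "gf ?B ?w ?c = gf (maya0_above (Suc N)) (\<lambda>S. ?w S + d * Suc N) ?c"
  proof (rule gf_reindex[OF maya0_above_bij])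
    fix S assume "S \<in> maya0_above (Suc N)"
    from energy_shift_remove[OF this] energy_nonneg[of S]
    have "nat (energy (shift 1 (S - {- int N - 2}))) = nat (energy S) + Suc N" by simp
    then show "d * nat (energy (shift 1 (S - {- int N - 2}))) = d * nat (energy S) + d * Suc N" by (simp only: distrib_left)
  qed simp
  also have "\<dots> = fps_X ^ (d * Suc N) * gf (maya0_above (Suc N)) ?w ?c" by (rule gf_add_weight)
  finally have "gf (maya0_above N) ?w ?c = gf (maya0_above (Suc N)) ?w ?c * (1 - fps_X ^ d * (fps_X ^ d) ^ N)"
    by (simp add: algebra_simps flip: power_mult power_add)
  then show ?case using Suc by (simp add: mult_ac)
qed

text \<open>The size bounds the number of parts, so up to degree \<open>n\<close> both factors agree
  with their truncations.\<close>

lemma gf_partitions: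
  assumes "d > 0"
  shows "gf maya0 (\<lambda>S. d * nat (energy S)) (\<lambda>_. 1 :: laurent) * qpoch_inf (fps_X ^ d) (fps_X ^ d) = 1"
proof (rule fps_ext)
  fix n
  let ?w = "\<lambda>S. d * nat (energy S)" and ?c = "\<lambda>_::int set. 1 :: laurent"
  have "fps_nth (gf maya0 ?w ?c * qpoch_inf (fps_X ^ d) (fps_X ^ d)) n
      = fps_nth (gf (maya0_above (Suc n)) ?w ?c * (\<Prod>j<Suc n. 1 - fps_X ^ d * (fps_X ^ d) ^ j)) n"
  proof (rule fps_mult_nth_cong)
    fix i assume i: "i \<le> n"
    have "S \<in> maya0_above (Suc n)" if "S \<in> maya0" "d * nat (energy S) = i" for S
    proof -
      have "nat (energy S) \<le> n" using that(2) i assms by (metis One_nat_def Suc_leI dual_order.trans mult_le_mono1 nat_mult_1)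
      moreover have "{..<0} - S \<subseteq> {- energy S..}" using that by (intro msum_fiber(3)) (auto simp: maya0_def)
      ultimately have "z \<in> S" if "z < - int (Suc n)" for z using that by force
      then show ?thesis using that by (auto simp: maya0_above_def)
    qed
    then have "{S\<in>maya0. ?w S = i} = {S\<in>maya0_above (Suc n). ?w S = i}" by (auto simp: maya0_above_def)
    then show "fps_nth (gf maya0 ?w ?c) i = fps_nth (gf (maya0_above (Suc n)) ?w ?c) i" by (simp add: gf_def)
    show "fps_nth (qpoch_inf (fps_X ^ d) (fps_X ^ d)) i = fps_nth (\<Prod>j<Suc n. 1 - fps_X ^ d * (fps_X ^ d) ^ j) i"
      using i assms by (intro qpoch_inf_nth) auto
  qed
  then show "fps_nth (gf maya0 ?w ?c * qpoch_inf (fps_X ^ d) (fps_X ^ d)) n = fps_nth 1 n"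
    by (simp only: gf_maya0_above[OF assms])
qed

section \<open>Partitions as Maya diagrams\<close>

lemma part_antimono:
  assumes "is_partition p" "1 \<le> i" "i \<le> j" shows "part p j \<le> part p i"
proof (cases "i < j \<and> j \<le> length p")
  case True
  then have "i - 1 < j - 1" "j - 1 < length p" using assms by auto
  moreover have "sorted_wrt (\<ge>) p" using assms by (simp add: is_partition_def)
  ultimately have "p ! (j - 1) \<le> p ! (i - 1)" using sorted_wrt_nth_less by blast
  then show ?thesis using True assms(2) by (simp add: part_def)
next
  case False
  then show ?thesis using assms by (cases "i = j") (auto simp: part_def)
qed

lemma part_pos_iff:
  assumes "is_partition p" shows "0 < part p i \<longleftrightarrow> 1 \<le> i \<and> i \<le> length p"
proof -
  have "p ! (i - 1) \<noteq> 0" if "1 \<le> i" "i \<le> length p"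
  proof -
    have "p ! (i - 1) \<in> set p" using that by (intro nth_mem) simp
    then show ?thesis using assms by (metis is_partition_def)
  qed
  then show ?thesis by (auto simp: part_def)
qed

lemma part_eqI:
  assumes "is_partition p" "is_partition q" "\<And>i. 1 \<le> i \<Longrightarrow> part p i = part q i"
  shows "p = q"
proof -
  have "1 \<le> i \<and> i \<le> length p \<longleftrightarrow> 1 \<le> i \<and> i \<le> length q" for i
    using assms part_pos_iff[of p i] part_pos_iff[of q i] by (cases "1 \<le> i") auto
  from this[of "length p"] this[of "length q"] have len: "length p = length q" by (cases p; cases q) auto
  show ?thesis
  proof (rule nth_equalityI[OF len])
    fix i assume "i < length p"
    then show "p ! i = q ! i" using assms(3)[of "Suc i"] len by (simp add: part_def)
  qed
qed

text \<open>The rows of length at least \<open>j\<close> form an initial segment of the rows, so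
  their number decides which rows these are.\<close>

lemma le_part_iff:
  assumes "is_partition p" "1 \<le> i" "1 \<le> j"
  shows "j \<le> part p i \<longleftrightarrow> i \<le> col_length p j"
proof -
  define A where "A = {i\<in>{1..length p}. part p i \<ge> j}"
  have fin: "finite A" by (simp add: A_def)
  have mem: "i \<in> A \<longleftrightarrow> 1 \<le> i \<and> j \<le> part p i" for i
    using part_pos_iff[OF assms(1), of i] assms(3) by (auto simp: A_def)
  show ?thesis
  proof (cases "j \<le> part p i")
    case True
    have "{1..i} \<subseteq> A"
    proof
      fix k assume "k \<in> {1..i}"
      then show "k \<in> A" using part_antimono[OF assms(1), of k i] True by (simp add: mem)
    qed
    then have "card {1..i} \<le> card A" using fin by (intro card_mono)
    then show ?thesis using True by (simp add: col_length_def A_def)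
  next
    case False
    have "A \<subseteq> {1..<i}"
    proof
      fix k assume k: "k \<in> A"
      have "\<not> i \<le> k" using part_antimono[OF assms(1,2), of k] False k by (auto simp: mem)
      then show "k \<in> {1..<i}" using k by (simp add: mem)
    qed
    then have "card A \<le> card {1..<i}" by (intro card_mono) auto
    then show ?thesis using False assms(2) by (simp add: col_length_def A_def)
  qed
qed

lemma part_conjugate:
  assumes "is_partition p" "1 \<le> j" shows "part (conjugate p) j = col_length p j"
proof (cases "j \<le> part p 1")
  case True
  then have "conjugate p ! (j - 1) = col_length p j" using assms(2) by (simp add: conjugate_def del: upt_Suc)
  moreover have "length (conjugate p) = part p 1" by (simp add: conjugate_def del: upt_Suc)
  ultimately show ?thesis using True assms(2) unfolding part_def[of "conjugate p" j] by simp
next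
  case False
  then have "\<not> 1 \<le> col_length p j" using le_part_iff[OF assms(1) _ assms(2), of 1] by simp
  moreover have "length (conjugate p) = part p 1" by (simp add: conjugate_def del: upt_Suc)
  ultimately show ?thesis using False unfolding part_def[of "conjugate p" j] by simp
qed

lemma col_length_antimono:
  assumes "is_partition p" "1 \<le> i" "i \<le> j" shows "col_length p j \<le> col_length p i"
proof (cases "col_length p j = 0")
  case False
  then have "j \<le> part p (col_length p j)" using assms le_part_iff[of p "col_length p j" j] by simp
  then show ?thesis using False assms le_part_iff[of p "col_length p j" i] by simp
qed simp

lemma is_partition_conjugate:
  assumes "is_partition p" shows "is_partition (conjugate p)"
proof -
  have "sorted_wrt (\<ge>) (conjugate p)"
    unfolding sorted_wrt_iff_nth_less
  proof (intro allI impI)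
    fix i j assume ij: "i < j" "j < length (conjugate p)"
    then have "conjugate p ! i = col_length p (Suc i)" "conjugate p ! j = col_length p (Suc j)"
      by (simp_all add: conjugate_def del: upt_Suc)
    then show "conjugate p ! i \<ge> conjugate p ! j"
      using col_length_antimono[OF assms, of "Suc i" "Suc j"] ij(1) by simp
  qed
  moreover have "col_length p j \<noteq> 0" if "1 \<le> j" "j \<le> part p 1" for j
    using le_part_iff[OF assms, of 1 j] that by simp
  then have "0 \<notin> set (conjugate p)" by (force simp: conjugate_def)
  ultimately show ?thesis by (simp add: is_partition_def)
qed

section \<open>Row beads and column gaps\<close>

definition beads :: "nat list \<Rightarrow> int set" where
  "beads p = (\<lambda>i. int (part p i) - int i) ` {1..}"

lemma bead_less:
  assumes "is_partition p" "1 \<le> i" "i < j"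
  shows "int (part p j) - int j < int (part p i) - int i"
  using part_antimono[OF assms(1,2), of j] assms(3) by simp

lemma inj_on_bead: "is_partition p \<Longrightarrow> inj_on (\<lambda>i. int (part p i) - int i) {1..}"
proof (rule inj_onI)
  fix i j assume p: "is_partition p" and ij: "i \<in> {1..}" "j \<in> {1..}" "int (part p i) - int i = int (part p j) - int j"
  show "i = j"
    using bead_less[OF p, of i j] bead_less[OF p, of j i] ij by (cases i j rule: linorder_cases) auto
qed

lemma bead_greater_gap_iff:
  assumes "is_partition p" "1 \<le> i" "1 \<le> j"
  shows "int j - 1 - int (col_length p j) < int (part p i) - int i \<longleftrightarrow> j \<le> part p i"
  using le_part_iff[OF assms] by linarith

text \<open>Rows give the beads and columns the gaps: they are the vertical and the horizontal steps
  of the boundary path.\<close>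

lemma not_in_beads_iff:
  assumes "is_partition p"
  shows "z \<notin> beads p \<longleftrightarrow> z \<in> (\<lambda>j. int j - 1 - int (col_length p j)) ` {1..}"
proof
  assume z: "z \<notin> beads p"
  \<comment> \<open>The first row \<open>i\<close> whose bead lies below the gap \<open>z\<close>
    determines its column, \<open>j = z + i\<close>.\<close>
  define P where "P i \<longleftrightarrow> 1 \<le> i \<and> int (part p i) - int i < z" for i
  define n where "n = Suc (length p + nat (- z))"
  have "part p n = 0" by (simp add: n_def part_def)
  then have "P n" by (auto simp: P_def n_def)
  then have "\<exists>i. P i" ..
  define i where "i = (LEAST i. P i)"
  have i: "P i" "\<And>k. P k \<Longrightarrow> i \<le> k"
    using LeastI_ex[OF \<open>\<exists>i. P i\<close>] Least_le[of P] by (auto simp: i_def)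
  define j where "j = nat (z + int i)"
  have j: "int j = z + int i" "1 \<le> j" using i(1) by (auto simp: j_def P_def)
  have pi: "part p i < j" using i(1) j(1) by (simp add: P_def)
  have "col_length p j = i - 1"
  proof -
    have "\<not> i \<le> col_length p j" using le_part_iff[OF assms, of i j] i(1) j(2) pi by (simp add: P_def)
    moreover have "i - 1 \<le> col_length p j"
    proof (cases "i = 1")
      case False
      then have i': "1 \<le> i - 1" using i(1) unfolding P_def by linarith
      have "\<not> P (i - 1)" using i(2)[of "i - 1"] i' by linarith
      moreover have "int (part p (i - 1)) - int (i - 1) \<in> beads p"
        unfolding beads_def using i' by (intro imageI) simp
      then have "int (part p (i - 1)) - int (i - 1) \<noteq> z" using z by blast
      ultimately have "z < int (part p (i - 1)) - int (i - 1)" using i' unfolding P_def by linarith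
      then have "j \<le> part p (i - 1)" using j(1) i' by linarith
      then show ?thesis using le_part_iff[OF assms i' j(2)] by simp
    qed simp
    ultimately show ?thesis by simp
  qed
  then have "z = int j - 1 - int (col_length p j)" using j(1) i(1) by (simp add: P_def)
  then show "z \<in> (\<lambda>j. int j - 1 - int (col_length p j)) ` {1..}" using j(2) by auto
next
  assume "z \<in> (\<lambda>j. int j - 1 - int (col_length p j)) ` {1..}"
  then obtain j where j: "1 \<le> j" "z = int j - 1 - int (col_length p j)" by auto
  show "z \<notin> beads p"
  proof
    assume "z \<in> beads p"
    then obtain i where i: "1 \<le> i" "z = int (part p i) - int i" by (auto simp: beads_def)
    show False using le_part_iff[OF assms i(1) j(1)] i(2) j(2) by linarith
  qed
qed

text \<open>Conjugation exchanges rows and columns, hence beads and gaps, while reversing the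
  boundary path.\<close>

lemma beads_conjugate:
  assumes "is_partition p" shows "z \<in> beads (conjugate p) \<longleftrightarrow> - 1 - z \<notin> beads p"
proof -
  have "z \<in> beads (conjugate p) \<longleftrightarrow> z \<in> (\<lambda>j. int (col_length p j) - int j) ` {1..}"
    unfolding beads_def using part_conjugate[OF assms] by (intro arg_cong2[where f = "(\<in>)"] image_cong refl) auto
  also have "\<dots> \<longleftrightarrow> - 1 - z \<in> (\<lambda>j. int j - 1 - int (col_length p j)) ` {1..}"
    unfolding image_iff by (intro bex_cong refl) linarith
  finally show ?thesis using not_in_beads_iff[OF assms] by simp
qed

text \<open>At the first differing part the larger bead would have to be the bead of an earlier row
  of the other partition, where the parts still agree.\<close>

lemma beads_eq_iff:
  assumes "is_partition p" "is_partition q" "beads p = beads q" shows "p = q"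
proof (rule part_eqI[OF assms(1,2)])
  fix i :: nat
  have not_less: "\<not> part p i < part q i"
    if "is_partition p" "is_partition q" "beads p = beads q" "1 \<le> i" "\<And>k. k < i \<Longrightarrow> 1 \<le> k \<Longrightarrow> part p k = part q k" for p q i
  proof
    assume lt: "part p i < part q i"
    have "int (part q i) - int i \<in> beads p" using that(3,4) by (auto simp: beads_def)
    then obtain k where k: "1 \<le> k" "int (part q i) - int i = int (part p k) - int k" by (auto simp: beads_def)
    have "\<not> i < k" using bead_less[OF that(1,4), of k] k(2) lt by linarith
    moreover have "k \<noteq> i" using k(2) lt by auto
    ultimately have "k < i" by simp
    then have "part p k = part q k" using that(5) k(1) by simp
    then show False using bead_less[OF that(2) k(1) \<open>k < i\<close>] k(2) by simp
  qed
  show "1 \<le> i \<Longrightarrow> part p i = part q i"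
  proof (induction i rule: less_induct)
    case (less i)
    then show ?case
      using not_less[of p q i] not_less[of q p i] assms by (metis linorder_neqE_nat)
  qed
qed

lemma msum_union_lessThan:
  assumes "finite F" "F \<subseteq> {- int n..}"
  shows "maya (F \<union> {..<- int n})" "msum f (F \<union> {..<- int n}) = (\<Sum>z\<in>F. f z) - (\<Sum>i=1..n. f (- int i))"
proof -
  have base: "msum f {..<- int n} = - (\<Sum>i=1..n. f (- int i))"
  proof (induction n)
    case (Suc n)
    then show ?case using msum_lessThan_Suc[of f "- int (Suc n)"] by simp
  qed simp
  have "maya (F \<union> {..<- int n}) \<and> msum f (F \<union> {..<- int n}) = (\<Sum>z\<in>F. f z) + msum f {..<- int n}"
    using assms
  proof (induction F rule: finite_induct)
    case (insert a F)
    then have "maya (F \<union> {..<- int n})" "a \<notin> F \<union> {..<- int n}" by auto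
    from msum_insert[OF this, of f] insert show ?case by simp
  qed simp
  then show "maya (F \<union> {..<- int n})" "msum f (F \<union> {..<- int n}) = (\<Sum>z\<in>F. f z) - (\<Sum>i=1..n. f (- int i))"
    using base by simp_all
qed

lemma beads_decompose:
  "beads p = (\<lambda>i. int (part p i) - int i) ` {1..length p} \<union> {..<- int (length p)}"
proof -
  have "{1..} = {1..length p} \<union> {Suc (length p)..}" by auto
  moreover have "(\<lambda>i. int (part p i) - int i) ` {Suc (length p)..} = {..<- int (length p)}"
  proof -
    have "(\<lambda>i. int (part p i) - int i) ` {Suc (length p)..} = (\<lambda>i. - int i) ` {Suc (length p)..}"
      by (intro image_cong) (auto simp: part_def)
    also have "\<dots> = {..<- int (length p)}"
    proof (rule set_eqI)
      fix z show "z \<in> (\<lambda>i. - int i) ` {Suc (length p)..} \<longleftrightarrow> z \<in> {..<- int (length p)}"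
        unfolding image_iff by (auto intro!: bexI[of _ "nat (- z)"])
    qed
    finally show ?thesis .
  qed
  ultimately show ?thesis unfolding beads_def by (simp only: image_Un)
qed

lemma
  assumes "is_partition p"
  shows maya_beads: "maya (beads p)"
    and msum_beads: "msum f (beads p) = (\<Sum>i=1..length p. f (int (part p i) - int i) - f (- int i))"
proof -
  let ?F = "(\<lambda>i. int (part p i) - int i) ` {1..length p}"
  have F: "finite ?F" "?F \<subseteq> {- int (length p)..}" by auto
  have "(\<Sum>z\<in>?F. f z) = (\<Sum>i=1..length p. f (int (part p i) - int i))"
    using inj_on_subset[OF inj_on_bead[OF assms], of "{1..length p}"] by (subst sum.reindex) (auto simp: o_def)
  then show "maya (beads p)" "msum f (beads p) = (\<Sum>i=1..length p. f (int (part p i) - int i) - f (- int i))"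
    using msum_union_lessThan[OF F] unfolding beads_decompose by (simp_all add: sum_subtractf)
qed

lemma energy_beads: "is_partition p \<Longrightarrow> energy (beads p) = int (sum_list p)"
proof -
  assume p: "is_partition p"
  have "(\<Sum>i=1..length p. part p i) = (\<Sum>i=0..<length p. p ! i)"
    by (rule sum.reindex_bij_witness[where i = Suc and j = "\<lambda>i. i - 1"]) (auto simp: part_def)
  then show ?thesis by (simp add: msum_beads[OF p] sum_list_sum_nth flip: of_nat_sum)
qed

abbreviation even_ind :: "int \<Rightarrow> int" where
  "even_ind z \<equiv> (if even z then 1 else 0)"

text \<open>Signs alternate along a row, so the sum over row \<open>i\<close> depends only on the
  parities of \<open>part p i - i\<close> and \<open>- i\<close>.\<close>

lemma BG_rank_beads:
  assumes "is_partition p" shows "BG_rank p = msum even_ind (beads p)"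
proof -
  have row: "(\<Sum>j=1..m. (-1) ^ (i + j)) = even_ind (int m - int i) - even_ind (- int i)" for i m :: nat
  proof (induction m)
    case (Suc m)
    then show ?case by (cases "even i"; cases "even m") (auto simp: uminus_power_if)
  qed simp
  have "BG_rank p = (\<Sum>i=1..length p. \<Sum>j=1..part p i. (-1) ^ (i + j))"
    unfolding BG_rank_def diagram_def by (subst sum.Sigma) auto
  then show ?thesis unfolding row msum_beads[OF assms] .
qed

text \<open>Box \<open>(i, j)\<close> corresponds to the bead of row \<open>i\<close> and the gap of
  column \<open>j\<close>, whose difference is the hook length; it lies in the diagram exactly when
  the gap is below the bead.\<close>

lemma hooks_beads:
  assumes "is_partition p"
  shows "image_mset (hook_length p) (mset_set (diagram p)) = hooks (beads p)"
proof -
  define \<phi> where "\<phi> = (\<lambda>(i, j). (int (part p i) - int i, int j - 1 - int (col_length p j)))"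
  have diag: "(i, j) \<in> diagram p \<longleftrightarrow> 1 \<le> i \<and> 1 \<le> j \<and> j \<le> part p i" for i j
    using part_pos_iff[OF assms, of i] by (auto simp: diagram_def)
  have inj_gap: "j = k" if jk: "1 \<le> j" "1 \<le> k" "int j - 1 - int (col_length p j) = int k - 1 - int (col_length p k)" for j k
    using col_length_antimono[OF assms, of j k] col_length_antimono[OF assms, of k j] jk by (cases j k rule: linorder_cases) auto
  have inj: "inj_on \<phi> (diagram p)"
  proof (rule inj_onI)
    fix x y assume xy: "x \<in> diagram p" "y \<in> diagram p" "\<phi> x = \<phi> y"
    obtain i j i' j' where "x = (i, j)" "y = (i', j')" by (cases x; cases y)
    then show "x = y"
      using xy inj_onD[OF inj_on_bead[OF assms], of i i'] inj_gap[of j j'] by (simp add: diag \<phi>_def)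
  qed
  have im: "\<phi> ` diagram p = hook_pairs (beads p)"
  proof (intro equalityI subsetI)
    fix x assume "x \<in> \<phi> ` diagram p"
    then obtain i j where ij: "(i, j) \<in> diagram p" "x = \<phi> (i, j)" by auto
    have "int j - 1 - int (col_length p j) \<notin> beads p" using ij(1) by (auto simp: not_in_beads_iff[OF assms] diag)
    moreover have "int (part p i) - int i \<in> beads p" using ij(1) by (auto simp: beads_def diag)
    ultimately show "x \<in> hook_pairs (beads p)"
      using bead_greater_gap_iff[OF assms, of i j] ij by (simp add: hook_pairs_def \<phi>_def diag)
  next
    fix x assume "x \<in> hook_pairs (beads p)"
    then obtain s g where x: "x = (s, g)" "s \<in> beads p" "g \<notin> beads p" "g < s" by (auto simp: hook_pairs_def)
    obtain i where i: "1 \<le> i" "s = int (part p i) - int i" using x(2) by (auto simp: beads_def)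
    obtain j where j: "1 \<le> j" "g = int j - 1 - int (col_length p j)" using x(3) by (auto simp: not_in_beads_iff[OF assms])
    have "(i, j) \<in> diagram p" using bead_greater_gap_iff[OF assms i(1) j(1)] x(4) i j by (simp add: diag)
    moreover have "x = \<phi> (i, j)" by (simp add: x(1) i(2) j(2) \<phi>_def)
    ultimately show "x \<in> \<phi> ` diagram p" by blast
  qed
  have "hook_length p x = (\<lambda>(s, g). nat (s - g)) (\<phi> x)" if x: "x \<in> diagram p" for x
  proof -
    obtain i j where ij: "x = (i, j)" by (cases x)
    have "1 \<le> i" "1 \<le> j" "j \<le> part p i" using x ij by (simp_all add: diag)
    moreover from this have "i \<le> col_length p j" using le_part_iff[OF assms] by blast
    ultimately show ?thesis by (simp add: ij hook_length_def \<phi>_def)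
  qed
  then have "image_mset (hook_length p) (mset_set (diagram p)) = image_mset ((\<lambda>(s, g). nat (s - g)) \<circ> \<phi>) (mset_set (diagram p))"
    by (intro image_mset_cong) (auto simp: diagram_def)
  also have "\<dots> = hooks (beads p)"
    unfolding hooks_def im[symmetric] image_mset_mset_set[OF inj, symmetric] by (simp add: image_mset.compositionality)
  finally show ?thesis .
qed

lemma partition_of_parts:
  fixes f :: "nat \<Rightarrow> nat"
  assumes anti: "\<And>i j. 1 \<le> i \<Longrightarrow> i \<le> j \<Longrightarrow> f j \<le> f i" and fin: "\<And>i. N < i \<Longrightarrow> f i = 0"
  obtains p where "is_partition p" "\<And>i. 1 \<le> i \<Longrightarrow> part p i = f i"
proof -
  define n where "n = (LEAST n. \<forall>i>n. f i = 0)"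
  have "\<forall>i>n. f i = 0" unfolding n_def by (rule LeastI[of _ N]) (use fin in blast)
  then have n: "\<And>i. n < i \<Longrightarrow> f i = 0" by blast
  have pos: "f i \<noteq> 0" if "1 \<le> i" "i \<le> n" for i
  proof
    assume 0: "f i = 0"
    have "\<forall>k>n - 1. f k = 0"
    proof (intro allI impI)
      fix k assume "n - 1 < k"
      then have "i \<le> k" using that by simp
      then show "f k = 0" using anti[OF that(1)] 0 by fastforce
    qed
    then have "n \<le> n - 1" unfolding n_def by (rule Least_le)
    then show False using that by simp
  qed
  define p where "p = map f [1..<Suc n]"
  have part: "part p i = f i" if "1 \<le> i" for i
    using that n[of i] by (auto simp: part_def p_def simp del: upt_Suc)
  have "sorted_wrt (\<ge>) p"
    unfolding sorted_wrt_iff_nth_less using anti by (auto simp: p_def simp del: upt_Suc)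
  moreover have "0 \<notin> set p"
  proof
    assume "0 \<in> set p"
    then obtain x where "1 \<le> x" "x \<le> n" "f x = 0" by (auto simp: p_def simp del: upt_Suc)
    then show False using pos by blast
  qed
  ultimately have "is_partition p" by (simp add: is_partition_def)
  then show ?thesis using that part by blast
qed

text \<open>The partition is built box by box. Since \<open>x\<close> is not a bead, the row above
  row \<open>i\<close> is strictly longer, and row \<open>i\<close> can be lengthened.\<close>

lemma beads_surj:
  assumes "maya S" "charge S = 0" obtains p where "is_partition p" "beads p = S"
proof -
  have "\<exists>p. is_partition p \<and> beads p = S"
    using assms
  proof (induction rule: maya0_induct)
    case empty
    show ?case by (intro exI[of _ "[]"]) (simp add: is_partition_def beads_decompose)
  next
    case (add S x)
    then obtain p where p: "is_partition p" "beads p = S" by auto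
    have x: "x - 1 \<in> beads p" "x \<notin> beads p" using add p by (auto simp: addable_def)
    obtain i where i: "1 \<le> i" "x - 1 = int (part p i) - int i" using x(1) by (auto simp: beads_def)
    define f where "f = (part p)(i := Suc (part p i))"
    have above: "part p i < part p k" if "1 \<le> k" "k < i" for k
    proof -
      have "1 \<le> i - 1" using that by simp
      then have "int (part p (i - 1)) - int (i - 1) \<in> beads p" unfolding beads_def by (intro imageI) simp
      moreover have "x = int (part p i) - int (i - 1)" using i by (simp add: of_nat_diff)
      ultimately have "part p (i - 1) \<noteq> part p i" using x(2) by metis
      moreover have "part p i \<le> part p (i - 1)" "part p (i - 1) \<le> part p k"
        using that by (auto intro!: part_antimono[OF p(1)])
      ultimately show ?thesis by simp
    qed
    have "f b \<le> f a" if "1 \<le> a" "a \<le> b" for a b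
      using part_antimono[OF p(1) that] above[of a] that by (auto simp: f_def)
    moreover have "f b = 0" if "i + length p < b" for b
      using that by (auto simp: f_def part_def)
    ultimately obtain r where r: "is_partition r" "\<And>k. 1 \<le> k \<Longrightarrow> part r k = f k"
      using partition_of_parts[of f "i + length p"] by metis
    have ii: "{1..} = insert i ({1..} - {i})" using i(1) by auto
    have "beads r = insert (int (part r i) - int i) ((\<lambda>k. int (part r k) - int k) ` ({1..} - {i}))"
      unfolding beads_def by (subst ii) (rule image_insert)
    also have "(\<lambda>k. int (part r k) - int k) ` ({1..} - {i}) = (\<lambda>k. int (part p k) - int k) ` ({1..} - {i})"
      by (intro image_cong) (auto simp: r(2) f_def)
    also have "\<dots> = beads p - {x - 1}"
      unfolding beads_def i(2) using inj_on_image_set_diff[OF inj_on_bead[OF p(1)], of "{1..}" "{i}"] i(1) by simp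
    also have "int (part r i) - int i = x" using i by (simp add: r(2) f_def)
    finally have "beads r = add_box x S" by (simp add: add_box_def p(2))
    then show ?case using r(1) by blast
  qed
  then show ?thesis using that by blast
qed

section \<open>Diagrams of self-conjugate partitions\<close>

text \<open>Invariance under the exchange of beads and gaps that conjugation performs; charge 0 is a
  consequence.\<close>

definition symmetric_maya :: "int set set" where
  "symmetric_maya = {S. maya S \<and> (\<forall>z. z \<in> S \<longleftrightarrow> - 1 - z \<notin> S)}"

lemma msum_symmetric:
  assumes "S \<in> symmetric_maya"
  shows "msum f S = (\<Sum>s\<in>S \<inter> {0..}. f s - f (- 1 - s))"
proof -
  have S: "z \<notin> S \<Longrightarrow> - 1 - z \<in> S" "z \<in> S \<Longrightarrow> - 1 - z \<notin> S" for z
    using assms unfolding symmetric_maya_def by blast+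
  have "(\<Sum>s\<in>{..<0} - S. f s) = (\<Sum>s\<in>S \<inter> {0..}. f (- 1 - s))"
    by (rule sum.reindex_bij_witness[where i = "\<lambda>s. - 1 - s" and j = "\<lambda>s. - 1 - s"]) (use S in auto)
  then show ?thesis by (simp add: msum_def sum_subtractf)
qed

lemma bij_betw_beads: "bij_betw beads self_conjugate symmetric_maya"
  unfolding bij_betw_def
proof
  show "inj_on beads self_conjugate"
    by (rule inj_onI) (auto simp: self_conjugate_def intro: beads_eq_iff)
  show "beads ` self_conjugate = symmetric_maya"
  proof (intro equalityI subsetI)
    fix S assume "S \<in> beads ` self_conjugate"
    then obtain p where p: "is_partition p" "conjugate p = p" "S = beads p" by (auto simp: self_conjugate_def)
    have "z \<in> S \<longleftrightarrow> - 1 - z \<notin> S" for z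
      using beads_conjugate[OF p(1), of z] unfolding p(2,3) .
    moreover have "maya S" using maya_beads[OF p(1)] p(3) by simp
    ultimately show "S \<in> symmetric_maya" unfolding symmetric_maya_def by blast
  next
    fix S assume S: "S \<in> symmetric_maya"
    have "maya S" using S unfolding symmetric_maya_def by blast
    moreover have "charge S = 0" using msum_symmetric[OF S, of "\<lambda>_. 1"] by simp
    ultimately obtain p where p: "is_partition p" "beads p = S" by (rule beads_surj)
    have "beads (conjugate p) = beads p"
    proof (rule set_eqI)
      fix z show "z \<in> beads (conjugate p) \<longleftrightarrow> z \<in> beads p"
        using beads_conjugate[OF p(1), of z] S p(2) unfolding symmetric_maya_def by blast
    qed
    then have "conjugate p = p" using beads_eq_iff p(1) is_partition_conjugate by blast
    then show "S \<in> beads ` self_conjugate" using p by (auto simp: self_conjugate_def)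
  qed
qed

section \<open>Residue classes of self-conjugate diagrams\<close>

text \<open>A runner of the \<open>t\<close>-abacus: one component of the \<open>t\<close>-quotient
  together with its charge.\<close>

definition residue_class :: "int \<Rightarrow> int \<Rightarrow> int set \<Rightarrow> int set" where
  "residue_class t r S = {z. t * z + r \<in> S}"

lemma mayaI:
  assumes "\<And>z. z \<notin> S \<Longrightarrow> - n < z" "\<And>z. z \<in> S \<Longrightarrow> z < n" shows "maya S"
proof -
  have "- n \<le> z" if "z \<notin> S" for z using assms(1)[OF that] by simp
  moreover have "z \<le> n" if "z \<in> S" for z using assms(2)[OF that] by simp
  ultimately have "S \<inter> {0..} \<subseteq> {0..n}" "{..<0} - S \<subseteq> {-n..0}" by auto
  then show ?thesis unfolding maya_def by (meson finite_atLeastAtMost_int finite_subset)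
qed

lemma affine_bounds:
  fixes t :: int
  assumes "0 \<le> r" "r < t" "0 \<le> n"
  shows "n \<le> z \<Longrightarrow> n \<le> t * z + r" "z < - n \<Longrightarrow> t * z + r < - n"
proof -
  assume z: "n \<le> z"
  have "1 * z \<le> t * z" using z assms by (intro mult_right_mono) auto
  then show "n \<le> t * z + r" using z assms by linarith
next
  assume z: "z < - n"
  have "t * z \<le> t * (- n - 1)" using z assms by (intro mult_left_mono) auto
  moreover have "1 * n \<le> t * n" using assms by (intro mult_right_mono) auto
  ultimately show "t * z + r < - n" using assms by (simp add: right_diff_distrib)
qed

lemma maya_residue_class:
  assumes "maya S" "0 \<le> r" "r < t" shows "maya (residue_class t r S)"
proof -
  obtain n where n: "n \<ge> 0" "\<And>z. z \<notin> S \<Longrightarrow> -n < z" "\<And>z. z \<in> S \<Longrightarrow> z < n"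
    using maya_bounds[OF assms(1)] by metis
  note b = affine_bounds[OF assms(2,3) n(1)]
  show ?thesis
  proof (rule mayaI)
    fix z assume "z \<notin> residue_class t r S"
    then have "- n < t * z + r" using n(2) by (simp add: residue_class_def)
    then show "- (n + 1) < z" using b(2)[of z] by linarith
  next
    fix z assume "z \<in> residue_class t r S"
    then have "t * z + r < n" using n(3) by (simp add: residue_class_def)
    then show "z < n + 1" using b(1)[of z] by linarith
  qed
qed

lemma affine_div_mod:
  fixes t :: int
  assumes "0 \<le> r" "r < t" shows "(t * z + r) div t = z" "(t * z + r) mod t = r"
  using assms by (auto intro: int_div_pos_eq int_mod_pos_eq)

text \<open>Nonnegative beads and negative gaps are put into one signed sum, which can then be
  reindexed over several classes at once.\<close>

lemma msum_eq_sum_defects: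
  assumes "maya S"
  shows "msum f S = (\<Sum>z\<in>(S \<inter> {0..}) \<union> ({..<0} - S). if 0 \<le> z then f z else - f z)"
proof -
  have "(\<Sum>z\<in>(S \<inter> {0..}) \<union> ({..<0} - S). if 0 \<le> z then f z else - f z)
      = (\<Sum>z\<in>S \<inter> {0..}. if 0 \<le> z then f z else - f z) + (\<Sum>z\<in>{..<0} - S. if 0 \<le> z then f z else - f z)"
    using assms by (intro sum.union_disjoint) (auto simp: maya_def)
  also have "(\<Sum>z\<in>S \<inter> {0..}. if 0 \<le> z then f z else - f z) = (\<Sum>z\<in>S \<inter> {0..}. f z)"
    by (intro sum.cong) auto
  also have "(\<Sum>z\<in>{..<0} - S. if 0 \<le> z then f z else - f z) = (\<Sum>z\<in>{..<0} - S. - f z)"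
    by (intro sum.cong) auto
  finally show ?thesis by (simp add: msum_def sum_negf)
qed

lemma symmetric_mayaD:
  assumes "S \<in> symmetric_maya"
  shows "maya S" "z \<notin> S \<Longrightarrow> - 1 - z \<in> S" "z \<in> S \<Longrightarrow> - 1 - z \<notin> S"
  using assms unfolding symmetric_maya_def by blast+

text \<open>In a symmetric diagram the nonnegative beads determine the sum. Such a bead lies in a
  class \<open>j < m\<close>, or in a mirror class \<open>t - 1 - j\<close>, where its reflection is
  a negative gap of class \<open>j\<close>. So the nonnegative beads correspond to the defects of
  the first \<open>m\<close> classes.\<close>

lemma msum_residues:
  fixes m :: nat
  assumes S: "S \<in> symmetric_maya" and t: "t = 2 * int m" and m: "0 < m"
  shows "msum f S = (\<Sum>j<m. msum (\<lambda>z. f (t * z + int j) - f (- 1 - (t * z + int j))) (residue_class t (int j) S))"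
proof -
  define g where "g s = f s - f (- 1 - s)" for s
  \<comment> \<open>Oddness under the reflection absorbs the minus sign carried by gaps.\<close>
  have g: "g (- 1 - s) = - g s" for s by (simp add: g_def)
  define D where "D j = (residue_class t (int j) S \<inter> {0..}) \<union> ({..<0} - residue_class t (int j) S)" for j
  note SD = symmetric_mayaD[OF S]
  have M: "maya (residue_class t (int j) S)" if "j < m" for j
    using that t SD(1) by (intro maya_residue_class) auto
  have finD: "finite (D j)" if "j < m" for j using M[OF that] by (simp add: D_def maya_def)
  \<comment> \<open>\<open>v\<close> sends a defect to the nonnegative bead it stands for, and
    \<open>u\<close> is the inverse.\<close>
  define v where "v = (\<lambda>(j, z). if 0 \<le> z then t * z + int j else - 1 - (t * z + int j))"
  define u where "u s = (if s mod t < int m then (nat (s mod t), s div t) else (nat (t - 1 - s mod t), - 1 - s div t))" for s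
  have tpos: "0 < t" using t m by simp
  have neg: "- 1 - (t * z + r) = t * (- 1 - z) + (t - 1 - r)" for z r by (simp add: algebra_simps)
  have "(\<Sum>j<m. msum (\<lambda>z. g (t * z + int j)) (residue_class t (int j) S))
      = (\<Sum>j<m. \<Sum>z\<in>D j. if 0 \<le> z then g (t * z + int j) else - g (t * z + int j))"
    by (intro sum.cong refl) (simp only: msum_eq_sum_defects[OF M] D_def lessThan_iff)
  also have "\<dots> = (\<Sum>p\<in>Sigma {..<m} D. g (v p))"
    using finD by (subst sum.Sigma) (auto simp: v_def g intro!: sum.cong)
  also have "\<dots> = (\<Sum>s\<in>S \<inter> {0..}. g s)"
  proof (rule sum.reindex_bij_witness[where i = u and j = v])
    fix p assume p: "p \<in> Sigma {..<m} D"
    obtain j z where jz: "p = (j, z)" by (cases p)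
    have j: "j < m" "z \<in> D j" using p by (auto simp: jz)
    show "u (v p) = p"
    proof (cases "0 \<le> z")
      case True
      then have v: "v p = t * z + int j" by (simp add: v_def jz)
      show ?thesis unfolding v u_def using affine_div_mod[of "int j" t z] j(1) t by (simp add: jz)
    next
      case False
      then have v: "v p = t * (- 1 - z) + (t - 1 - int j)" by (simp add: v_def jz neg)
      show ?thesis unfolding v u_def using affine_div_mod[of "t - 1 - int j" t "- 1 - z"] j(1) t by (simp add: jz)
    qed
    show "v p \<in> S \<inter> {0..}"
    proof (cases "0 \<le> z")
      case True
      then have "t * z + int j \<in> S" using j(2) by (simp add: D_def residue_class_def)
      then show ?thesis using True tpos by (simp add: v_def jz)
    next
      case False
      then have "t * z + int j \<notin> S" using j(2) by (simp add: D_def residue_class_def)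
      then have "- 1 - (t * z + int j) \<in> S" by (rule SD(2))
      moreover have "t * z + int j < 0" using affine_bounds(2)[of "int j" t 0 z] False j(1) t by simp
      ultimately show ?thesis using False by (simp add: v_def jz)
    qed
  next
    fix s assume s: "s \<in> S \<inter> {0..}"
    define q r where "q = s div t" and "r = s mod t"
    have sqr: "s = t * q + r" by (simp add: q_def r_def)
    have r: "0 \<le> r" "r < t" using tpos by (simp_all add: r_def)
    have q: "0 \<le> q" using s tpos by (simp add: q_def pos_imp_zdiv_nonneg_iff)
    have "v (u s) = s \<and> u s \<in> Sigma {..<m} D"
    proof (cases "r < int m")
      case True
      then have u: "u s = (nat r, q)" by (simp add: u_def q_def r_def)
      show ?thesis using s q r True by (simp add: u v_def D_def residue_class_def flip: sqr)
    next
      case False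
      then have u: "u s = (nat (t - 1 - r), - 1 - q)" by (simp add: u_def q_def r_def)
      have e: "t * (- 1 - q) + (t - 1 - r) = - 1 - s" by (simp add: sqr algebra_simps)
      have "- 1 - s \<notin> S" using SD(3) s by blast
      moreover have "nat (t - 1 - r) < m" using False r t by linarith
      ultimately show ?thesis using q r by (simp add: u v_def D_def residue_class_def e)
    qed
    then show "v (u s) = s" "u s \<in> Sigma {..<m} D" by auto
  qed auto
  also have "\<dots> = msum f S" unfolding msum_symmetric[OF S] g_def ..
  finally show ?thesis unfolding g_def ..
qed

lemma sum_single_mset: "finite A \<Longrightarrow> (\<Sum>p\<in>A. {#f p#}) = image_mset f (mset_set A)"
  by (induction A rule: finite_induct) auto

text \<open>\<open>t\<close> divides \<open>s - g\<close> exactly when both lie in one residue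
  class, and there the hook length is divided by \<open>t\<close>.\<close>

lemma hooks_residues:
  fixes t :: nat
  assumes S: "maya S" and t: "0 < t"
  shows "{#h \<in># hooks S. t dvd h#} = (\<Sum>r<t. image_mset ((*) t) (hooks (residue_class (int t) (int r) S)))"
proof -
  let ?A = "{p\<in>hook_pairs S. t dvd nat (fst p - snd p)}"
  let ?H = "\<lambda>r. hook_pairs (residue_class (int t) (int r) S)"
  have M: "maya (residue_class (int t) (int r) S)" if "r < t" for r
    using that S by (intro maya_residue_class) auto
  have "{#h \<in># hooks S. t dvd h#} = (\<Sum>p\<in>?A. {#nat (fst p - snd p)#})"
    using S by (subst sum_single_mset) (auto simp: hooks_def filter_mset_image_mset split_def)
  also have "\<dots> = (\<Sum>(r, s, g)\<in>Sigma {..<t} ?H. {#t * nat (s - g)#})"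
  proof (rule sum.reindex_bij_witness[where i = "\<lambda>(r, s, g). (int t * s + int r, int t * g + int r)"
        and j = "\<lambda>(s, g). (nat (s mod int t), s div int t, g div int t)"])
    fix p assume p: "p \<in> ?A"
    obtain s g where sg: "p = (s, g)" by (cases p)
    have lt: "g < s" "s \<in> S" "g \<notin> S" and dv: "t dvd nat (s - g)" using p by (auto simp: sg hook_pairs_def)
    have "int t dvd s - g" using dv lt(1) by (metis diff_ge_0_iff_ge int_dvd_int_iff less_imp_le nat_0_le)
    then have md: "g mod int t = s mod int t" by (metis mod_eq_dvd_iff)
    define r where "r = s mod int t"
    have r: "0 \<le> r" "r < int t" using t by (simp_all add: r_def)
    have s: "s = int t * (s div int t) + r" and g: "g = int t * (g div int t) + r"
      using mult_div_mod_eq[of "int t" g] md by (simp_all add: r_def)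
    have diff: "s - g = int t * (s div int t - g div int t)"
      using s g by (metis add_diff_cancel_right right_diff_distrib)
    then have "g div int t < s div int t" using lt(1) t by (metis diff_gt_0_iff_gt of_nat_0_less_iff zero_less_mult_pos)
    then show "(case (case p of (s, g) \<Rightarrow> (nat (s mod int t), s div int t, g div int t)) of (r, s, g) \<Rightarrow> (int t * s + int r, int t * g + int r)) = p"
      "(case p of (s, g) \<Rightarrow> (nat (s mod int t), s div int t, g div int t)) \<in> Sigma {..<t} ?H"
      "(case (case p of (s, g) \<Rightarrow> (nat (s mod int t), s div int t, g div int t)) of (r, s, g) \<Rightarrow> {#t * nat (s - g)#}) = {#nat (fst p - snd p)#}"
      using lt r s g diff t unfolding sg
      by (simp_all add: hook_pairs_def residue_class_def nat_mult_distrib flip: r_def)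
  next
    fix x assume x: "x \<in> Sigma {..<t} ?H"
    obtain r s g where rsg: "x = (r, s, g)" by (cases x)
    have r: "r < t" and sg: "int t * s + int r \<in> S" "int t * g + int r \<notin> S" "g < s"
      using x by (auto simp: rsg hook_pairs_def residue_class_def)
    note dm = affine_div_mod[of "int r" "int t"]
    show "(case (case x of (r, s, g) \<Rightarrow> (int t * s + int r, int t * g + int r)) of (s, g) \<Rightarrow> (nat (s mod int t), s div int t, g div int t)) = x"
      using r by (simp add: rsg dm)
    have "int t * s + int r - (int t * g + int r) = int t * (s - g)" by (simp add: right_diff_distrib)
    then have "nat (int t * s + int r - (int t * g + int r)) = t * nat (s - g)" using sg(3) by (simp only: nat_mult_distrib) simp
    moreover have "int t * g < int t * s" using sg(3) t by simp
    ultimately show "(case x of (r, s, g) \<Rightarrow> (int t * s + int r, int t * g + int r)) \<in> ?A"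
      using sg by (simp add: rsg hook_pairs_def)
  qed
  also have "\<dots> = (\<Sum>r<t. \<Sum>(s, g)\<in>?H r. {#t * nat (s - g)#})"
    using M by (subst sum.Sigma) (auto simp: split_def)
  also have "\<dots> = (\<Sum>r<t. image_mset ((*) t) (hooks (residue_class (int t) (int r) S)))"
  proof (intro sum.cong refl)
    fix r assume "r \<in> {..<t}"
    then have "finite (?H r)" using M by simp
    from sum_single_mset[OF this, of "\<lambda>(s, g). t * nat (s - g)"]
    show "(\<Sum>(s, g)\<in>?H r. {#t * nat (s - g)#}) = image_mset ((*) t) (hooks (residue_class (int t) (int r) S))"
      by (simp add: hooks_def image_mset.compositionality o_def split_def)
  qed
  finally show ?thesis .
qed

text \<open>By symmetry the class \<open>t - 1 - r\<close> is the reflected complement of class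
  \<open>r\<close>. It encodes the conjugate partition, whose hooks arise by exchanging bead and
  gap.\<close>

lemma hooks_reflected_residue:
  assumes "S \<in> symmetric_maya"
  shows "hooks (residue_class t (t - 1 - r) S) = hooks (residue_class t r S)"
proof -
  note SD = symmetric_mayaD[OF assms]
  have mem: "z \<in> residue_class t (t - 1 - r) S \<longleftrightarrow> - 1 - z \<notin> residue_class t r S" for z
  proof -
    have "t * (- 1 - z) + r = - 1 - (t * z + (t - 1 - r))" by (simp add: algebra_simps)
    then show ?thesis using SD(2,3) unfolding residue_class_def mem_Collect_eq by metis
  qed
  have inj: "inj_on (\<lambda>(s, g). (- 1 - g, - 1 - s)) A" for A :: "(int \<times> int) set" by (auto simp: inj_on_def)
  have hp: "hook_pairs (residue_class t (t - 1 - r) S) = (\<lambda>(s, g). (- 1 - g, - 1 - s)) ` hook_pairs (residue_class t r S)"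
  proof (intro equalityI subsetI)
    fix p assume p: "p \<in> hook_pairs (residue_class t (t - 1 - r) S)"
    obtain s g where sg: "p = (s, g)" by (cases p)
    have "(- 1 - g, - 1 - s) \<in> hook_pairs (residue_class t r S)"
      using p by (simp add: sg hook_pairs_def mem)
    then show "p \<in> (\<lambda>(s, g). (- 1 - g, - 1 - s)) ` hook_pairs (residue_class t r S)"
      by (rule image_eqI[rotated]) (simp add: sg)
  next
    fix p assume "p \<in> (\<lambda>(s, g). (- 1 - g, - 1 - s)) ` hook_pairs (residue_class t r S)"
    then obtain s g where sg: "(s, g) \<in> hook_pairs (residue_class t r S)" "p = (- 1 - g, - 1 - s)" by auto
    then show "p \<in> hook_pairs (residue_class t (t - 1 - r) S)" by (simp add: hook_pairs_def mem)
  qed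
  show ?thesis
    unfolding hooks_def hp image_mset_mset_set[OF inj, symmetric]
    by (simp add: image_mset.compositionality o_def split_def)
qed

lemma hooks_div_residues:
  fixes m :: nat
  assumes p: "p \<in> self_conjugate" and t: "t = 2 * m" and m: "0 < m"
  defines "Q \<equiv> \<lambda>j. image_mset ((*) t) (hooks (residue_class (int t) (int j) (beads p)))"
  shows "hooks_div t p = (\<Sum>j<m. Q j + Q j)"
proof -
  have S: "beads p \<in> symmetric_maya" using p bij_betw_beads by (auto simp: bij_betw_def)
  have ip: "is_partition p" using p by (simp add: self_conjugate_def)
  have "hooks_div t p = (\<Sum>r<t. Q r)"
    unfolding hooks_div_def hooks_beads[OF ip] Q_def
    using t m by (intro hooks_residues symmetric_mayaD(1)[OF S]) auto
  also have "{..<t} = {..<m} \<union> {m..<2 * m}" using t by auto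
  also have "(\<Sum>r\<in>{..<m} \<union> {m..<2 * m}. Q r) = (\<Sum>r<m. Q r) + (\<Sum>r\<in>{m..<2 * m}. Q r)"
    by (rule sum.union_disjoint) auto
  also have "(\<Sum>r\<in>{m..<2 * m}. Q r) = (\<Sum>j<m. Q j)"
  proof (rule sum.reindex_bij_witness[where i = "\<lambda>j. t - 1 - j" and j = "\<lambda>j. t - 1 - j"])
    fix r assume r: "r \<in> {m..<2 * m}"
    have "int (t - 1 - r) = int t - 1 - int r" using r t by (simp add: of_nat_diff)
    then show "Q (t - 1 - r) = Q r" unfolding Q_def using hooks_reflected_residue[OF S] by simp
  qed (use t in auto)
  finally show ?thesis by (simp add: sum.distrib)
qed

section \<open>Symmetric diagrams from half of their classes, and from their nonnegative
  beads\<close>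

text \<open>Inverse to taking the first \<open>m\<close> of \<open>2 * m\<close> classes; the others
  are filled in by reflection.\<close>

definition assemble :: "nat \<Rightarrow> (nat \<Rightarrow> int set) \<Rightarrow> int set" where
  "assemble m G = {z. if z mod (2 * int m) < int m then z div (2 * int m) \<in> G (nat (z mod (2 * int m)))
     else - 1 - z div (2 * int m) \<notin> G (nat (2 * int m - 1 - z mod (2 * int m)))}"

lemma mem_assemble:
  assumes "0 \<le> r" "r < 2 * int m"
  shows "2 * int m * q + r \<in> assemble m G \<longleftrightarrow> (if r < int m then q \<in> G (nat r) else - 1 - q \<notin> G (nat (2 * int m - 1 - r)))"
  using affine_div_mod[OF assms] by (simp add: assemble_def)

lemma div_mod_obtain:
  assumes "0 < m"
  obtains q r where "z = 2 * int m * q + r" "0 \<le> r" "r < 2 * int m"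
  using assms that[of "z div (2 * int m)" "z mod (2 * int m)"] by simp

lemma assemble_symmetric:
  assumes m: "0 < m" and G: "\<And>j. j < m \<Longrightarrow> maya (G j)"
  shows "assemble m G \<in> symmetric_maya"
proof -
  define t where "t = 2 * int m"
  have refl: "z \<in> assemble m G \<longleftrightarrow> - 1 - z \<notin> assemble m G" for z
  proof -
    obtain q r where z: "z = 2 * int m * q + r" "0 \<le> r" "r < 2 * int m" using div_mod_obtain[OF m] by blast
    have e: "- 1 - z = 2 * int m * (- 1 - q) + (2 * int m - 1 - r)" by (simp add: z(1) algebra_simps)
    have 1: "z \<in> assemble m G \<longleftrightarrow> (if r < int m then q \<in> G (nat r) else - 1 - q \<notin> G (nat (2 * int m - 1 - r)))"
      unfolding z(1) by (rule mem_assemble[OF z(2,3)])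
    have 2: "- 1 - z \<in> assemble m G \<longleftrightarrow> (if 2 * int m - 1 - r < int m then - 1 - q \<in> G (nat (2 * int m - 1 - r))
        else - 1 - (- 1 - q) \<notin> G (nat (2 * int m - 1 - (2 * int m - 1 - r))))"
      unfolding e by (rule mem_assemble) (use z in auto)
    show ?thesis unfolding 1 2 by (cases "r < int m") auto
  qed
  have "\<exists>n. 0 \<le> n \<and> (\<forall>z. (z \<notin> G j \<longrightarrow> -n < z) \<and> (z \<in> G j \<longrightarrow> z < n))" if "j < m" for j
    using maya_bounds[OF G[OF that]] by metis
  then obtain N where N: "\<And>j. j < m \<Longrightarrow> 0 \<le> N j" "\<And>j z. j < m \<Longrightarrow> z \<notin> G j \<Longrightarrow> - N j < z" "\<And>j z. j < m \<Longrightarrow> z \<in> G j \<Longrightarrow> z < N j"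
    by metis
  define n where "n = (\<Sum>j<m. N j)"
  have n: "0 \<le> n" "\<And>j. j < m \<Longrightarrow> N j \<le> n"
    using N(1) by (auto simp: n_def intro!: sum_nonneg member_le_sum)
  have up: "z < 2 * int m * (n + 1)" if z: "z \<in> assemble m G" for z
  proof -
    obtain q r where qr: "z = 2 * int m * q + r" "0 \<le> r" "r < 2 * int m" using div_mod_obtain[OF m] by blast
    have "q \<le> n"
    proof (cases "r < int m")
      case True
      then have "q \<in> G (nat r)" "nat r < m" using z mem_assemble[OF qr(2,3)] qr by auto
      then show ?thesis using N(3)[of "nat r" q] n(2)[of "nat r"] by linarith
    next
      case False
      then have "- 1 - q \<notin> G (nat (2 * int m - 1 - r))" "nat (2 * int m - 1 - r) < m"
        using z mem_assemble[OF qr(2,3)] qr by auto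
      then show ?thesis using N(2)[of "nat (2 * int m - 1 - r)" "- 1 - q"] n(2)[of "nat (2 * int m - 1 - r)"] by linarith
    qed
    then have "2 * int m * q \<le> 2 * int m * n" by (intro mult_left_mono) auto
    moreover have "2 * int m * (n + 1) = 2 * int m * n + 2 * int m" by (simp add: distrib_left)
    ultimately show ?thesis using qr by linarith
  qed
  have "maya (assemble m G)"
  proof (rule mayaI)
    show "z < 2 * int m * (n + 1) + 1" if "z \<in> assemble m G" for z using up[OF that] by simp
    \<comment> \<open>Reflection turns the bound on beads into a bound on gaps.\<close>
    show "- (2 * int m * (n + 1) + 1) < z" if "z \<notin> assemble m G" for z
      using up[of "- 1 - z"] refl[of z] that by linarith
  qed
  then show ?thesis using refl unfolding symmetric_maya_def by blast
qed

lemma bij_betw_residues: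
  assumes m: "0 < m"
  shows "bij_betw (\<lambda>S. \<lambda>j\<in>{..<m}. residue_class (2 * int m) (int j) S) symmetric_maya (PiE {..<m} (\<lambda>_. {S. maya S}))"
proof (rule bij_betw_byWitness[where f' = "assemble m"])
  show "\<forall>S\<in>symmetric_maya. assemble m (\<lambda>j\<in>{..<m}. residue_class (2 * int m) (int j) S) = S"
  proof (intro ballI set_eqI)
    fix S z assume S: "S \<in> symmetric_maya"
    let ?G = "\<lambda>j\<in>{..<m}. residue_class (2 * int m) (int j) S"
    note SD = symmetric_mayaD(2,3)[OF S]
    obtain q r where z: "z = 2 * int m * q + r" "0 \<le> r" "r < 2 * int m" using div_mod_obtain[OF m] by blast
    show "z \<in> assemble m (\<lambda>j\<in>{..<m}. residue_class (2 * int m) (int j) S) \<longleftrightarrow> z \<in> S"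
    proof (cases "r < int m")
      case True
      then have "nat r < m" using z by linarith
      then show ?thesis using True mem_assemble[OF z(2,3), of q ?G] z by (simp add: residue_class_def)
    next
      case False
      then have "nat (2 * int m - 1 - r) < m" "0 \<le> 2 * int m - 1 - r" using z by linarith+
      then have G: "?G (nat (2 * int m - 1 - r)) = residue_class (2 * int m) (2 * int m - 1 - r) S" by simp
      have e: "2 * int m * (- 1 - q) + (2 * int m - 1 - r) = - 1 - z" by (simp add: z(1) algebra_simps)
      have "z \<in> assemble m ?G \<longleftrightarrow> - 1 - q \<notin> ?G (nat (2 * int m - 1 - r))"
        using mem_assemble[OF z(2,3), of q ?G] False unfolding z(1)[symmetric] by simp
      also have "\<dots> \<longleftrightarrow> - 1 - z \<notin> S" unfolding G by (simp only: residue_class_def mem_Collect_eq e)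
      also have "\<dots> \<longleftrightarrow> z \<in> S" using SD by blast
      finally show ?thesis .
    qed
  qed
  show "\<forall>G\<in>PiE {..<m} (\<lambda>_. {S. maya S}). (\<lambda>j\<in>{..<m}. residue_class (2 * int m) (int j) (assemble m G)) = G"
  proof
    fix G assume G: "G \<in> PiE {..<m} (\<lambda>_. {S. maya S})"
    show "(\<lambda>j\<in>{..<m}. residue_class (2 * int m) (int j) (assemble m G)) = G"
    proof
      fix j
      show "(\<lambda>j\<in>{..<m}. residue_class (2 * int m) (int j) (assemble m G)) j = G j"
      proof (cases "j < m")
        case True
        then show ?thesis by (auto simp: residue_class_def mem_assemble)
      next
        case False
        then show ?thesis using PiE_arb[OF G, of j] by simp
      qed
    qed
  qed
  show "(\<lambda>S. \<lambda>j\<in>{..<m}. residue_class (2 * int m) (int j) S) ` symmetric_maya \<subseteq> PiE {..<m} (\<lambda>_. {S. maya S})"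
    by (auto intro!: maya_residue_class dest: symmetric_mayaD(1))
  show "assemble m ` PiE {..<m} (\<lambda>_. {S. maya S}) \<subseteq> symmetric_maya"
    using assemble_symmetric[OF m] by (auto simp: PiE_def Pi_def)
qed

text \<open>The nonnegative beads determine a symmetric diagram and may form any finite set. Bead
  \<open>n\<close> belongs to the main-diagonal hook of length \<open>2 * n + 1\<close>, so this is
  the classical bijection with partitions into distinct odd parts.\<close>

lemma bij_betw_finite_sets:
  "bij_betw (\<lambda>S. {n. int n \<in> S}) symmetric_maya {A. finite A}"
proof (rule bij_betw_byWitness[where f' = "\<lambda>A. int ` A \<union> {z. z < 0 \<and> nat (- 1 - z) \<notin> A}"])
  show "\<forall>S\<in>symmetric_maya. int ` {n. int n \<in> S} \<union> {z. z < 0 \<and> nat (- 1 - z) \<notin> {n. int n \<in> S}} = S"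
  proof (intro ballI set_eqI)
    fix S z assume "S \<in> symmetric_maya"
    note SD = symmetric_mayaD(2,3)[OF this]
    show "z \<in> int ` {n. int n \<in> S} \<union> {z. z < 0 \<and> nat (- 1 - z) \<notin> {n. int n \<in> S}} \<longleftrightarrow> z \<in> S"
    proof (cases "z < 0")
      case True
      then have "int (nat (- 1 - z)) = - 1 - z" by simp
      then show ?thesis using True SD[of z] by auto
    next
      case False
      then have "z = int (nat z)" by simp
      then show ?thesis using False by (auto simp: image_iff intro!: exI[of _ "nat z"])
    qed
  qed
  show "\<forall>A\<in>{A. finite A}. {n. int n \<in> int ` A \<union> {z. z < 0 \<and> nat (- 1 - z) \<notin> A}} = A"
    by auto
  show "(\<lambda>S. {n. int n \<in> S}) ` symmetric_maya \<subseteq> {A. finite A}"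
  proof (intro image_subsetI CollectI)
    fix S assume "S \<in> symmetric_maya"
    then have "finite (S \<inter> {0..})" using symmetric_mayaD(1) by (simp add: maya_def)
    moreover have "int ` {n. int n \<in> S} \<subseteq> S \<inter> {0..}" by auto
    ultimately have "finite (int ` {n. int n \<in> S})" by (rule rev_finite_subset)
    then show "finite {n. int n \<in> S}" by (rule finite_imageD) (simp add: inj_on_def)
  qed
  show "(\<lambda>A. int ` A \<union> {z. z < 0 \<and> nat (- 1 - z) \<notin> A}) ` {A. finite A} \<subseteq> symmetric_maya"
  proof (intro image_subsetI)
    fix A :: "nat set" assume "A \<in> {A. finite A}"
    then have A: "finite A" by simp
    let ?S = "int ` A \<union> {z. z < 0 \<and> nat (- 1 - z) \<notin> A}"
    have mem: "z \<in> ?S \<longleftrightarrow> (if z < 0 then nat (- 1 - z) \<notin> A else nat z \<in> A)" for z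
    proof (cases "z < 0")
      case False
      then have "z = int (nat z)" by simp
      then show ?thesis using False by (auto simp: image_iff intro!: bexI[of _ "nat z"])
    qed auto
    have "z \<in> ?S \<longleftrightarrow> - 1 - z \<notin> ?S" for z unfolding mem by (cases "z < 0") auto
    moreover have "maya ?S"
      unfolding maya_def
    proof
      have "?S \<inter> {0..} \<subseteq> int ` A" by auto
      then show "finite (?S \<inter> {0..})" by (rule finite_subset) (use A in simp)
      have "{..<0} - ?S \<subseteq> (\<lambda>n. - 1 - int n) ` A"
      proof
        fix z assume z: "z \<in> {..<0} - ?S"
        then have "nat (- 1 - z) \<in> A" using mem[of z] by auto
        moreover have "z = - 1 - int (nat (- 1 - z))" using z by auto
        ultimately show "z \<in> (\<lambda>n. - 1 - int n) ` A" by blast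
      qed
      then show "finite ({..<0} - ?S)" by (rule finite_subset) (use A in simp)
    qed
    ultimately show "?S \<in> symmetric_maya" unfolding symmetric_maya_def by blast
  qed
qed

section \<open>The identity\<close>

lemma msum_eqI: "(\<And>z. f z = g z) \<Longrightarrow> msum f S = msum g S"
  by (simp add: msum_def)

text \<open>The identity minus its reflection is \<open>2 * s + 1\<close>; at
  \<open>s = t * z + j\<close> this is the affine weight of class \<open>j\<close>.\<close>

lemma energy_residues:
  fixes m :: nat
  assumes "S \<in> symmetric_maya" "t = 2 * int m" "0 < m"
  shows "energy S = (\<Sum>j<m. msum (\<lambda>z. 2 * t * z + (2 * int j + 1)) (residue_class t (int j) S))"
  unfolding msum_residues[OF assms, of "\<lambda>z. z"]
  by (intro sum.cong refl msum_eqI) (simp add: algebra_simps)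

text \<open>As \<open>t\<close> is even, \<open>t * z + j\<close> has the parity of \<open>j\<close>
  and its reflection the opposite one, so each bead of class \<open>j\<close> counts
  \<open>(-1) ^ j\<close>. Hence the BG-rank sees only the charges.\<close>

lemma even_ind_residues:
  fixes m :: nat
  assumes "S \<in> symmetric_maya" "t = 2 * int m" "0 < m"
  shows "msum even_ind S = (\<Sum>j<m. (-1) ^ j * charge (residue_class t (int j) S))"
  unfolding msum_residues[OF assms, of even_ind] msum_const[symmetric]
  using assms(2) by (intro sum.cong refl msum_eqI) (auto simp: uminus_power_if)

lemma size_sum_mset: "size (\<Sum>i\<in>I. M i :: 'a multiset) = (\<Sum>i\<in>I. size (M i))"
  by (induction I rule: infinite_finite_induct) auto

lemma prod_sum_mset: "(\<Prod>h\<in>#(\<Sum>i\<in>I. M i). f h) = (\<Prod>i\<in>I. \<Prod>h\<in>#M i. f h :: 'b :: comm_monoid_mult)"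
  by (induction I rule: infinite_finite_induct) auto

lemma sum_sum_mset: "(\<Sum>h\<in>#(\<Sum>i\<in>I. M i). f h) = (\<Sum>i\<in>I. \<Sum>h\<in>#M i. f h :: 'b :: comm_monoid_add)"
  by (induction I rule: infinite_finite_induct) auto

text \<open>Class \<open>j\<close> and its mirror class have the same hooks and are weighted
  together, hence the doubled exponent and the square.\<close>

definition hook_weight :: "nat \<Rightarrow> nat multiset \<Rightarrow> laurent" where
  "hook_weight t M = x_var ^ (2 * size M) * scalar ((\<Prod>h\<in>#M. 1 / of_nat (t * h)) ^ 2)"

text \<open>The factor 2 accounts for the mirror class.\<close>

definition hook_power :: "nat \<Rightarrow> nat \<Rightarrow> nat multiset \<Rightarrow> rat" where
  "hook_power t k M = 2 * of_nat t ^ (2 * k) * (\<Sum>h\<in>#M. of_nat h ^ (2 * k))"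

text \<open>The power sum is additive over the classes, everything else multiplicative. In the
  summand \<open>i\<close> class \<open>i\<close> carries the power sum, so that each summand
  factors over the classes.\<close>

lemma hooks_div_weight:
  fixes m k :: nat
  assumes p: "p \<in> self_conjugate" and t: "t = 2 * m" and m: "0 < m"
  defines "H \<equiv> \<lambda>j. hooks (residue_class (int t) (int j) (beads p))"
  shows "x_var ^ size (hooks_div t p) * b_pow (BG_rank p) *
      scalar ((\<Prod>h\<in>#hooks_div t p. 1 / of_nat h) * (\<Sum>h\<in>#hooks_div t p. of_nat h ^ (2 * k)))
    = (\<Sum>i<m. \<Prod>j<m. b_pow ((-1) ^ j * charge (residue_class (int t) (int j) (beads p)))
         * (if j = i then hook_weight t (H j) * scalar (hook_power t k (H j)) else hook_weight t (H j)))"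
proof -
  have S: "beads p \<in> symmetric_maya" using p bij_betw_beads by (auto simp: bij_betw_def)
  have ip: "is_partition p" using p by (simp add: self_conjugate_def)
  have hd: "hooks_div t p = (\<Sum>j<m. image_mset ((*) t) (H j) + image_mset ((*) t) (H j))"
    unfolding H_def by (rule hooks_div_residues[OF p t m])
  have size: "size (hooks_div t p) = (\<Sum>j<m. 2 * size (H j))"
    unfolding hd size_sum_mset by (simp add: mult_2)
  have prod: "(\<Prod>h\<in>#hooks_div t p. 1 / of_nat h :: rat) = (\<Prod>j<m. (\<Prod>h\<in>#H j. 1 / of_nat (t * h)) ^ 2)"
    unfolding hd prod_sum_mset by (simp add: power2_eq_square image_mset.compositionality o_def)
  have "(\<Sum>h\<in>#image_mset ((*) t) M. of_nat h ^ (2 * k) :: rat) = of_nat t ^ (2 * k) * (\<Sum>h\<in>#M. of_nat h ^ (2 * k))" for M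
    by (induction M) (auto simp: power_mult_distrib ring_distribs)
  then have sum: "(\<Sum>h\<in>#hooks_div t p. of_nat h ^ (2 * k) :: rat) = (\<Sum>j<m. hook_power t k (H j))"
    unfolding hd sum_sum_mset by (simp add: hook_power_def mult.assoc)
  have bg: "b_pow (BG_rank p) = (\<Prod>j<m. b_pow ((-1) ^ j * charge (residue_class (int t) (int j) (beads p))))"
    unfolding BG_rank_beads[OF ip] using even_ind_residues[OF S _ m, of "int t"] t by (simp add: b_pow_sum)
  have x: "x_var ^ size (hooks_div t p) * scalar (\<Prod>h\<in>#hooks_div t p. 1 / of_nat h) = (\<Prod>j<m. hook_weight t (H j))"
    unfolding size prod hook_weight_def by (simp add: power_sum scalar_prod prod.distrib)
  have one: "(\<Prod>j<m. B j * (if j = i then W j * V j else W j)) = (\<Prod>j<m. B j) * (\<Prod>j<m. W j) * V i"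
    if "i < m" for B W V :: "nat \<Rightarrow> laurent" and i
  proof -
    have "(\<Prod>j<m. B j * (if j = i then W j * V j else W j)) = (\<Prod>j<m. B j * W j * (if j = i then V j else 1))"
      by (intro prod.cong) auto
    then show ?thesis using that by (simp add: prod.distrib)
  qed
  have "x_var ^ size (hooks_div t p) * b_pow (BG_rank p) *
      scalar ((\<Prod>h\<in>#hooks_div t p. 1 / of_nat h) * (\<Sum>h\<in>#hooks_div t p. of_nat h ^ (2 * k)))
    = b_pow (BG_rank p) * (x_var ^ size (hooks_div t p) * scalar (\<Prod>h\<in>#hooks_div t p. 1 / of_nat h))
       * scalar (\<Sum>h\<in>#hooks_div t p. of_nat h ^ (2 * k))"
    by (simp only: scalar_mult mult_ac)
  also have "\<dots> = (\<Sum>i<m. b_pow (BG_rank p) * (\<Prod>j<m. hook_weight t (H j)) * scalar (hook_power t k (H i)))"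
    unfolding x sum scalar_sum sum_distrib_left ..
  also have "\<dots> = (\<Sum>i<m. \<Prod>j<m. b_pow ((-1) ^ j * charge (residue_class (int t) (int j) (beads p)))
         * (if j = i then hook_weight t (H j) * scalar (hook_power t k (H j)) else hook_weight t (H j)))"
    unfolding bg by (intro sum.cong refl one[symmetric]) auto
  finally show ?thesis .
qed

text \<open>The charges of the residue classes parametrise the self-conjugate \<open>t\<close>-cores.\<close>

definition core_series :: "nat \<Rightarrow> nat \<Rightarrow> laurent fps" where
  "core_series t j = gf UNIV (\<lambda>c. nat (msum (\<lambda>z. int (2 * t) * z + (2 * int j + 1)) {..<c})) (\<lambda>c. b_pow ((-1) ^ j * c))"

text \<open>The weight may vary from class to class: the constant 1 identifies the core series, and
  with one distinguished class it accommodates the power sum.\<close>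

lemma gf_symmetric_maya:
  fixes m :: nat and F :: "nat \<Rightarrow> nat multiset \<Rightarrow> laurent"
  assumes t: "t = 2 * m" and m: "0 < m"
  defines "R \<equiv> \<lambda>S j. residue_class (int t) (int j) S"
  shows "gf symmetric_maya (\<lambda>S. nat (energy S)) (\<lambda>S. \<Prod>j<m. b_pow ((-1) ^ j * charge (R S j)) * F j (hooks (R S j)))
     = (\<Prod>j<m. core_series t j * gf maya0 (\<lambda>S. 2 * t * nat (energy S)) (\<lambda>S. F j (hooks S)))"
proof -
  let ?f = "\<lambda>j z. int (2 * t) * z + (2 * int j + 1)"
  let ?w = "\<lambda>j S. nat (msum (?f j) S)" and ?c = "\<lambda>j S. b_pow ((-1) ^ j * charge S) * F j (hooks S)"
  have de: "0 \<le> 2 * int j + 1" "2 * int j + 1 < int (2 * t)" if "j < m" for j using that t by auto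
  have bij: "bij_betw (\<lambda>S. \<lambda>j\<in>{..<m}. R S j) symmetric_maya (PiE {..<m} (\<lambda>_. {S. maya S}))"
    using bij_betw_residues[OF m] by (simp add: R_def t)
  have "gf (PiE {..<m} (\<lambda>_. {S. maya S})) (\<lambda>G. \<Sum>j<m. ?w j (G j)) (\<lambda>G. \<Prod>j<m. ?c j (G j))
      = gf symmetric_maya (\<lambda>S. nat (energy S)) (\<lambda>S. \<Prod>j<m. ?c j (R S j))"
  proof (rule gf_reindex[OF bij])
    fix S assume S: "S \<in> symmetric_maya"
    have "energy S = (\<Sum>j<m. msum (?f j) (R S j))"
      unfolding R_def using energy_residues[OF S _ m, of "int t"] t by simp
    also have "\<dots> = (\<Sum>j<m. int (?w j (R S j)))"
    proof (intro sum.cong refl)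
      fix j assume "j \<in> {..<m}"
      then have j: "j < m" by simp
      have "maya (R S j)" unfolding R_def using symmetric_mayaD(1)[OF S] j t by (intro maya_residue_class) auto
      then show "msum (?f j) (R S j) = int (?w j (R S j))" using affine_msum_nonneg[OF de[OF j]] by simp
    qed
    finally have "nat (energy S) = (\<Sum>j<m. ?w j (R S j))" by (simp only: of_nat_sum[symmetric] nat_int)
    then show "(\<Sum>j<m. ?w j ((\<lambda>j\<in>{..<m}. R S j) j)) = nat (energy S)" by simp
    show "(\<Prod>j<m. ?c j ((\<lambda>j\<in>{..<m}. R S j) j)) = (\<Prod>j<m. ?c j (R S j))" by (intro prod.cong) auto
  qed
  moreover have "gf (PiE {..<m} (\<lambda>_. {S. maya S})) (\<lambda>G. \<Sum>j<m. ?w j (G j)) (\<lambda>G. \<Prod>j<m. ?c j (G j))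
      = (\<Prod>j<m. gf {S. maya S} (?w j) (?c j))"
    using gf_graded_PiE[of "{..<m}" "\<lambda>_. {S. maya S}" ?w ?c] graded_affine[OF de] by auto
  moreover have "gf {S. maya S} (?w j) (?c j) = core_series t j * gf maya0 (\<lambda>S. 2 * t * nat (energy S)) (\<lambda>S. F j (hooks S))"
    if "j < m" for j
    using gf_charge_split[OF de[OF that], of "(-1) ^ j" "F j"] unfolding core_series_def nat_int .
  ultimately show ?thesis by simp
qed

text \<open>The main-diagonal hook \<open>2 * a + 1\<close> contributes \<open>(-1) ^ a\<close> to
  the BG-rank: even \<open>a\<close> give lengths 1 modulo 4 with \<open>b\<close>, odd
  \<open>a\<close> give lengths 3 modulo 4 with \<open>1 / b\<close>.\<close>

lemma gf_even_ind:
  "gf symmetric_maya (\<lambda>S. nat (energy S)) (\<lambda>S. b_pow (msum even_ind S))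
     = qpoch_inf (- (fps_const (b_pow 1) * fps_X)) (fps_X ^ 4) * qpoch_inf (- (fps_const (b_pow (-1)) * fps_X ^ 3)) (fps_X ^ 4)"
proof (rule fps_ext)
  fix n
  let ?a = "- (fps_const (b_pow 1) * fps_X)" and ?b = "- (fps_const (b_pow (-1)) * fps_X ^ 3)" and ?z = "fps_X ^ 4 :: laurent fps"
  let ?w = "\<lambda>a::nat. 2 * a + 1" and ?c = "\<lambda>a::nat. b_pow ((-1) ^ a)"
  have "gf {A. finite A} (\<lambda>A. \<Sum>a\<in>A. ?w a) (\<lambda>A. \<Prod>a\<in>A. ?c a) = gf symmetric_maya (\<lambda>S. nat (energy S)) (\<lambda>S. b_pow (msum even_ind S))"
  proof (rule gf_reindex[OF bij_betw_finite_sets])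
    fix S assume S: "S \<in> symmetric_maya"
    have sum: "msum f S = (\<Sum>a\<in>{n. int n \<in> S}. f (int a) - f (- 1 - int a))" for f
      unfolding msum_symmetric[OF S]
      by (rule sum.reindex_bij_witness[where i = int and j = nat]) auto
    have "energy S = (\<Sum>a\<in>{n. int n \<in> S}. int (?w a))"
      unfolding sum by (intro sum.cong) auto
    then show "(\<Sum>a\<in>{n. int n \<in> S}. ?w a) = nat (energy S)" by (simp only: of_nat_sum[symmetric] nat_int)
    have "msum even_ind S = (\<Sum>a\<in>{n. int n \<in> S}. (-1) ^ a)"
      unfolding sum by (intro sum.cong) (auto simp: uminus_power_if)
    then show "(\<Prod>a\<in>{n. int n \<in> S}. ?c a) = b_pow (msum even_ind S)" by (simp add: b_pow_sum)
  qed
  \<comment> \<open>The number of factors is even, so that each even \<open>a\<close> is paired with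
    the odd one after it.\<close>
  then have "fps_nth (gf symmetric_maya (\<lambda>S. nat (energy S)) (\<lambda>S. b_pow (msum even_ind S))) n
      = fps_nth (\<Prod>a<2 * Suc n. 1 + fps_const (?c a) * fps_X ^ ?w a) n"
    using gf_finite_sets[of ?w n "2 * Suc n" ?c] by simp
  also have "(\<Prod>a<2 * M. 1 + fps_const (?c a) * fps_X ^ ?w a) = (\<Prod>j<M. 1 - ?a * ?z ^ j) * (\<Prod>j<M. 1 - ?b * ?z ^ j)" for M
  proof (induction M)
    case (Suc M)
    have 1: "1 + fps_const (?c (2 * M)) * fps_X ^ ?w (2 * M) = 1 - ?a * ?z ^ M"
    proof -
      have "fps_X ^ ?w (2 * M) = fps_X * ?z ^ M" by (simp flip: power_mult power_Suc)
      then show ?thesis by (simp add: mult.assoc)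
    qed
    have 2: "1 + fps_const (?c (Suc (2 * M))) * fps_X ^ ?w (Suc (2 * M)) = 1 - ?b * ?z ^ M"
    proof -
      have "?w (Suc (2 * M)) = 3 + 4 * M" by simp
      then have "fps_X ^ ?w (Suc (2 * M)) = fps_X ^ 3 * ?z ^ M" by (simp only: power_add power_mult)
      then show ?thesis by (simp add: mult.assoc)
    qed
    have "(\<Prod>a<2 * Suc M. 1 + fps_const (?c a) * fps_X ^ ?w a)
       = (\<Prod>a<2 * M. 1 + fps_const (?c a) * fps_X ^ ?w a) * (1 - ?a * ?z ^ M) * (1 - ?b * ?z ^ M)"
      unfolding 1[symmetric] 2[symmetric] by (simp add: mult.assoc)
    then show ?case unfolding Suc.IH prod.lessThan_Suc by (simp only: mult_ac)
  qed simp
  also have "fps_nth ((\<Prod>j<Suc n. 1 - ?a * ?z ^ j) * (\<Prod>j<Suc n. 1 - ?b * ?z ^ j)) n = fps_nth (qpoch_inf ?a ?z * qpoch_inf ?b ?z) n"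
    by (intro fps_mult_nth_cong qpoch_inf_nth[symmetric]) auto
  finally show "fps_nth (gf symmetric_maya (\<lambda>S. nat (energy S)) (\<lambda>S. b_pow (msum even_ind S))) n = fps_nth (qpoch_inf ?a ?z * qpoch_inf ?b ?z) n" .
qed

lemma hook_weight_maya0:
  assumes "S \<in> maya0"
  shows "hook_weight t (hooks S) = (x_var ^ 2 * scalar (1 / of_nat t ^ 2)) ^ nat (energy S) * scalar (1 / hook_prod S ^ 2)"
proof -
  have "(\<Prod>h\<in>#M. 1 / of_nat (t * h) :: rat) = (1 / of_nat t) ^ size M * (1 / (\<Prod>h\<in>#M. of_nat h))" for M
    by (induction M) (auto simp: field_simps)
  then have "(\<Prod>h\<in>#hooks S. 1 / of_nat (t * h) :: rat) = (1 / of_nat t) ^ nat (energy S) * (1 / hook_prod S)"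
    by (simp only: size_hooks[OF assms] prod_hooks)
  then show ?thesis
    unfolding hook_weight_def size_hooks[OF assms]
    by (simp only: power_mult_distrib scalar_mult scalar_power power_mult power_one_over power_one flip: power_mult)
      (simp add: mult_ac power_mult_distrib power_one_over scalar_power[symmetric] flip: power_mult)
qed

theorem corollary4p6:
  fixes k t :: nat and q :: "laurent fps"
  assumes "k \<ge> 1" and "t \<ge> 1" and "even t"
  defines "q \<equiv> fps_X"
  shows
    "((\<lambda>p. q ^ sum_list p *
         fps_const (x_var ^ size (hooks_div t p) * b_pow (BG_rank p) *
           scalar ((\<Prod>h\<in>#hooks_div t p. 1 / of_nat h) *
                   (\<Sum>h\<in>#hooks_div t p. of_nat h ^ (2 * k)))))
      has_sum
      (fps_const (scalar (of_nat t ^ (2 * k + 1)))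
        * qpoch_inf (q ^ (2 * t)) (q ^ (2 * t)) ^ (t div 2)
        * qpoch_inf (- (fps_const (b_pow 1) * q)) (q ^ 4)
        * qpoch_inf (- (fps_const (b_pow (-1)) * q ^ 3)) (q ^ 4)
        * exp_fps (fps_const (x_var ^ 2 * scalar (1 / of_nat (2 * t))) * q ^ (2 * t))
        * (\<Sum>i=0..k. fps_const (scalar (of_nat (central_factorial (k + 1) (i + 1)) * C_coeff i))
             * (fps_const (x_var ^ 2 * scalar (1 / of_nat t ^ 2)) * q ^ (2 * t)) ^ (i + 1))))
     self_conjugate"
proof -
  define m where "m = t div 2"
  have t: "t = 2 * m" and m: "0 < m" using assms by (auto simp: m_def)
  define a where "a = x_var ^ 2 * scalar (1 / of_nat t ^ 2)"
  define c where "c p = x_var ^ size (hooks_div t p) * b_pow (BG_rank p) *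
      scalar ((\<Prod>h\<in>#hooks_div t p. 1 / of_nat h) * (\<Sum>h\<in>#hooks_div t p. of_nat h ^ (2 * k)))" for p
  define E where "E = exp_fps (fps_const a * fps_X ^ (2 * t))"
  define R where "R = (\<Sum>i=0..k. fps_const (scalar (of_nat (central_factorial (k + 1) (i + 1)) * C_coeff i))
      * (fps_const a * fps_X ^ (2 * t)) ^ (i + 1))"
  define Q where "Q = (qpoch_inf (fps_X ^ (2 * t)) (fps_X ^ (2 * t)) :: laurent fps)"
  define B where "B = qpoch_inf (- (fps_const (b_pow 1) * fps_X)) (fps_X ^ 4) * qpoch_inf (- (fps_const (b_pow (-1)) * fps_X ^ 3)) (fps_X ^ 4)"
  define P where "P F = gf maya0 (\<lambda>S. 2 * t * nat (energy S)) (\<lambda>S. F (hooks S))" for F :: "nat multiset \<Rightarrow> laurent"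
  define F where "F i j M = (if j = i then hook_weight t M * scalar (hook_power t k M) else hook_weight t M)" for i j :: nat and M
  let ?R = "\<lambda>S j. residue_class (int t) (int j) S"
  have d: "0 < 2 * t" using assms by simp

  have P_weight: "P (hook_weight t) = E"
  proof -
    have "P (hook_weight t) = gf maya0 (\<lambda>S. 2 * t * nat (energy S)) (\<lambda>S. a ^ nat (energy S) * scalar (1 / hook_prod S ^ 2))"
      unfolding P_def a_def by (intro gf_cong refl hook_weight_maya0)
    then show ?thesis by (simp only: gf_plancherel[OF d] E_def)
  qed
  have P_power: "P (\<lambda>M. hook_weight t M * scalar (hook_power t k M)) = fps_const (scalar (2 * of_nat t ^ (2 * k))) * R * E"
  proof -
    have "P (\<lambda>M. hook_weight t M * scalar (hook_power t k M)) = gf maya0 (\<lambda>S. 2 * t * nat (energy S))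
        (\<lambda>S. scalar (2 * of_nat t ^ (2 * k)) * (a ^ nat (energy S) * scalar (hook_power_sum k S / hook_prod S ^ 2)))"
      unfolding P_def
    proof (intro gf_cong refl)
      fix S assume S: "S \<in> maya0"
      have e: "1 / hook_prod S ^ 2 * (2 * of_nat t ^ (2 * k) * hook_power_sum k S)
          = 2 * of_nat t ^ (2 * k) * (hook_power_sum k S / hook_prod S ^ 2)" by simp
      have "hook_weight t (hooks S) * scalar (hook_power t k (hooks S))
          = a ^ nat (energy S) * scalar (1 / hook_prod S ^ 2 * (2 * of_nat t ^ (2 * k) * hook_power_sum k S))"
        unfolding hook_weight_maya0[OF S] hook_power_def sum_hooks a_def by (simp only: scalar_mult mult.assoc)
      then show "hook_weight t (hooks S) * scalar (hook_power t k (hooks S))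
          = scalar (2 * of_nat t ^ (2 * k)) * (a ^ nat (energy S) * scalar (hook_power_sum k S / hook_prod S ^ 2))"
        unfolding e by (simp only: scalar_mult mult.left_commute)
    qed
    then show ?thesis unfolding gf_cmult gf_okada_panova[OF d] E_def[symmetric] R_def by (simp only: mult_ac)
  qed
  have P_one: "P (\<lambda>_. 1) * Q = 1"
    unfolding P_def Q_def by (rule gf_partitions[OF d])

  \<comment> \<open>With weight 1 each class contributes its core series divided by
    \<open>Q\<close>, so multiplication by \<open>Q ^ m\<close> isolates the core series.\<close>
  have core: "(\<Prod>j<m. core_series t j) = B * Q ^ m"
  proof -
    have "B = gf symmetric_maya (\<lambda>S. nat (energy S)) (\<lambda>S. \<Prod>j<m. b_pow ((-1) ^ j * charge (?R S j)) * 1)"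
      unfolding B_def gf_even_ind[symmetric]
    proof (intro gf_cong refl)
      fix S assume S: "S \<in> symmetric_maya"
      show "b_pow (msum even_ind S) = (\<Prod>j<m. b_pow ((-1) ^ j * charge (?R S j)) * 1)"
        using even_ind_residues[OF S _ m, of "int t"] t by (simp add: b_pow_sum)
    qed
    also have "\<dots> = (\<Prod>j<m. core_series t j * P (\<lambda>_. 1))"
      unfolding P_def by (rule gf_symmetric_maya[OF t m])
    finally have "B * Q ^ m = (\<Prod>j<m. core_series t j) * (P (\<lambda>_. 1) * Q) ^ m"
      by (simp add: prod.distrib power_mult_distrib)
    then show ?thesis by (simp add: P_one)
  qed

  have bij: "bij_betw beads self_conjugate symmetric_maya" by (rule bij_betw_beads)
  have weight: "nat (energy (beads p)) = sum_list p" if "p \<in> self_conjugate" for p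
    using that energy_beads by (simp add: self_conjugate_def)
  have "gf symmetric_maya (\<lambda>S. nat (energy S)) (\<lambda>S. \<Sum>i<m. \<Prod>j<m. b_pow ((-1) ^ j * charge (?R S j)) * F i j (hooks (?R S j)))
      = gf self_conjugate sum_list c"
  proof (rule gf_reindex[OF bij])
    fix p assume p: "p \<in> self_conjugate"
    then show "nat (energy (beads p)) = sum_list p" by (rule weight)
    from p show "(\<Sum>i<m. \<Prod>j<m. b_pow ((-1) ^ j * charge (?R (beads p) j)) * F i j (hooks (?R (beads p) j))) = c p"
      unfolding c_def F_def by (rule hooks_div_weight[OF _ t m, symmetric])
  qed
  then have "gf self_conjugate sum_list c = (\<Sum>i<m. \<Prod>j<m. core_series t j * P (F i j))"
    unfolding gf_sum gf_symmetric_maya[OF t m] P_def by simp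
  \<comment> \<open>The summands do not depend on \<open>i\<close>: whichever class carries the
    power sum, the factor \<open>R\<close> occurs once and \<open>E\<close> occurs \<open>m\<close>
    times.\<close>
  also have "\<dots> = (\<Sum>i<m. B * Q ^ m * (E ^ m * (fps_const (scalar (2 * of_nat t ^ (2 * k))) * R)))"
  proof (intro sum.cong refl)
    fix i assume "i \<in> {..<m}"
    then have i: "i < m" by simp
    have "P (F i j) = E * (if j = i then fps_const (scalar (2 * of_nat t ^ (2 * k))) * R else 1)" for j
      using P_weight P_power unfolding F_def by (cases "j = i") (simp_all add: mult_ac)
    then have "(\<Prod>j<m. core_series t j * P (F i j)) = (\<Prod>j<m. core_series t j) * (E ^ m * (fps_const (scalar (2 * of_nat t ^ (2 * k))) * R))"
      using i by (simp add: prod.distrib)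
    then show "(\<Prod>j<m. core_series t j * P (F i j)) = B * Q ^ m * (E ^ m * (fps_const (scalar (2 * of_nat t ^ (2 * k))) * R))"
      by (simp only: core)
  qed
  also have "\<dots> = of_nat m * fps_const (scalar (2 * of_nat t ^ (2 * k))) * Q ^ m * B * E ^ m * R"
    by (simp add: mult_ac)
  \<comment> \<open>The \<open>m\<close> choices of the class and the mirror factor 2 combine to
    \<open>2 * m = t\<close>, the last power of \<open>t\<close>.\<close>
  also have "of_nat m * fps_const (scalar (2 * of_nat t ^ (2 * k))) = fps_const (scalar (of_nat t ^ (2 * k + 1)))"
  proof -
    have "(of_nat t ^ (2 * k + 1) :: rat) = of_nat m * (2 * of_nat t ^ (2 * k))" by (simp add: t)
    then show ?thesis by (simp only: scalar_mult scalar_of_nat fps_of_nat[symmetric] fps_const_mult)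
  qed
  \<comment> \<open>The power multiplies the exponent by \<open>m\<close>, and
    \<open>m / t ^ 2 = 1 / (2 * t)\<close>.\<close>
  also have "E ^ m = exp_fps (fps_const (x_var ^ 2 * scalar (1 / of_nat (2 * t))) * fps_X ^ (2 * t))"
  proof -
    have "(of_nat m * (1 / of_nat t ^ 2) :: rat) = 1 / of_nat (2 * t)" using m by (simp add: t power2_eq_square)
    then have "scalar (1 / of_nat (2 * t)) = of_nat m * scalar (1 / of_nat t ^ 2)"
      by (simp only: scalar_mult[symmetric] scalar_of_nat[symmetric])
    then have "of_nat m * a = x_var ^ 2 * scalar (1 / of_nat (2 * t))" by (simp only: a_def mult.left_commute)
    then show ?thesis unfolding E_def exp_fps_power[OF d] by simp
  qed
  finally have total: "gf self_conjugate sum_list c = fps_const (scalar (of_nat t ^ (2 * k + 1))) * Q ^ m * B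
      * exp_fps (fps_const (x_var ^ 2 * scalar (1 / of_nat (2 * t))) * fps_X ^ (2 * t)) * R" .

  have "graded symmetric_maya (\<lambda>S. nat (energy S))"
    unfolding graded_def
  proof
    fix n
    have "{S\<in>symmetric_maya. nat (energy S) = n} \<subseteq> {S. maya S \<and> energy S = int n}"
      using energy_nonneg symmetric_mayaD(1) by auto
    moreover have "finite {S. maya S \<and> energy S = int n}" by (rule finite_msum_fiber) auto
    ultimately show "finite {S\<in>symmetric_maya. nat (energy S) = n}" by (rule finite_subset)
  qed
  then have "graded self_conjugate sum_list"
    using bij_betw_finite[OF bij_betw_level[of beads self_conjugate symmetric_maya "\<lambda>S. nat (energy S)" sum_list, OF bij weight]] unfolding graded_def by blast
  from has_sum_gf[OF this, of c] show ?thesis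
    unfolding total q_def c_def Q_def B_def R_def a_def m_def by (simp only: mult.assoc)
qed

end
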